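(* Let $\Omega\subset\mathbb{R}^N$ be a bounded open set with $\Omega\subset B_R$ for some $R>0$. Let $s_\sharp\in(0,1)$, $\kappa\ge0$, and let $f\not\equiv0$ be a measurable integrable function on $(0,1)$ such that $f\ge0$ in $(s_\sharp,1)$, $\int_{s_\sharp}^1f(s)\,ds>0$ and $$\int_0^{s_\sharp}\max\{0,-f(s)\}\,ds\le\kappa\int_{s_\sharp}^1f(s)\,ds.$$ Assume additionally that there exists $\delta\in(0,1-s_\sharp]$ such that $$\int_0^{s_\sharp}\max\{0,-f(s)\}\,ds\le\bar\kappa\,\delta\int_{s_\sharp}^{1-\delta}f(s)\,ds,$$ where $\bar\kappa>0$ is a small enough constant as specified in the context. Assume $\frac N{s_\sharp}>p\ge2$, put $p_{s_\sharp}^*:=\frac{pN}{N-s_\sharp p}$, and let $m,q$ be real constants with $1\le m<p\le q<p_{s_\sharp}^*$. Then there exists an open interval $\Lambda\subset(0,+\infty)$ such that, for every $\lambda\in\Lambda$, the problem $$\int_0^1f(s)(-\Delta_p)^su\,ds=|u|^{p_{s_\sharp}^*-2}u+\lambda(|u|^{m-1}+|u|^{q-1})\ \text{ in }\Omega,\qquad u=0\ \text{ in }\mathbb{R}^N\setminus\Omega,$$ has at least one nonnegative nontrivial weak solution $u_\lambda\in\mathbb{X}(\Omega)$.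
   Context: For $s\in(0,1)$ put $C_{N,p,s}:=\frac{\frac{sp}{2}(1-s)2^{2s-1}}{\pi^{(N-1)/2}}\frac{\Gamma(\frac{N+ps}{2})}{\Gamma(\frac{p+1}{2})\Gamma(2-s)}$ and $[u]_{s,p}:=\left(C_{N,p,s}\iint_{\mathbb{R}^{2N}}\frac{|u(x)-u(y)|^p}{|x-y|^{N+sp}}dx\,dy\right)^{1/p}$. $\mathbb{X}(\Omega)$ is the space of measurable $u:\mathbb{R}^N\to\mathbb{R}$ with $u=0$ in $\mathbb{R}^N\setminus\Omega$ and finite norm $\left(\int_0^1\max\{f(s),0\}[u]_{s,p}^p\,ds\right)^{1/p}$. The operator is $(-\Delta_p)^su(x)=2C_{N,p,s}\lim_{\varepsilon\searrow0}\int_{\mathbb{R}^N\setminus B_\varepsilon(x)}\frac{|u(x)-u(y)|^{p-2}(u(x)-u(y))}{|x-y|^{N+sp}}dy$. Put $E_s(u,v):=C_{N,p,s}\iint_{\mathbb{R}^{2N}}\frac{|u(x)-u(y)|^{p-2}(u(x)-u(y))(v(x)-v(y))}{|x-y|^{N+sp}}dx\,dy$. A weak solution is $u\in\mathbb{X}(\Omega)$ with $\int_0^1f(s)E_s(u,v)\,ds=\int_\Omega\left(|u|^{p_{s_\sharp}^*-2}u+\lambda(|u|^{m-1}+|u|^{q-1})\right)v\,dx$ for all $v\in\mathbb{X}(\Omega)$. The constant $\bar\kappa>0$: it may be taken smaller than $\frac{s_\sharp\,\underline\Gamma_{N,p}}{4\,\bar\Gamma_{N,p}\max\{1,(2R)^p\}}$,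 where $\bar\Gamma_{N,p}:=\max_{s\in[0,1]}\frac{\Gamma(\frac{N+ps}{2})}{\Gamma(2-s)}$ and $\underline\Gamma_{N,p}:=\min_{s\in[0,1]}\frac{\Gamma(\frac{N+ps}{2})}{\Gamma(2-s)}$. *)

theory Defs
  imports "HOL-Analysis.Analysis"
begin

(* Power with a real exponent and base x >= 0 under the convention x^0 = 1 for every x,
   including x = 0, whereas 0 powr 0 = 0.  This matters for |u|^(m-1) when m = 1. *)
definition rpow :: "real \<Rightarrow> real \<Rightarrow> real" where
  "rpow x a = (if a = 0 then 1 else x powr a)"

(* Only used for a > 0. *)
definition ennpowr :: "ennreal \<Rightarrow> real \<Rightarrow> ennreal" where
  "ennpowr x a = (if x = top then top else ennreal (enn2real x powr a))"

definition frac_const :: "nat \<Rightarrow> real \<Rightarrow> real \<Rightarrow> real" where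
  "frac_const N p s =
     (s * p / 2 * (1 - s) * 2 powr (2 * s - 1)) / pi powr ((real N - 1) / 2)
     * (Gamma ((real N + p * s) / 2) / (Gamma ((p + 1) / 2) * Gamma (2 - s)))"

(* [u]_{s,p}, possibly infinite. On the diagonal x = y, a null set, the integrand is 0. *)
definition frac_seminorm ::
  "real \<Rightarrow> real \<Rightarrow> (real ^ 'n \<Rightarrow> real) \<Rightarrow> ennreal" where
  "frac_seminorm s p u =
     ennpowr
       (ennreal (frac_const CARD('n) p s) *
        (\<integral>\<^sup>+ (x, y). ennreal
            (\<bar>u x - u y\<bar> powr p / norm (x - y) powr (real CARD('n) + s * p))
          \<partial>(lebesgue :: ((real ^ 'n) \<times> (real ^ 'n)) measure)))
       (1 / p)"

definition X_norm ::
  "(real \<Rightarrow> real) \<Rightarrow> real \<Rightarrow> (real ^ 'n \<Rightarrow> real) \<Rightarrow> ennreal" where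
  "X_norm f p u =
     ennpowr
       (\<integral>\<^sup>+ s \<in> {0<..<1}. ennreal (max (f s) 0) * ennpowr (frac_seminorm s p u) p \<partial>lebesgue)
       (1 / p)"

definition X_space ::
  "(real \<Rightarrow> real) \<Rightarrow> real \<Rightarrow> (real ^ 'n) set \<Rightarrow> (real ^ 'n \<Rightarrow> real) set" where
  "X_space f p \<Omega> =
     {u. u \<in> borel_measurable lebesgue \<and> (\<forall>x. x \<notin> \<Omega> \<longrightarrow> u x = 0) \<and> X_norm f p u < top}"

definition frac_integrand ::
  "real \<Rightarrow> real \<Rightarrow> (real ^ 'n \<Rightarrow> real) \<Rightarrow> (real ^ 'n \<Rightarrow> real) \<Rightarrow> (real ^ 'n) \<times> (real ^ 'n) \<Rightarrow> real" where
  "frac_integrand s p u v =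
     (\<lambda>(x, y). rpow \<bar>u x - u y\<bar> (p - 2) * (u x - u y) * (v x - v y)
        / norm (x - y) powr (real CARD('n) + s * p))"

definition frac_form ::
  "real \<Rightarrow> real \<Rightarrow> (real ^ 'n \<Rightarrow> real) \<Rightarrow> (real ^ 'n \<Rightarrow> real) \<Rightarrow> real" where
  "frac_form s p u v =
     frac_const CARD('n) p s * integral\<^sup>L lebesgue (frac_integrand s p u v)"

(* Weak solutions of  int_0^1 f(s) (-Delta_p)^s u ds = g(u) in Omega,  u = 0 outside Omega.
   A Bochner integral of a non-integrable function is 0, so the existence of all the integrals
   in the weak formulation is required explicitly. *)
definition weak_solution ::
  "(real \<Rightarrow> real) \<Rightarrow> real \<Rightarrow> (real ^ 'n) set \<Rightarrow> (real \<Rightarrow> real) \<Rightarrow> (real ^ 'n \<Rightarrow> real) \<Rightarrow> bool" where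
  "weak_solution f p \<Omega> g u \<longleftrightarrow>
     u \<in> X_space f p \<Omega> \<and>
     (\<forall>v \<in> X_space f p \<Omega>.
        (AE s in lebesgue. s \<in> {0<..<1} \<and> f s \<noteq> 0 \<longrightarrow>
           integrable lebesgue (frac_integrand s p u v)) \<and>
        set_integrable lebesgue {0<..<1} (\<lambda>s. f s * frac_form s p u v) \<and>
        set_integrable lebesgue \<Omega> (\<lambda>x. g (u x) * v x) \<and>
        (LINT s:{0<..<1}|lebesgue. f s * frac_form s p u v) =
          (LINT x:\<Omega>|lebesgue. g (u x) * v x))"

definition crit_exp :: "nat \<Rightarrow> real \<Rightarrow> real \<Rightarrow> real" where
  "crit_exp N p s = p * real N / (real N - s * p)"

(* The supremum and infimum are attained, since the function is continuous on [0,1]. *)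
definition Gamma_upper :: "nat \<Rightarrow> real \<Rightarrow> real" where
  "Gamma_upper N p = (SUP s\<in>{0..1}. Gamma ((real N + p * s) / 2) / Gamma (2 - s))"

definition Gamma_lower :: "nat \<Rightarrow> real \<Rightarrow> real" where
  "Gamma_lower N p = (INF s\<in>{0..1}. Gamma ((real N + p * s) / 2) / Gamma (2 - s))"

end

theory Submission imports Defs begin

text \<open>
  Put \<open>K(z) = \<integral> f(s) C\<^bsub>N,p,s\<^esub> |z|\<^bsup>-N-sp\<^esup> ds\<close>. For functions vanishing off \<open>\<Omega> \<subseteq> B\<^sub>R\<close>, a pair of
  points at distance at least \<open>2R\<close> interacts only through the total mass of the kernel there, because
  one of the two values is zero. The smallness condition ensures that the negative part of
  \<open>K\<close> is at most a quarter of the positive part, pointwise for \<open>|z| < 2R\<close> and in mass for \<open>|z| \<ge> 2R\<close>. Hence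
  the operator is that of a nonnegative kernel comparable to \<open>K\<^sup>+\<close>: its energy is convex and dominates
  \<open>\<tau> \<integral> |u|\<^sup>p\<close> for some \<open>\<tau> > 0\<close>, and the comparison principle holds.

  The constant \<open>M\<close> is a supersolution as soon as \<open>g(M) \<le> \<tau> M\<^bsup>p-1\<^esup>\<close>, where \<open>g\<close> is the right-hand side; as
  the critical exponent exceeds \<open>p\<close>, this holds for a small \<open>M\<close> and then for all small \<open>\<lambda>\<close>. Since \<open>g\<close> is
  nondecreasing, monotone iteration from \<open>M\<close> converges to a solution between \<open>0\<close> and \<open>M\<close>, with no Sobolev
  embedding or compactness. It is nontrivial because the same iteration, started at a small multiple
  of a bump where the energy functional is negative (\<open>m < p\<close>), stays below it and decreases the functional.
\<close>

section \<open>Pointwise inequalities for powers\<close>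

text \<open>Smallness cannot make the signed kernel nonnegative everywhere. For s < s' the ratio
  |z|^(-sp) / |z|^(-s'p) = |z|^((s'-s)p) is unbounded at infinity, so negative contributions of
  small order may win far away. For |z| < 2R the ratio is at most max 1 ((2R)^p), which is where
  that factor of the constant comes from; the other factors bound the ratio of C_{N,p,s} to
  C_{N,p,s'} when s lies below s_sharp and s' between s_sharp and 1 - \<delta>. Beyond 2R the form
  equals twice the mass times the integral of |u|^(p-2) u v, so any even kernel of the same mass
  does equally well there, in particular a multiple of the positive part.

  The mass beyond 2R doubles as a Poincare constant: every point of \<Omega> sees it outside
  \<Omega>, where admissible functions vanish. It is the source of all coercivity and the reason why
  a constant can be a supersolution although the equation has no zero-order term.

  Minimizers are ordered only almost everywhere, and test functions are merely Lebesgue measurable.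
  The analysis runs on Borel functions that vanish at every point off \<Omega>; the two settings are
  matched at the end.\<close>

definition sgpow :: "real \<Rightarrow> real \<Rightarrow> real" where
  "sgpow p t = rpow \<bar>t\<bar> (p - 2) * t"

text \<open>This form of the derivative of |t|^p / p has no case distinction at p = 2.
  \<open>sgpow\<close> itself keeps the \<open>rpow\<close> of \<open>frac_integrand\<close>, so
  that the two match literally.\<close>

lemma sgpow_altdef:
  assumes "p \<ge> 2" shows "sgpow p t = sgn t * \<bar>t\<bar> powr (p - 1)"
proof (cases "t = 0")
  case False
  have "rpow \<bar>t\<bar> (p - 2) = \<bar>t\<bar> powr (p - 2)"
    using False by (auto simp: rpow_def)
  moreover have "\<bar>t\<bar> powr (p - 1) = \<bar>t\<bar> powr (p - 2) * \<bar>t\<bar>"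
    using False powr_add[of "\<bar>t\<bar>" "p - 2" 1] by simp
  ultimately show ?thesis
    unfolding sgpow_def by (simp add: sgn_if)
qed (simp add: sgpow_def)

lemma powr_minus_one_mult: "a \<ge> 0 \<Longrightarrow> a powr (r - 1) * a = a powr r" for a r :: real
  by (cases "a = 0") (auto simp: powr_diff)

lemma sgpow_0 [simp]: "sgpow p 0 = 0"
  by (simp add: sgpow_def)

lemma sgpow_minus [simp]: "sgpow p (- t) = - sgpow p t"
  by (simp add: sgpow_def)

lemma sgpow_mult_self:
  assumes "p \<ge> 2" shows "sgpow p t * t = \<bar>t\<bar> powr p"
  using powr_minus_one_mult[of "\<bar>t\<bar>" p]
  by (auto simp: sgpow_altdef[OF assms] sgn_if)

lemma abs_sgpow:
  assumes "p \<ge> 2" shows "\<bar>sgpow p t\<bar> = \<bar>t\<bar> powr (p - 1)"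
  by (auto simp: sgpow_altdef[OF assms] abs_mult sgn_if)

text \<open>A crude Young inequality: both factors are bounded by powers of the larger of |a| and
  |b|. It is the domination behind the integrability of every form, given finite energy of both
  arguments.\<close>

lemma abs_sgpow_mult_le:
  assumes "p \<ge> 2" shows "\<bar>sgpow p a * b\<bar> \<le> \<bar>a\<bar> powr p + \<bar>b\<bar> powr p"
proof -
  define c where "c = max \<bar>a\<bar> \<bar>b\<bar>"
  have "\<bar>sgpow p a * b\<bar> = \<bar>a\<bar> powr (p - 1) * \<bar>b\<bar>"
    by (simp add: abs_mult abs_sgpow[OF assms])
  also have "\<dots> \<le> c powr (p - 1) * c"
    using assms by (intro mult_mono powr_mono2) (auto simp: c_def)
  also have "\<dots> = c powr p"
    by (rule powr_minus_one_mult) (auto simp: c_def)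
  also have "\<dots> \<le> \<bar>a\<bar> powr p + \<bar>b\<bar> powr p"
    by (auto simp: c_def max_def)
  finally show ?thesis .
qed

lemma continuous_on_sgpow:
  assumes "p \<ge> 2" shows "continuous_on UNIV (sgpow p)"
proof (cases "p = 2")
  case True
  then show ?thesis by (auto simp: sgpow_def[abs_def] rpow_def)
next
  case False
  then have "sgpow p = (\<lambda>t. \<bar>t\<bar> powr (p - 2) * t)"
    by (auto simp: sgpow_def rpow_def)
  moreover have "continuous_on UNIV (\<lambda>t::real. \<bar>t\<bar> powr (p - 2) * t)"
    using False assms by (intro continuous_on_mult continuous_on_powr' continuous_intros) auto
  ultimately show ?thesis by simp
qed

lemma borel_measurable_sgpow [measurable]: "p \<ge> 2 \<Longrightarrow> sgpow p \<in> borel_measurable borel"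
  using continuous_on_sgpow by (intro borel_measurable_continuous_onI)

lemma tendsto_sgpow [tendsto_intros]:
  assumes "p \<ge> 2" "(f \<longlongrightarrow> a) F" shows "((\<lambda>x. sgpow p (f x)) \<longlongrightarrow> sgpow p a) F"
  using continuous_on_tendsto_compose[OF continuous_on_sgpow[OF assms(1)] assms(2)] by simp

lemma sgpow_strict_mono:
  assumes p: "p \<ge> 2" and "a < b" shows "sgpow p a < sgpow p b"
proof -
  note [simp] = sgpow_altdef[OF p]
  consider "a \<ge> 0" | "a < 0" "b > 0" | "b \<le> 0" using \<open>a < b\<close> by linarith
  then show ?thesis
  proof cases
    case 1
    then have "a powr (p - 1) < b powr (p - 1)"
      using assms by (intro powr_less_mono2) auto
    with 1 assms show ?thesis by (auto simp: sgn_if)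
  next
    case 2
    then have "\<bar>a\<bar> powr (p - 1) > 0" "\<bar>b\<bar> powr (p - 1) > 0" by auto
    with 2 have "sgpow p a < 0" "sgpow p b > 0" by (auto simp: sgn_if)
    then show ?thesis by linarith
  next
    case 3
    then have "\<bar>b\<bar> powr (p - 1) < \<bar>a\<bar> powr (p - 1)"
      using assms by (intro powr_less_mono2) auto
    with 3 assms show ?thesis by (auto simp: sgn_if)
  qed
qed

lemma rpow_nonneg [simp]: "rpow a r \<ge> 0"
  by (simp add: rpow_def)

lemma rpow_mono: "0 \<le> a \<Longrightarrow> a \<le> b \<Longrightarrow> 0 \<le> r \<Longrightarrow> rpow a r \<le> rpow b r"
  by (auto simp: rpow_def intro: powr_mono2)

lemma tendsto_rpow:
  assumes "(f \<longlongrightarrow> a) F" "a \<ge> 0" "r \<ge> 0" "\<And>x. f x \<ge> 0"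
  shows "((\<lambda>x. rpow (f x) r) \<longlongrightarrow> rpow a r) F"
proof (cases "r = 0")
  case False
  then show ?thesis
    using assms by (auto simp: rpow_def intro!: tendsto_powr2 tendsto_const always_eventually)
qed (simp add: rpow_def)

lemma borel_measurable_rpow [measurable]:
  "f \<in> borel_measurable M \<Longrightarrow> (\<lambda>x. rpow (f x) r) \<in> borel_measurable M"
  unfolding rpow_def by (cases "r = 0") auto

text \<open>The tangent line of the convex function t^r lies below its graph; Young's inequality
  with exponents r and r / (r - 1) gives this without derivatives. For r = 1 the slope is
  \<open>rpow a 0 = 1\<close> at every a, also at 0, as in the nonlinearity with m = 1.\<close>

lemma powr_subgradient:
  assumes "r \<ge> 1" "a \<ge> 0" "b \<ge> 0"
  shows "a powr r + r * (rpow a (r - 1) * (b - a)) \<le> b powr r"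
proof (cases "r = 1")
  case True
  with assms show ?thesis by (simp add: rpow_def)
next
  case False
  with assms have r: "r > 1" by simp
  have "b * a powr (r - 1) \<le> b powr r / r + (a powr (r - 1)) powr (r / (r - 1)) / (r / (r - 1))"
    using r assms by (intro Youngs_inequality) (auto simp: field_simps)
  also have "(a powr (r - 1)) powr (r / (r - 1)) = a powr r"
    using r by (simp add: powr_powr)
  finally have "r * (b * a powr (r - 1)) \<le> b powr r + (r - 1) * a powr r"
    using r by (simp add: field_simps)
  moreover have "a powr (r - 1) * a = a powr r"
    using assms by (intro powr_minus_one_mult)
  ultimately show ?thesis
    using r by (simp add: rpow_def algebra_simps)
qed

text \<open>The tangent inequality on the whole line follows from the one for absolute values, since
  \<open>sgpow p a * b\<close> is at most |a|^(p-1) |b|.\<close>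

lemma sgpow_subgradient:
  assumes "p \<ge> 2"
  shows "\<bar>a\<bar> powr p + p * (sgpow p a * (b - a)) \<le> \<bar>b\<bar> powr p"
proof -
  have "\<bar>a\<bar> powr p + p * (\<bar>a\<bar> powr (p - 1) * (\<bar>b\<bar> - \<bar>a\<bar>)) \<le> \<bar>b\<bar> powr p"
    using powr_subgradient[of p "\<bar>a\<bar>" "\<bar>b\<bar>"] assms by (simp add: rpow_def)
  moreover have "sgpow p a * b \<le> \<bar>a\<bar> powr (p - 1) * \<bar>b\<bar>"
    using abs_ge_self[of "sgpow p a * b"] by (simp add: abs_mult abs_sgpow[OF assms])
  then have "sgpow p a * (b - a) \<le> \<bar>a\<bar> powr (p - 1) * (\<bar>b\<bar> - \<bar>a\<bar>)"
    using sgpow_mult_self[OF assms, of a] powr_minus_one_mult[of "\<bar>a\<bar>" p]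
    by (simp add: algebra_simps)
  ultimately show ?thesis
    using assms by (smt (verit) mult_left_mono)
qed

text \<open>Clarkson's inequality: with r = p / 2 \<ge> 1, superadditivity of t^r, the parallelogram
  identity and convexity of t^r apply in turn. The surplus term with a - b turns minimizing
  sequences into Cauchy sequences, in place of weak compactness.\<close>

lemma clarkson_powr:
  fixes a b p :: real
  assumes "p \<ge> 2"
  shows "\<bar>(a + b) / 2\<bar> powr p + \<bar>(a - b) / 2\<bar> powr p \<le> (\<bar>a\<bar> powr p + \<bar>b\<bar> powr p) / 2"
proof -
  define r where "r = p / 2"
  have r: "r \<ge> 1" using assms by (simp add: r_def)
  have sq: "\<bar>t\<bar> powr p = (t\<^sup>2) powr r" for t :: real
  proof (cases "t = 0")
    case False
    have "(t\<^sup>2) powr r = (\<bar>t\<bar> powr 2) powr r" using False by (simp add: powr_numeral)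
    also have "\<dots> = \<bar>t\<bar> powr p" unfolding powr_powr r_def by simp
    finally show ?thesis ..
  qed simp
  have super: "x powr r + y powr r \<le> (x + y) powr r" if "x \<ge> 0" "y \<ge> 0" for x y :: real
  proof -
    have "x powr r + y powr r = x powr (r - 1) * x + y powr (r - 1) * y"
      using that by (simp add: powr_minus_one_mult)
    also have "\<dots> \<le> (x + y) powr (r - 1) * x + (x + y) powr (r - 1) * y"
      using that r by (intro add_mono mult_right_mono powr_mono2) auto
    also have "\<dots> = (x + y) powr r"
      using that powr_minus_one_mult[of "x + y" r] by (simp add: algebra_simps)
    finally show ?thesis .
  qed
  have mid: "((x + y) / 2) powr r \<le> (x powr r + y powr r) / 2" if "x \<ge> 0" "y \<ge> 0" for x y :: real
  proof -
    define m where "m = (x + y) / 2"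
    have "m powr r + r * (rpow m (r - 1) * (x - m)) \<le> x powr r"
      "m powr r + r * (rpow m (r - 1) * (y - m)) \<le> y powr r"
      using that r unfolding m_def by (auto intro!: powr_subgradient)
    moreover have "r * (rpow m (r - 1) * (x - m)) + r * (rpow m (r - 1) * (y - m)) = 0"
      by (simp add: m_def field_simps)
    ultimately show ?thesis by (simp add: m_def[symmetric])
  qed
  have "\<bar>(a + b) / 2\<bar> powr p + \<bar>(a - b) / 2\<bar> powr p
      = (((a + b) / 2)\<^sup>2) powr r + (((a - b) / 2)\<^sup>2) powr r"
    unfolding sq ..
  also have "\<dots> \<le> (((a + b) / 2)\<^sup>2 + ((a - b) / 2)\<^sup>2) powr r"
    by (intro super) auto
  also have "((a + b) / 2)\<^sup>2 + ((a - b) / 2)\<^sup>2 = (a\<^sup>2 + b\<^sup>2) / 2"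
    by (simp add: power2_eq_square field_simps)
  also have "\<dots> powr r \<le> ((a\<^sup>2) powr r + (b\<^sup>2) powr r) / 2"
    by (intro mid) auto
  finally show ?thesis by (simp add: sq)
qed

lemma abs_powr_add_le:
  fixes a b p :: real
  assumes "p \<ge> 1"
  shows "\<bar>a + b\<bar> powr p \<le> 2 powr p * (\<bar>a\<bar> powr p + \<bar>b\<bar> powr p)"
proof -
  have "\<bar>a + b\<bar> powr p \<le> (2 * max \<bar>a\<bar> \<bar>b\<bar>) powr p"
    using assms by (intro powr_mono2) auto
  also have "\<dots> = 2 powr p * max \<bar>a\<bar> \<bar>b\<bar> powr p"
    by (intro powr_mult)
  also have "\<dots> \<le> 2 powr p * (\<bar>a\<bar> powr p + \<bar>b\<bar> powr p)"
    by (intro mult_left_mono) (auto simp: max_def)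
  finally show ?thesis .
qed

text \<open>The increments of \<open>d\<^sup>+\<close> have the sign of those of \<open>d = u\<^sub>1 - u\<^sub>2\<close>: testing the difference of
  two equations with \<open>(u\<^sub>1 - u\<^sub>2)\<^sup>+\<close> gives the comparison principle.\<close>

lemma sgpow_diff_pos_part:
  fixes d e :: real
  assumes "p \<ge> 2" "a - b = d - e"
  shows "(sgpow p a - sgpow p b) * (max d 0 - max e 0) \<ge> 0"
    and "(sgpow p a - sgpow p b) * (max d 0 - max e 0) = 0 \<Longrightarrow> max d 0 = max e 0"
proof -
  consider "d < e" "a < b" | "d = e" "a = b" | "d > e" "a > b" using assms(2) by linarith
  then have "(sgpow p a - sgpow p b) * (max d 0 - max e 0) \<ge> 0 \<and>
    ((sgpow p a - sgpow p b) * (max d 0 - max e 0) = 0 \<longrightarrow> max d 0 = max e 0)"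
  proof cases
    case 1
    then have "sgpow p a - sgpow p b < 0" "max d 0 - max e 0 \<le> 0"
      using sgpow_strict_mono[OF assms(1), of a b] by auto
    then show ?thesis by (auto simp: mult_nonpos_nonpos)
  next
    case 3
    then have "sgpow p a - sgpow p b > 0" "max d 0 - max e 0 \<ge> 0"
      using sgpow_strict_mono[OF assms(1), of b a] by auto
    then show ?thesis by auto
  qed auto
  then show "(sgpow p a - sgpow p b) * (max d 0 - max e 0) \<ge> 0"
    and "(sgpow p a - sgpow p b) * (max d 0 - max e 0) = 0 \<Longrightarrow> max d 0 = max e 0"
    by auto
qed

section \<open>Energies of nonnegative kernels\<close>

text \<open>Strips over a null set are null in the product. This is why energies and forms do not
  notice a change of a function on a null set.\<close>

lemma AE_lborel_pair:
  fixes P :: "'a::euclidean_space \<Rightarrow> bool"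
  assumes "AE x in lborel. P x"
  shows "AE z in (lborel :: ('a \<times> 'a) measure). P (fst z) \<and> P (snd z)"
proof -
  obtain N :: "'a set" where N: "N \<in> sets lborel" "emeasure lborel N = 0" "{x. \<not> P x} \<subseteq> N"
    using assms by (auto elim!: AE_E)
  have "emeasure (lborel \<Otimes>\<^sub>M lborel :: ('a \<times> 'a) measure) (N \<times> UNIV) = 0"
    using N lborel.emeasure_pair_measure_Times[of N lborel "UNIV :: 'a set"] by simp
  moreover have "emeasure (lborel \<Otimes>\<^sub>M lborel :: ('a \<times> 'a) measure) (UNIV \<times> N) = 0"
    using N lborel.emeasure_pair_measure_Times[of "UNIV :: 'a set" lborel N] by simp
  moreover have "N \<times> UNIV \<in> sets (lborel \<Otimes>\<^sub>M lborel)" "UNIV \<times> N \<in> sets (lborel \<Otimes>\<^sub>M lborel)"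
    using N by auto
  ultimately have "N \<times> UNIV \<union> UNIV \<times> N \<in> null_sets (lborel :: ('a \<times> 'a) measure)"
    unfolding lborel_prod by (intro null_sets.Un) (auto simp: null_sets_def)
  then show ?thesis
    by (rule AE_I') (use N in auto)
qed

lemma borel_measurable_fst [measurable]:
    "fst \<in> borel_measurable (borel :: ('a::topological_space \<times> 'b::topological_space) measure)"
  and borel_measurable_snd [measurable]:
    "snd \<in> borel_measurable (borel :: ('a::topological_space \<times> 'b::topological_space) measure)"
  by (auto intro!: borel_measurable_continuous_onI continuous_intros)

definition incr :: "('a \<Rightarrow> real) \<Rightarrow> 'a \<times> 'a \<Rightarrow> real" where
  "incr u z = u (fst z) - u (snd z)"

lemma incr_measurable [measurable]:
  fixes u :: "'a::topological_space \<Rightarrow> real"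
  assumes [measurable]: "u \<in> borel_measurable borel"
  shows "incr u \<in> borel_measurable borel"
  unfolding incr_def
  by (intro borel_measurable_diff measurable_compose[OF borel_measurable_fst]
      measurable_compose[OF borel_measurable_snd]) measurable

lemma incr_scale: "incr (\<lambda>x. c * u x) z = c * incr u z"
  by (simp add: incr_def algebra_simps)

text \<open>\<open>tail\<close> plays the part of a Poincare inequality: each point of \<Omega>
  interacts with the complement, where the functions vanish, with total strength at least
  \<open>T\<close>.\<close>

locale nonlocal_form =
  fixes \<Omega> :: "'a::euclidean_space set" and k :: "'a \<times> 'a \<Rightarrow> real" and p T :: real
  assumes Omega_borel [measurable]: "\<Omega> \<in> sets borel"
    and Omega_finite: "emeasure lborel \<Omega> < \<infinity>"
    and p_ge: "p \<ge> 2"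
    and k_borel [measurable]: "k \<in> borel_measurable borel"
    and k_nonneg: "k z \<ge> 0"
    and T_pos: "T > 0"
    and tail: "x \<in> \<Omega> \<Longrightarrow> ennreal T \<le> (\<integral>\<^sup>+y. ennreal (k (x, y)) * indicator (- \<Omega>) y \<partial>lborel)"
begin

definition \<nu> :: "('a \<times> 'a) measure" where
  "\<nu> = density lborel (\<lambda>z. ennreal (k z))"

text \<open>Vanishing is demanded at every point off \<Omega>, so that increments between a point of
  \<Omega> and one outside can be evaluated pointwise.\<close>

definition V :: "('a \<Rightarrow> real) set" where
  "V = {u. u \<in> borel_measurable borel \<and> (\<forall>x. x \<notin> \<Omega> \<longrightarrow> u x = 0) \<and>
        integrable \<nu> (\<lambda>z. \<bar>incr u z\<bar> powr p)}"

definition E :: "('a \<Rightarrow> real) \<Rightarrow> real" where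
  "E u = (LINT z|\<nu>. \<bar>incr u z\<bar> powr p)"

text \<open>The Euler-Lagrange equation of \<open>F h\<close> is the problem with frozen right-hand
  side \<open>h\<close>; the factor 1 / p absorbs the p that arises from differentiating
  |t|^p.\<close>

definition F :: "('a \<Rightarrow> real) \<Rightarrow> ('a \<Rightarrow> real) \<Rightarrow> real" where
  "F h u = E u / p - (LINT x|lborel. h x * u x)"

definition is_min :: "('a \<Rightarrow> real) \<Rightarrow> ('a \<Rightarrow> real) \<Rightarrow> bool" where
  "is_min h u \<longleftrightarrow> u \<in> V \<and> (\<forall>z\<in>V. F h u \<le> F h z)"

lemma sets_nu [measurable_cong, simp]: "sets \<nu> = sets borel"
  by (simp add: \<nu>_def)

lemma space_nu [simp]: "space \<nu> = UNIV"
  by (simp add: \<nu>_def)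

lemma V_measurable: "u \<in> V \<Longrightarrow> u \<in> borel_measurable borel"
  and V_outside: "u \<in> V \<Longrightarrow> x \<notin> \<Omega> \<Longrightarrow> u x = 0"
  and V_integrable: "u \<in> V \<Longrightarrow> integrable \<nu> (\<lambda>z. \<bar>incr u z\<bar> powr p)"
  by (auto simp: V_def)

lemma sgpow_measurable [measurable]: "sgpow p \<in> borel_measurable borel"
  using borel_measurable_sgpow p_ge by blast

lemma E_nonneg: "E u \<ge> 0"
  unfolding E_def by (intro integral_nonneg_AE) auto

lemma AE_nu_pair:
  assumes "AE x in lborel. P x"
  shows "AE z in \<nu>. P (fst z) \<and> P (snd z)"
proof -
  have "AE z in lborel. 0 < ennreal (k z) \<longrightarrow> P (fst z) \<and> P (snd z)"
    using AE_lborel_pair[OF assms] by eventually_elim simp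
  then show ?thesis
    unfolding \<nu>_def by (subst AE_density) simp_all
qed

lemma V_dominated:
  assumes [measurable]: "w \<in> borel_measurable borel"
    and "\<And>x. x \<notin> \<Omega> \<Longrightarrow> w x = 0" "integrable \<nu> g" "\<And>z. \<bar>incr w z\<bar> powr p \<le> g z"
  shows "w \<in> V" "E w \<le> integral\<^sup>L \<nu> g"
proof -
  have i: "integrable \<nu> (\<lambda>z. \<bar>incr w z\<bar> powr p)"
  proof (rule Bochner_Integration.integrable_bound[OF assms(3)])
    have "norm (\<bar>incr w z\<bar> powr p) \<le> norm (g z)" for z
      using assms(4)[of z] by simp
    then show "AE z in \<nu>. norm (\<bar>incr w z\<bar> powr p) \<le> norm (g z)" by simp
  qed measurable
  then show "w \<in> V"
    using assms by (auto simp: V_def)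
  show "E w \<le> integral\<^sup>L \<nu> g"
    unfolding E_def by (intro integral_mono i assms)
qed

lemma V_zero: "(\<lambda>_. 0) \<in> V"
  by (rule V_dominated[where g = "\<lambda>_. 0"]) (auto simp: incr_def)

lemma V_add: assumes "u \<in> V" "v \<in> V" shows "(\<lambda>x. u x + v x) \<in> V"
proof (rule V_dominated)
  show "integrable \<nu> (\<lambda>z. 2 powr p * (\<bar>incr u z\<bar> powr p + \<bar>incr v z\<bar> powr p))"
    using assms by (intro integrable_mult_right Bochner_Integration.integrable_add V_integrable)
  show "\<bar>incr (\<lambda>x. u x + v x) z\<bar> powr p \<le> 2 powr p * (\<bar>incr u z\<bar> powr p + \<bar>incr v z\<bar> powr p)" for z
    using abs_powr_add_le[of p "incr u z" "incr v z"] p_ge by (simp add: incr_def algebra_simps)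
  show "(\<lambda>x. u x + v x) \<in> borel_measurable borel"
    using assms[THEN V_measurable] by measurable
qed (use assms in \<open>auto simp: V_outside\<close>)

lemma V_scale: assumes "u \<in> V" shows "(\<lambda>x. c * u x) \<in> V" "E (\<lambda>x. c * u x) = \<bar>c\<bar> powr p * E u"
proof -
  have eq: "\<bar>incr (\<lambda>x. c * u x) z\<bar> powr p = \<bar>c\<bar> powr p * \<bar>incr u z\<bar> powr p" for z
    unfolding incr_scale abs_mult by (rule powr_mult)
  show "(\<lambda>x. c * u x) \<in> V"
    unfolding V_def using V_measurable[OF assms] V_outside[OF assms] V_integrable[OF assms]
    by (auto simp: eq)
  show "E (\<lambda>x. c * u x) = \<bar>c\<bar> powr p * E u"
    unfolding E_def eq by simp
qed

lemma V_diff: assumes "u \<in> V" "v \<in> V" shows "(\<lambda>x. u x - v x) \<in> V"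
  using V_add[OF assms(1) V_scale(1)[OF assms(2), of "-1"]] by simp

lemma V_contraction:
  assumes "u \<in> V" and [measurable]: "c \<in> borel_measurable borel"
    and "c 0 = 0" "\<And>s t. \<bar>c s - c t\<bar> \<le> \<bar>s - t\<bar>"
  shows "(\<lambda>x. c (u x)) \<in> V"
proof (rule V_dominated)
  show "integrable \<nu> (\<lambda>z. \<bar>incr u z\<bar> powr p)" using assms by (intro V_integrable)
  show "\<bar>incr (\<lambda>x. c (u x)) z\<bar> powr p \<le> \<bar>incr u z\<bar> powr p" for z
    using assms p_ge by (auto simp: incr_def intro!: powr_mono2)
  show "(\<lambda>x. c (u x)) \<in> borel_measurable borel"
    using V_measurable[OF assms(1)] by measurable
qed (use assms in \<open>auto simp: V_outside\<close>)

text \<open>Integrate \<open>tail\<close> against \<open>H\<close> over \<Omega> and apply Tonelli: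
  what appears on the right is the interaction of \<Omega> with its complement.\<close>

lemma tail_nn_integral:
  assumes [measurable]: "H \<in> borel_measurable borel"
  shows "ennreal T * (\<integral>\<^sup>+x. H x * indicator \<Omega> x \<partial>lborel)
    \<le> (\<integral>\<^sup>+z. H (fst z) * indicator \<Omega> (fst z) * indicator (- \<Omega>) (snd z) \<partial>\<nu>)"
proof -
  have [measurable]: "k \<in> borel_measurable (borel \<Otimes>\<^sub>M borel)"
    by (simp add: borel_prod)
  have "ennreal T * (\<integral>\<^sup>+x. H x * indicator \<Omega> x \<partial>lborel) = (\<integral>\<^sup>+x. ennreal T * (H x * indicator \<Omega> x) \<partial>lborel)"
    by (rule nn_integral_cmult[symmetric]) measurable
  also have "\<dots> \<le> (\<integral>\<^sup>+x. (\<integral>\<^sup>+y. ennreal (k (x, y)) * indicator (- \<Omega>) y \<partial>lborel) * (H x * indicator \<Omega> x) \<partial>lborel)"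
    by (intro nn_integral_mono) (use tail in \<open>auto simp: indicator_def intro!: mult_right_mono\<close>)
  also have "\<dots> = (\<integral>\<^sup>+x. \<integral>\<^sup>+y. ennreal (k (x, y)) * (H x * indicator \<Omega> x * indicator (- \<Omega>) y) \<partial>lborel \<partial>lborel)"
    by (intro nn_integral_cong, subst nn_integral_multc[symmetric])
       (measurable, auto intro!: nn_integral_cong simp: mult_ac)
  also have "\<dots> = (\<integral>\<^sup>+z. ennreal (k z) * (H (fst z) * indicator \<Omega> (fst z) * indicator (- \<Omega>) (snd z)) \<partial>(lborel \<Otimes>\<^sub>M lborel))"
    by (subst lborel.nn_integral_fst[symmetric]) auto
  also have "\<dots> = (\<integral>\<^sup>+z. H (fst z) * indicator \<Omega> (fst z) * indicator (- \<Omega>) (snd z) \<partial>\<nu>)"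
    unfolding \<nu>_def by (subst nn_integral_density) (simp_all add: lborel_prod)
  finally show ?thesis .
qed

text \<open>An energy density that dominates \<open>H x\<close> for x inside and y outside \<Omega>
  controls the integral of \<open>H\<close>. With \<open>H\<close> = |u|^p this is coercivity; with
  \<open>H\<close> a multiple of the excess of u over M it measures the energy gained by
  truncation.\<close>

lemma tail_integral:
  assumes [measurable]: "H \<in> borel_measurable borel" and H: "\<And>x. 0 \<le> H x" "\<And>x. x \<notin> \<Omega> \<Longrightarrow> H x = 0"
    and g: "integrable \<nu> g" "\<And>z. 0 \<le> g z"
      "\<And>x y. x \<in> \<Omega> \<Longrightarrow> y \<notin> \<Omega> \<Longrightarrow> H x \<le> g (x, y)"
  shows "integrable lborel H" "T * (LINT x|lborel. H x) \<le> (LINT z|\<nu>. g z)"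
proof -
  have "ennreal T * (\<integral>\<^sup>+x. ennreal (H x) * indicator \<Omega> x \<partial>lborel)
    \<le> (\<integral>\<^sup>+z. ennreal (H (fst z)) * indicator \<Omega> (fst z) * indicator (- \<Omega>) (snd z) \<partial>\<nu>)"
    by (rule tail_nn_integral) measurable
  also have "\<dots> \<le> (\<integral>\<^sup>+z. ennreal (g z) \<partial>\<nu>)"
    using g by (intro nn_integral_mono) (auto simp: indicator_def intro!: ennreal_leI)
  also have "\<dots> = ennreal (LINT z|\<nu>. g z)"
    using g by (intro nn_integral_eq_integral) auto
  also have "(\<integral>\<^sup>+x. ennreal (H x) * indicator \<Omega> x \<partial>lborel) = (\<integral>\<^sup>+x. ennreal (H x) \<partial>lborel)"
    using H by (intro nn_integral_cong) (auto simp: indicator_def)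
  finally have le: "ennreal T * (\<integral>\<^sup>+x. ennreal (H x) \<partial>lborel) \<le> ennreal (LINT z|\<nu>. g z)" .
  then have "ennreal T * (\<integral>\<^sup>+x. ennreal (H x) \<partial>lborel) < \<infinity>"
    using le_less_trans ennreal_less_top by (metis infinity_ennreal_def)
  then have "(\<integral>\<^sup>+x. ennreal (H x) \<partial>lborel) < \<infinity>"
    using T_pos by (auto simp: ennreal_mult_less_top)
  then show i: "integrable lborel H"
    using H by (intro integrableI_nonneg) auto
  have "ennreal (T * (LINT x|lborel. H x)) \<le> ennreal (LINT z|\<nu>. g z)"
    using le H T_pos nn_integral_eq_integral[OF i] by (simp add: ennreal_mult')
  moreover have "(LINT z|\<nu>. g z) \<ge> 0" using g by simp
  ultimately show "T * (LINT x|lborel. H x) \<le> (LINT z|\<nu>. g z)"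
    by (simp add: ennreal_le_iff)
qed

text \<open>For y off \<Omega> the increment of u between x and y is u(x) itself.\<close>

lemma coercive:
  assumes "u \<in> V"
  shows "integrable lborel (\<lambda>x. \<bar>u x\<bar> powr p)" "T * (LINT x|lborel. \<bar>u x\<bar> powr p) \<le> E u"
proof -
  note [measurable] = V_measurable[OF assms]
  have m: "(\<lambda>x. \<bar>u x\<bar> powr p) \<in> borel_measurable borel" by measurable
  have out: "\<bar>u x\<bar> powr p = 0" if "x \<notin> \<Omega>" for x
    using V_outside[OF assms that] by simp
  have le: "\<bar>u x\<bar> powr p \<le> \<bar>incr u (x, y)\<bar> powr p" if "x \<in> \<Omega>" "y \<notin> \<Omega>" for x y
    using V_outside[OF assms that(2)] by (simp add: incr_def)
  show "integrable lborel (\<lambda>x. \<bar>u x\<bar> powr p)" "T * (LINT x|lborel. \<bar>u x\<bar> powr p) \<le> E u"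
    unfolding E_def
    using tail_integral[OF m powr_ge_zero out V_integrable[OF assms] powr_ge_zero le] by blast+
qed

lemma integrable_indicator_Omega: "integrable lborel (indicat_real \<Omega>)"
  using Omega_finite by (auto simp: integrable_indicator_iff)

lemma integrable_of_bounded:
  fixes w :: "'a \<Rightarrow> real"
  assumes [measurable]: "w \<in> borel_measurable borel"
    and "\<And>x. x \<notin> \<Omega> \<Longrightarrow> w x = 0" "\<And>x. \<bar>w x\<bar> \<le> B"
  shows "integrable lborel w"
proof (rule Bochner_Integration.integrable_bound)
  show "integrable lborel (\<lambda>x. B * indicat_real \<Omega> x)"
    by (intro integrable_mult_right integrable_indicator_Omega)
  have "\<bar>w x\<bar> \<le> \<bar>B * indicat_real \<Omega> x\<bar>" for x
    using assms(2)[of x] assms(3)[of x] by (cases "x \<in> \<Omega>") auto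
  then show "AE x in lborel. norm (w x) \<le> norm (B * indicat_real \<Omega> x)"
    by simp
qed measurable

lemma V_integrable_lborel:
  assumes "u \<in> V" shows "integrable lborel u"
proof -
  have "\<bar>t\<bar> \<le> \<bar>t\<bar> powr p + 1" for t :: real
    using p_ge powr_mono[of 1 p "\<bar>t\<bar>"] powr_ge_zero[of "\<bar>t\<bar>" p]
    by (cases "\<bar>t\<bar> \<ge> 1") (simp, linarith)
  from this[of "u _"] have "norm (u x) \<le> norm (\<bar>u x\<bar> powr p + indicat_real \<Omega> x)" for x
    using V_outside[OF assms, of x] abs_ge_self[of "\<bar>u x\<bar> powr p + 1"]
    by (cases "x \<in> \<Omega>") (simp_all add: order_trans)
  then have "AE x in lborel. norm (u x) \<le> norm (\<bar>u x\<bar> powr p + indicat_real \<Omega> x)"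
    by (rule AE_I2)
  moreover have "u \<in> borel_measurable lborel" using V_measurable[OF assms] by measurable
  ultimately show ?thesis
    by (intro Bochner_Integration.integrable_bound[OF
        Bochner_Integration.integrable_add[OF coercive(1)[OF assms] integrable_indicator_Omega]])
qed

lemma V_integrable_mult:
  assumes "u \<in> V" and [measurable]: "h \<in> borel_measurable borel" and "\<And>x. \<bar>h x\<bar> \<le> B"
  shows "integrable lborel (\<lambda>x. h x * u x)"
proof (rule Bochner_Integration.integrable_bound)
  show "integrable lborel (\<lambda>x. B * u x)" using V_integrable_lborel[OF assms(1)] by simp
  have "norm (h x * u x) \<le> norm (B * u x)" for x
    using assms(3)[of x] unfolding real_norm_def abs_mult by (intro mult_right_mono) auto
  then show "AE x in lborel. norm (h x * u x) \<le> norm (B * u x)" by simp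
qed (use V_measurable[OF assms(1)] in measurable)

lemma E_zero_imp:
  assumes "u \<in> V" "E u \<le> 0" shows "AE x in lborel. u x = 0"
proof -
  have "T * (LINT x|lborel. \<bar>u x\<bar> powr p) \<le> 0" using coercive(2)[OF assms(1)] assms(2) by simp
  then have "(LINT x|lborel. \<bar>u x\<bar> powr p) = 0"
    using T_pos by (intro antisym) (auto simp: mult_le_0_iff)
  then have "AE x in lborel. \<bar>u x\<bar> powr p = 0"
    using coercive(1)[OF assms(1)] by (subst (asm) integral_nonneg_eq_0_iff_AE) auto
  then show ?thesis by eventually_elim auto
qed

text \<open>Lower semicontinuity of the energy along almost everywhere convergence, together with
  membership of the limit in \<open>V\<close>. The bound may vary with n because in the applications
  it contains linear terms of \<open>F\<close>, whose limits are found separately.\<close>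

lemma E_Fatou:
  assumes "\<And>n. us n \<in> V" and [measurable]: "u \<in> borel_measurable borel"
    and "\<And>x. x \<notin> \<Omega> \<Longrightarrow> u x = 0"
    and "AE x in lborel. (\<lambda>n. us n x) \<longlonglongrightarrow> u x"
    and "\<And>n. E (us n) \<le> B n" "B \<longlonglongrightarrow> b"
  shows "u \<in> V" "E u \<le> b"
proof -
  have [measurable]: "us n \<in> borel_measurable borel" for n using assms(1) by (rule V_measurable)
  have b: "b \<ge> 0"
    by (rule LIMSEQ_le_const[OF assms(6)]) (use E_nonneg assms(5) order_trans in blast)
  have "AE z in \<nu>. (\<lambda>n. ennreal (\<bar>incr (us n) z\<bar> powr p)) \<longlonglongrightarrow> ennreal (\<bar>incr u z\<bar> powr p)"
    using AE_nu_pair[OF assms(4)]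
  proof eventually_elim
    case (elim z)
    then have "(\<lambda>n. \<bar>incr (us n) z\<bar>) \<longlonglongrightarrow> \<bar>incr u z\<bar>"
      unfolding incr_def by (intro tendsto_intros) auto
    then show ?case
      using p_ge by (intro tendsto_ennrealI tendsto_powr2 tendsto_const) auto
  qed
  then have "AE z in \<nu>. ennreal (\<bar>incr u z\<bar> powr p) = liminf (\<lambda>n. ennreal (\<bar>incr (us n) z\<bar> powr p))"
    by eventually_elim (metis lim_imp_Liminf sequentially_bot)
  then have "(\<integral>\<^sup>+z. ennreal (\<bar>incr u z\<bar> powr p) \<partial>\<nu>)
      = (\<integral>\<^sup>+z. liminf (\<lambda>n. ennreal (\<bar>incr (us n) z\<bar> powr p)) \<partial>\<nu>)"
    by (rule nn_integral_cong_AE)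
  also have "\<dots> \<le> liminf (\<lambda>n. \<integral>\<^sup>+z. ennreal (\<bar>incr (us n) z\<bar> powr p) \<partial>\<nu>)"
    by (rule nn_integral_liminf) measurable
  also have "\<dots> = liminf (\<lambda>n. ennreal (E (us n)))"
    unfolding E_def using V_integrable[OF assms(1)] by (subst nn_integral_eq_integral) auto
  also have "\<dots> \<le> liminf (\<lambda>n. ennreal (B n))"
    using assms(5) by (intro Liminf_mono always_eventually) (auto intro: ennreal_leI)
  also have "\<dots> = ennreal b"
    using tendsto_ennrealI[OF assms(6)] by (intro lim_imp_Liminf) auto
  finally have le: "(\<integral>\<^sup>+z. ennreal (\<bar>incr u z\<bar> powr p) \<partial>\<nu>) \<le> ennreal b" .
  then have i: "integrable \<nu> (\<lambda>z. \<bar>incr u z\<bar> powr p)"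
    by (intro integrableI_nonneg le_less_trans[OF le, folded infinity_ennreal_def]) auto
  then show "u \<in> V" using assms(3) by (auto simp: V_def)
  show "E u \<le> b"
    using le b nn_integral_eq_integral[OF i] unfolding E_def by (simp add: ennreal_le_iff)
qed

end

section \<open>Minimizers and comparison\<close>

context nonlocal_form begin

definition clip :: "real \<Rightarrow> real \<Rightarrow> real" where
  "clip M t = min (max t 0) M"

lemma clip_measurable [measurable]: "clip M \<in> borel_measurable borel"
  unfolding clip_def by measurable

lemma clip_in_V: "M > 0 \<Longrightarrow> u \<in> V \<Longrightarrow> (\<lambda>x. clip M (u x)) \<in> V"
  by (rule V_contraction) (auto simp: clip_def)

text \<open>Since \<open>T\<close> bounds the mass of the kernel outside \<open>\<Omega>\<close> from below, the constant \<open>M\<close> is a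
  supersolution for the right-hand side \<open>T M\<^bsup>p-1\<^esup>\<close>; for the energy this means that truncation at \<open>M\<close>
  does not increase it.\<close>

lemma F_clip_le:
  assumes "M > 0" "u \<in> V" and [measurable]: "h \<in> borel_measurable borel"
    and h: "\<And>x. 0 \<le> h x" "\<And>x. h x \<le> T * M powr (p - 1)"
  shows "F h (\<lambda>x. clip M (u x)) \<le> F h u"
proof -
  let ?c = "\<lambda>x. clip M (u x)"
  note [measurable] = V_measurable[OF assms(2)]
  have c: "?c \<in> V" using assms by (intro clip_in_V)
  \<comment> \<open>This is the tangent bound p M^(p-1) (u - M) for u^p - M^p where u > M: the
    energy density lost between x in \<Omega> and y outside when u is cut at M.\<close>
  define H where "H x = p * M powr (p - 1) * max (u x - M) 0" for x
  have Hm: "H \<in> borel_measurable borel" unfolding H_def by measurable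
  have H0: "0 \<le> H x" for x using p_ge by (simp add: H_def)
  have Hout: "H x = 0" if "x \<notin> \<Omega>" for x
    using V_outside[OF assms(2) that] assms(1) by (simp add: H_def)
  have gi: "integrable \<nu> (\<lambda>z. \<bar>incr u z\<bar> powr p - \<bar>incr ?c z\<bar> powr p)"
    using assms(2) c by (intro Bochner_Integration.integrable_diff V_integrable)
  have "\<bar>incr ?c z\<bar> \<le> \<bar>incr u z\<bar>" for z by (auto simp: incr_def clip_def)
  then have g0: "0 \<le> \<bar>incr u z\<bar> powr p - \<bar>incr ?c z\<bar> powr p" for z
    using p_ge by (simp add: powr_mono2)
  have Hg: "H x \<le> \<bar>incr u (x, y)\<bar> powr p - \<bar>incr ?c (x, y)\<bar> powr p" if "x \<in> \<Omega>" "y \<notin> \<Omega>" for x y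
  proof (cases "u x > M")
    case True
    have "incr u (x, y) = u x" "incr ?c (x, y) = M"
      using V_outside[OF assms(2) that(2)] True assms(1) by (auto simp: incr_def clip_def)
    with True show ?thesis
      using powr_subgradient[of p M "u x"] p_ge assms(1) by (simp add: H_def rpow_def)
  next
    case False
    then show ?thesis using g0[of "(x, y)"] by (simp add: H_def)
  qed
  have Hi: "integrable lborel H" and "T * integral\<^sup>L lborel H \<le> (LINT z|\<nu>. \<bar>incr u z\<bar> powr p - \<bar>incr ?c z\<bar> powr p)"
    using tail_integral[OF Hm H0 Hout gi g0 Hg] by auto
  then have le: "T * integral\<^sup>L lborel H \<le> E u - E ?c"
    unfolding E_def using V_integrable[OF assms(2)] V_integrable[OF c] by simp
  have hb: "\<bar>h x\<bar> \<le> T * M powr (p - 1)" for x using h[of x] by simp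
  have iu: "integrable lborel (\<lambda>x. h x * u x)" and ic: "integrable lborel (\<lambda>x. h x * ?c x)"
    using V_integrable_mult[OF assms(2) _ hb] V_integrable_mult[OF c _ hb] by auto
  have "(LINT x|lborel. h x * u x) \<le> (LINT x|lborel. h x * ?c x + T / p * H x)"
  proof (intro integral_mono iu Bochner_Integration.integrable_add ic integrable_mult_right Hi)
    fix x
    \<comment> \<open>Replacing u by its positive part can only increase the product, as h is
      nonnegative; the positive part is the clipped function plus the excess over M.\<close>
    have "h x * u x \<le> h x * (?c x + max (u x - M) 0)"
      using h(1)[of x] assms(1) by (intro mult_left_mono) (auto simp: clip_def)
    also have "\<dots> \<le> h x * ?c x + T * M powr (p - 1) * max (u x - M) 0"
      unfolding distrib_left using h(2)[of x] by (intro add_left_mono mult_right_mono) auto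
    finally show "h x * u x \<le> h x * ?c x + T / p * H x"
      using p_ge by (simp add: H_def)
  qed
  also have "\<dots> = (LINT x|lborel. h x * ?c x) + T * integral\<^sup>L lborel H / p"
    using ic Hi by simp
  also have "\<dots> \<le> (LINT x|lborel. h x * ?c x) + (E u - E ?c) / p"
    using le p_ge by (intro add_left_mono divide_right_mono) auto
  finally show ?thesis by (simp add: F_def diff_divide_distrib)
qed

lemma E_clarkson:
  assumes "u \<in> V" "v \<in> V"
  shows "E (\<lambda>x. (u x + v x) / 2) + E (\<lambda>x. (u x - v x) / 2) \<le> (E u + E v) / 2"
proof -
  have s: "(\<lambda>x. (u x + v x) / 2) \<in> V" and d: "(\<lambda>x. (u x - v x) / 2) \<in> V"
    using V_scale(1)[OF V_add[OF assms], of "1/2"] V_scale(1)[OF V_diff[OF assms], of "1/2"] by simp_all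
  note i = V_integrable[OF s] V_integrable[OF d] V_integrable[OF assms(1)] V_integrable[OF assms(2)]
  have "E (\<lambda>x. (u x + v x) / 2) + E (\<lambda>x. (u x - v x) / 2)
     = (LINT z|\<nu>. \<bar>incr (\<lambda>x. (u x + v x) / 2) z\<bar> powr p + \<bar>incr (\<lambda>x. (u x - v x) / 2) z\<bar> powr p)"
    unfolding E_def by (rule Bochner_Integration.integral_add[OF i(1,2), symmetric])
  also have "\<dots> \<le> (LINT z|\<nu>. (\<bar>incr u z\<bar> powr p + \<bar>incr v z\<bar> powr p) / 2)"
  proof (rule integral_mono)
    fix z
    have "incr (\<lambda>x. (u x + v x) / 2) z = (incr u z + incr v z) / 2" "incr (\<lambda>x. (u x - v x) / 2) z = (incr u z - incr v z) / 2"
      by (simp_all add: incr_def field_simps)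
    note eq = this
    show "\<bar>incr (\<lambda>x. (u x + v x) / 2) z\<bar> powr p + \<bar>incr (\<lambda>x. (u x - v x) / 2) z\<bar> powr p
        \<le> (\<bar>incr u z\<bar> powr p + \<bar>incr v z\<bar> powr p) / 2"
      unfolding eq by (rule clarkson_powr[OF p_ge])
  qed (intro Bochner_Integration.integrable_add i integrable_divide)+
  also have "\<dots> = (E u + E v) / 2"
    unfolding E_def using i by simp
  finally show ?thesis .
qed

text \<open>Where |t| exceeds \<epsilon>, the factor (|t| / \<epsilon>)^(p-1) is at least 1. On a
  set of finite measure this makes the L1 norm small once the energy is small.\<close>

lemma young_small:
  assumes "\<epsilon> > 0" shows "\<bar>t\<bar> \<le> \<epsilon> + \<epsilon> powr (1 - p) * \<bar>t\<bar> powr p"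
proof (cases "\<bar>t\<bar> \<le> \<epsilon>")
  case False
  have "1 = \<epsilon> powr (1 - p) * \<epsilon> powr (p - 1)"
    using assms by (simp flip: powr_add)
  also have "\<dots> \<le> \<epsilon> powr (1 - p) * \<bar>t\<bar> powr (p - 1)"
    using False assms p_ge by (intro mult_left_mono powr_mono2) auto
  finally have "1 * \<bar>t\<bar> \<le> \<epsilon> powr (1 - p) * \<bar>t\<bar> powr (p - 1) * \<bar>t\<bar>"
    by (rule mult_right_mono) simp
  also have "\<dots> = \<epsilon> powr (1 - p) * \<bar>t\<bar> powr p"
    using powr_minus_one_mult[of "\<bar>t\<bar>" p] by simp
  finally show ?thesis using assms by simp
qed (simp add: add_increasing2)

lemma L1_le_E:
  assumes "u \<in> V" "\<epsilon> > 0"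
  shows "(LINT x|lborel. \<bar>u x\<bar>) \<le> \<epsilon> * measure lborel \<Omega> + \<epsilon> powr (1 - p) / T * E u"
proof -
  note i = coercive(1)[OF assms(1)] integrable_indicator_Omega
  have "(LINT x|lborel. \<bar>u x\<bar>) \<le> (LINT x|lborel. \<epsilon> * indicat_real \<Omega> x + \<epsilon> powr (1 - p) * \<bar>u x\<bar> powr p)"
  proof (intro integral_mono Bochner_Integration.integrable_add integrable_mult_right i
      integrable_abs V_integrable_lborel assms(1))
    fix x
    show "\<bar>u x\<bar> \<le> \<epsilon> * indicat_real \<Omega> x + \<epsilon> powr (1 - p) * \<bar>u x\<bar> powr p"
      using young_small[OF assms(2), of "u x"] V_outside[OF assms(1), of x]
      by (cases "x \<in> \<Omega>") simp_all
  qed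
  also have "\<dots> = \<epsilon> * measure lborel \<Omega> + \<epsilon> powr (1 - p) * (LINT x|lborel. \<bar>u x\<bar> powr p)"
    using i by simp
  also have "(LINT x|lborel. \<bar>u x\<bar> powr p) \<le> E u / T"
    using coercive(2)[OF assms(1)] T_pos by (simp add: field_simps)
  then have "\<epsilon> powr (1 - p) * (LINT x|lborel. \<bar>u x\<bar> powr p) \<le> \<epsilon> powr (1 - p) / T * E u"
    using mult_left_mono[of "LINT x|lborel. \<bar>u x\<bar> powr p" "E u / T" "\<epsilon> powr (1 - p)"] by simp
  finally show ?thesis by simp
qed

text \<open>The direct method with strong convergence. The minimizing sequence is taken among
  functions with values in [0, M]; Clarkson's inequality makes it Cauchy in L1, a subsequence
  converges almost everywhere, and Fatou applies. Truncation by \<open>F_clip_le\<close> upgrades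
  minimality from this class to all of \<open>V\<close>.\<close>

lemma exists_min:
  assumes M: "M > 0" and [measurable]: "h \<in> borel_measurable borel"
    and h: "\<And>x. 0 \<le> h x" "\<And>x. h x \<le> T * M powr (p - 1)"
  shows "\<exists>u. is_min h u \<and> (\<forall>x. 0 \<le> u x \<and> u x \<le> M)"
proof -
  define B where "B = T * M powr (p - 1)"
  have hb: "\<bar>h x\<bar> \<le> B" for x using h[of x] by (simp add: B_def)
  define K where "K = {u\<in>V. \<forall>x. 0 \<le> u x \<and> u x \<le> M}"
  have KV: "u \<in> V" if "u \<in> K" for u using that by (simp add: K_def)
  have int: "integrable lborel (\<lambda>x. h x * u x)" if "u \<in> V" for u
    by (rule V_integrable_mult[OF that _ hb]) measurable
  have low: "- (B * M * measure lborel \<Omega>) \<le> F h u" if "u \<in> K" for u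
  proof -
    have "(LINT x|lborel. h x * u x) \<le> (LINT x|lborel. B * M * indicat_real \<Omega> x)"
    proof (intro integral_mono int KV that integrable_mult_right integrable_indicator_Omega)
      fix x
      show "h x * u x \<le> B * M * indicat_real \<Omega> x"
        using that h[of x] M V_outside[OF KV[OF that], of x]
        by (cases "x \<in> \<Omega>") (auto simp: K_def B_def intro!: mult_mono)
    qed
    also have "\<dots> = B * M * measure lborel \<Omega>"
      using integrable_indicator_Omega by simp
    finally show ?thesis
      using E_nonneg[of u] p_ge divide_nonneg_nonneg[of "E u" p] unfolding F_def by linarith
  qed
  define I where "I = Inf (F h ` K)"
  have bdd: "bdd_below (F h ` K)" using low by (auto intro!: bdd_belowI)
  have "(\<lambda>_. 0) \<in> K" using V_zero M by (simp add: K_def)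
  then have ne: "F h ` K \<noteq> {}" by blast
  have I_le: "I \<le> F h u" if "u \<in> K" for u
    unfolding I_def using that by (intro cInf_lower bdd) auto
  have "\<exists>u\<in>K. F h u < I + 1 / real (Suc n)" for n
    using cInf_lessD[OF ne, of "I + 1 / real (Suc n)"] by (auto simp: I_def)
  then obtain us where us: "\<And>n. us n \<in> K" "\<And>n. F h (us n) < I + 1 / real (Suc n)"
    by metis
  have usV: "us n \<in> V" for n using us(1) KV by blast
  note [measurable] = V_measurable[OF usV]
  \<comment> \<open>The midpoint of two members of the sequence is again a competitor, so its value
    is at least the infimum. Clarkson's inequality then leaves only the errors 1 / (i + 1) and 1 /
    (j + 1) for the half difference.\<close>
  have par: "E (\<lambda>x. (us i x - us j x) / 2) \<le> p / 2 * (1 / real (Suc i) + 1 / real (Suc j))" for i j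
  proof -
    let ?s = "\<lambda>x. (us i x + us j x) / 2"
    have "?s \<in> V" using V_scale(1)[OF V_add[OF usV[of i] usV[of j]], of "1/2"] by simp
    moreover have "0 \<le> ?s x \<and> ?s x \<le> M" for x
    proof -
      have "0 \<le> us i x" "us i x \<le> M" "0 \<le> us j x" "us j x \<le> M"
        using us(1)[of i] us(1)[of j] by (auto simp: K_def)
      then show ?thesis by auto
    qed
    ultimately have "I \<le> F h ?s" by (intro I_le) (simp add: K_def)
    moreover have "(LINT x|lborel. h x * ?s x) = ((LINT x|lborel. h x * us i x) + (LINT x|lborel. h x * us j x)) / 2"
      using int[OF usV[of i]] int[OF usV[of j]] by (simp add: distrib_left)
    ultimately have "I \<le> E ?s / p - ((LINT x|lborel. h x * us i x) + (LINT x|lborel. h x * us j x)) / 2"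
      by (simp add: F_def)
    moreover have "E (\<lambda>x. (us i x - us j x) / 2) / p \<le> (E (us i) / p + E (us j) / p) / 2 - E ?s / p"
      using divide_right_mono[OF E_clarkson[OF usV[of i] usV[of j]], of p] p_ge
      by (simp add: add_divide_distrib)
    ultimately have "E (\<lambda>x. (us i x - us j x) / 2) / p \<le> (1 / real (Suc i) + 1 / real (Suc j)) / 2"
      using us(2)[of i] us(2)[of j] unfolding F_def by argo
    then show ?thesis using p_ge by (simp add: field_simps)
  qed
  have "\<exists>N. \<forall>i\<ge>N. \<forall>j\<ge>N. (LINT x|lborel. norm (us i x - us j x)) < e" if "e > 0" for e
  proof -
    define m where "m = measure lborel \<Omega>"
    have m: "m \<ge> 0" by (simp add: m_def)
    \<comment> \<open>The term with the measure of \<Omega> becomes at most e / 8, and N is then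
      chosen to bring the energy term below e / 4; doubling for the full difference stays below e.
      The added 1 covers a measure equal to zero.\<close>
    define \<epsilon> where "\<epsilon> = e / (8 * (m + 1))"
    have \<epsilon>: "\<epsilon> > 0" using that m by (simp add: \<epsilon>_def)
    define C where "C = \<epsilon> powr (1 - p) / T * p"
    have C: "C \<ge> 0" using T_pos p_ge by (simp add: C_def)
    obtain N :: nat where N: "4 * C / e < real N" using reals_Archimedean2 by blast
    have "(LINT x|lborel. norm (us i x - us j x)) < e" if ij: "i \<ge> N" "j \<ge> N" for i j
    proof -
      let ?d = "\<lambda>x. (us i x - us j x) / 2"
      have dV: "?d \<in> V" using V_scale(1)[OF V_diff[OF usV[of i] usV[of j]], of "1/2"] by simp
      have "1 / real (Suc i) \<le> 1 / real (Suc N)" "1 / real (Suc j) \<le> 1 / real (Suc N)"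
        using ij by (auto intro!: divide_left_mono)
      then have "p / 2 * (1 / real (Suc i) + 1 / real (Suc j)) \<le> p / 2 * (1 / real (Suc N) + 1 / real (Suc N))"
        using p_ge by (intro mult_left_mono add_mono) auto
      moreover have "p / 2 * (1 / real (Suc N) + 1 / real (Suc N)) = p / real (Suc N)"
        by (simp add: field_simps)
      ultimately have "E ?d \<le> p / real (Suc N)"
        using par[of i j] by linarith
      then have "\<epsilon> powr (1 - p) / T * E ?d \<le> \<epsilon> powr (1 - p) / T * (p / real (Suc N))"
        using T_pos by (intro mult_left_mono) auto
      also have "\<dots> = C / real (Suc N)" by (simp add: C_def)
      also have "\<dots> < e / 4"
        using N \<open>e > 0\<close> C by (simp add: field_simps)
      finally have "(LINT x|lborel. \<bar>?d x\<bar>) < \<epsilon> * m + e / 4"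
        using L1_le_E[OF dV \<epsilon>] unfolding m_def by linarith
      moreover have "\<epsilon> * m \<le> e / 8"
        using m \<open>e > 0\<close> by (simp add: \<epsilon>_def field_simps)
      moreover have "(LINT x|lborel. norm (us i x - us j x)) = 2 * (LINT x|lborel. \<bar>?d x\<bar>)"
        by (simp add: abs_divide)
      ultimately show ?thesis using \<open>e > 0\<close> by linarith
    qed
    then show ?thesis by blast
  qed
  then obtain r where r: "strict_mono r" "AE x in lborel. Cauchy (\<lambda>i. us (r i) x)"
    using cauchy_L1_AE_cauchy_subseq[of lborel us] V_integrable_lborel[OF usV] by blast
  \<comment> \<open>Setting u to 0 where the subsequence does not converge keeps the bounds 0 and M
    at every point.\<close>
  define u where "u x = (if Cauchy (\<lambda>i. us (r i) x) then lim (\<lambda>i. us (r i) x) else 0)" for x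
  have um [measurable]: "u \<in> borel_measurable borel"
    unfolding u_def[abs_def] by measurable
  have conv: "(\<lambda>i. us (r i) x) \<longlonglongrightarrow> u x" if "Cauchy (\<lambda>i. us (r i) x)" for x
    using that by (simp add: u_def Cauchy_convergent convergent_LIMSEQ_iff[symmetric])
  have ub: "0 \<le> u x \<and> u x \<le> M" for x
  proof (cases "Cauchy (\<lambda>i. us (r i) x)")
    case True
    then show ?thesis
      using LIMSEQ_le_const[OF conv[OF True], of 0] LIMSEQ_le_const2[OF conv[OF True], of M] us(1)
      by (auto simp: K_def)
  qed (use M in \<open>simp add: u_def\<close>)
  have uout: "u x = 0" if "x \<notin> \<Omega>" for x
    using V_outside[OF usV that] by (simp add: u_def)
  have ae: "AE x in lborel. (\<lambda>i. us (r i) x) \<longlonglongrightarrow> u x"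
    using r(2) by eventually_elim (rule conv)
  have hlim: "(\<lambda>i. LINT x|lborel. h x * us (r i) x) \<longlonglongrightarrow> (LINT x|lborel. h x * u x)"
  proof (rule integral_dominated_convergence)
    show "integrable lborel (\<lambda>x. B * M * indicat_real \<Omega> x)"
      by (intro integrable_mult_right integrable_indicator_Omega)
    show "AE x in lborel. (\<lambda>i. h x * us (r i) x) \<longlonglongrightarrow> h x * u x"
      using ae by eventually_elim (intro tendsto_intros)
    have "\<bar>h x * us (r i) x\<bar> \<le> B * M * indicat_real \<Omega> x" for i x
      using us(1)[of "r i"] h[of x] M V_outside[OF usV[of "r i"], of x]
      by (cases "x \<in> \<Omega>") (auto simp: K_def B_def abs_mult intro!: mult_mono)
    then show "AE x in lborel. norm (h x * us (r i) x) \<le> B * M * indicat_real \<Omega> x" for i by simp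
  qed measurable
  \<comment> \<open>The near-minimality of the sequence, solved for the energy; \<open>r i\<close>
    is at least i, so the error 1 / (i + 1) suffices.\<close>
  define Bd where "Bd i = p * (I + 1 / real (Suc i) + (LINT x|lborel. h x * us (r i) x))" for i
  have "Bd \<longlonglongrightarrow> p * (I + 0 + (LINT x|lborel. h x * u x))"
    unfolding Bd_def by (intro tendsto_intros hlim LIMSEQ_inverse_real_of_nat[unfolded inverse_eq_divide])
  moreover have "E (us (r i)) \<le> Bd i" for i
  proof -
    have "1 / real (Suc (r i)) \<le> 1 / real (Suc i)"
      using seq_suble[OF r(1), of i] by (intro divide_left_mono) auto
    then have "E (us (r i)) / p \<le> I + 1 / real (Suc i) + (LINT x|lborel. h x * us (r i) x)"
      using us(2)[of "r i"] unfolding F_def by linarith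
    then show ?thesis using p_ge by (simp add: Bd_def field_simps)
  qed
  ultimately have uV: "u \<in> V" and "E u \<le> p * (I + 0 + (LINT x|lborel. h x * u x))"
    using E_Fatou[OF usV um uout ae] by blast+
  then have FI: "F h u \<le> I" using p_ge by (simp add: F_def field_simps)
  have "F h u \<le> F h z" if "z \<in> V" for z
  proof -
    have "(\<lambda>x. clip M (z x)) \<in> K"
      using clip_in_V[OF M that] M by (simp add: K_def clip_def)
    then have "I \<le> F h (\<lambda>x. clip M (z x))" by (rule I_le)
    also have "\<dots> \<le> F h z" using M that h by (intro F_clip_le) auto
    finally show ?thesis using FI by simp
  qed
  then show ?thesis using uV ub by (auto simp: is_min_def)
qed

lemma integrable_form:
  assumes "u \<in> V" "v \<in> V" shows "integrable \<nu> (\<lambda>z. sgpow p (incr u z) * incr v z)"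
proof (rule Bochner_Integration.integrable_bound)
  show "integrable \<nu> (\<lambda>z. \<bar>incr u z\<bar> powr p + \<bar>incr v z\<bar> powr p)"
    using assms by (intro Bochner_Integration.integrable_add V_integrable)
  have "norm (sgpow p (incr u z) * incr v z) \<le> norm (\<bar>incr u z\<bar> powr p + \<bar>incr v z\<bar> powr p)" for z
    using abs_sgpow_mult_le[OF p_ge, of "incr u z" "incr v z"] by simp
  then show "AE z in \<nu>. norm (sgpow p (incr u z) * incr v z) \<le> norm (\<bar>incr u z\<bar> powr p + \<bar>incr v z\<bar> powr p)"
    by simp
qed (use V_measurable[OF assms(1)] V_measurable[OF assms(2)] in measurable)

text \<open>The tangent inequality is used at the perturbed function u + t v instead of at u. It
  bounds the energy difference by p t times the form at u + t v, so dividing by t and letting t tend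
  to 0 needs only dominated convergence of the form. The opposite inequality comes from -v.\<close>

lemma euler_lagrange:
  assumes "is_min h u" "v \<in> V" and [measurable]: "h \<in> borel_measurable borel" and hb: "\<And>x. \<bar>h x\<bar> \<le> B"
  shows "(LINT z|\<nu>. sgpow p (incr u z) * incr v z) = (LINT x|lborel. h x * v x)"
proof -
  have uV: "u \<in> V" using assms by (simp add: is_min_def)
  note [measurable] = V_measurable[OF uV]
  have ge: "(LINT x|lborel. h x * v x) \<le> (LINT z|\<nu>. sgpow p (incr u z) * incr v z)" if vV: "v \<in> V" for v
  proof -
    note [measurable] = V_measurable[OF vV]
    define t where "t n = 1 / real (Suc n)" for n
    have t: "0 < t n" "t n \<le> 1" for n by (auto simp: t_def)
    have t0: "t \<longlonglongrightarrow> 0"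
      unfolding t_def[abs_def] by (rule LIMSEQ_inverse_real_of_nat[unfolded inverse_eq_divide])
    define w where "w n x = u x + t n * v x" for n x
    have wV: "w n \<in> V" for n
      unfolding w_def[abs_def] by (intro V_add uV V_scale vV)
    note [measurable] = V_measurable[OF wV]
    have Dw: "incr (w n) z = incr u z + t n * incr v z" for n z by (simp add: incr_def w_def algebra_simps)
    have step: "(LINT x|lborel. h x * v x) \<le> (LINT z|\<nu>. sgpow p (incr (w n) z) * incr v z)" for n
    proof -
      have "F h u \<le> F h (w n)" using assms(1) wV by (simp add: is_min_def)
      moreover have "(LINT x|lborel. h x * w n x) = (LINT x|lborel. h x * u x) + t n * (LINT x|lborel. h x * v x)"
        using V_integrable_mult[OF uV assms(3) hb] V_integrable_mult[OF vV assms(3) hb]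
        by (simp add: w_def distrib_left mult.left_commute[of _ "t n"])
      moreover have *: "E (w n) - E u \<le> p * t n * (LINT z|\<nu>. sgpow p (incr (w n) z) * incr v z)"
      proof -
        have "E (w n) - p * t n * (LINT z|\<nu>. sgpow p (incr (w n) z) * incr v z)
          = (LINT z|\<nu>. \<bar>incr (w n) z\<bar> powr p - p * t n * (sgpow p (incr (w n) z) * incr v z))"
          unfolding E_def using V_integrable[OF wV] integrable_form[OF wV vV] by simp
        also have "\<dots> \<le> E u"
          unfolding E_def
        proof (intro integral_mono Bochner_Integration.integrable_diff integrable_mult_right
            V_integrable integrable_form uV vV wV)
          fix z
          show "\<bar>incr (w n) z\<bar> powr p - p * t n * (sgpow p (incr (w n) z) * incr v z) \<le> \<bar>incr u z\<bar> powr p"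
            using sgpow_subgradient[OF p_ge, of "incr (w n) z" "incr u z"] by (simp add: Dw algebra_simps)
        qed
        finally show ?thesis by simp
      qed
      ultimately have "t n * (LINT x|lborel. h x * v x) \<le> t n * (LINT z|\<nu>. sgpow p (incr (w n) z) * incr v z)"
        using divide_right_mono[OF *, of p] p_ge by (simp add: F_def diff_divide_distrib)
      then show ?thesis using t(1)[of n] by simp
    qed
    have "(\<lambda>n. LINT z|\<nu>. sgpow p (incr (w n) z) * incr v z) \<longlonglongrightarrow> (LINT z|\<nu>. sgpow p (incr u z) * incr v z)"
    proof (rule integral_dominated_convergence)
      show "integrable \<nu> (\<lambda>z. 2 powr p * (\<bar>incr u z\<bar> powr p + \<bar>incr v z\<bar> powr p) + \<bar>incr v z\<bar> powr p)"
        using uV vV by (intro Bochner_Integration.integrable_add integrable_mult_right V_integrable)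
      have "(\<lambda>n. sgpow p (incr (w n) z) * incr v z) \<longlonglongrightarrow> sgpow p (incr u z + 0 * incr v z) * incr v z" for z
        unfolding Dw by (intro tendsto_intros t0 p_ge)
      then show "AE z in \<nu>. (\<lambda>n. sgpow p (incr (w n) z) * incr v z) \<longlonglongrightarrow> sgpow p (incr u z) * incr v z"
        by simp
      have "norm (sgpow p (incr (w n) z) * incr v z) \<le> 2 powr p * (\<bar>incr u z\<bar> powr p + \<bar>incr v z\<bar> powr p) + \<bar>incr v z\<bar> powr p" for n z
      proof -
        have "norm (sgpow p (incr (w n) z) * incr v z) \<le> \<bar>incr (w n) z\<bar> powr p + \<bar>incr v z\<bar> powr p"
          using abs_sgpow_mult_le[OF p_ge] by simp
        also have "\<bar>incr (w n) z\<bar> powr p \<le> 2 powr p * (\<bar>incr u z\<bar> powr p + \<bar>t n * incr v z\<bar> powr p)"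
          unfolding Dw using p_ge by (intro abs_powr_add_le) auto
        also have "\<bar>t n * incr v z\<bar> powr p \<le> \<bar>incr v z\<bar> powr p"
          using t[of n] p_ge by (intro powr_mono2) (auto simp: abs_mult mult_left_le_one_le)
        finally show ?thesis by simp
      qed
      then show "AE z in \<nu>. norm (sgpow p (incr (w n) z) * incr v z)
          \<le> 2 powr p * (\<bar>incr u z\<bar> powr p + \<bar>incr v z\<bar> powr p) + \<bar>incr v z\<bar> powr p" for n
        by simp
    qed measurable
    then show ?thesis by (rule LIMSEQ_le_const) (use step in blast)
  qed
  have "(\<lambda>x. - v x) \<in> V" using V_scale(1)[OF assms(2), of "-1"] by simp
  from ge[OF this] have "(LINT x|lborel. h x * v x) \<ge> (LINT z|\<nu>. sgpow p (incr u z) * incr v z)"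
    using incr_scale[of "-1" v] by simp
  with ge[OF assms(2)] show ?thesis by simp
qed

text \<open>The difference of the forms tested with the positive part has a nonnegative integrand,
  and its integral is at most 0 since h1 \<le> h2. The test function therefore has zero energy, and
  coercivity, not connectedness of \<Omega>, forces it to vanish.\<close>

lemma comparison:
  assumes "is_min h1 u1" "is_min h2 u2"
    and m [measurable]: "h1 \<in> borel_measurable borel" "h2 \<in> borel_measurable borel"
    and hb: "\<And>x. \<bar>h1 x\<bar> \<le> B" "\<And>x. \<bar>h2 x\<bar> \<le> B"
    and le: "AE x in lborel. h1 x \<le> h2 x"
  shows "AE x in lborel. u1 x \<le> u2 x"
proof -
  have V: "u1 \<in> V" "u2 \<in> V" using assms by (auto simp: is_min_def)
  define v where "v x = max (u1 x - u2 x) 0" for x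
  have vV: "v \<in> V"
    unfolding v_def using V_contraction[OF V_diff[OF V], of "\<lambda>t. max t 0"] by auto
  have nonneg: "(sgpow p (incr u1 z) - sgpow p (incr u2 z)) * incr v z \<ge> 0"
    and zero: "(sgpow p (incr u1 z) - sgpow p (incr u2 z)) * incr v z = 0 \<Longrightarrow> incr v z = 0" for z
    using sgpow_diff_pos_part[OF p_ge, of "incr u1 z" "incr u2 z" "u1 (fst z) - u2 (fst z)" "u1 (snd z) - u2 (snd z)"]
    by (auto simp: incr_def v_def)
  have i: "integrable \<nu> (\<lambda>z. (sgpow p (incr u1 z) - sgpow p (incr u2 z)) * incr v z)"
    using Bochner_Integration.integrable_diff[OF integrable_form[OF V(1) vV] integrable_form[OF V(2) vV]]
    by (simp add: left_diff_distrib)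
  have "(LINT z|\<nu>. (sgpow p (incr u1 z) - sgpow p (incr u2 z)) * incr v z)
     = (LINT z|\<nu>. sgpow p (incr u1 z) * incr v z) - (LINT z|\<nu>. sgpow p (incr u2 z) * incr v z)"
    using integrable_form[OF V(1) vV] integrable_form[OF V(2) vV] by (simp add: left_diff_distrib)
  also have "\<dots> = (LINT x|lborel. h1 x * v x) - (LINT x|lborel. h2 x * v x)"
    using euler_lagrange[OF assms(1) vV m(1) hb(1)] euler_lagrange[OF assms(2) vV m(2) hb(2)] by simp
  also have "(LINT x|lborel. h1 x * v x) \<le> (LINT x|lborel. h2 x * v x)"
    using le by (intro integral_mono_AE V_integrable_mult[OF vV m(1) hb(1)] V_integrable_mult[OF vV m(2) hb(2)])
       (auto simp: v_def intro!: mult_right_mono)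
  finally have "(LINT z|\<nu>. (sgpow p (incr u1 z) - sgpow p (incr u2 z)) * incr v z) = 0"
    using nonneg by (intro antisym integral_nonneg_AE) auto
  then have "AE z in \<nu>. (sgpow p (incr u1 z) - sgpow p (incr u2 z)) * incr v z = 0"
    using i nonneg by (subst (asm) integral_nonneg_eq_0_iff_AE) auto
  then have "AE z in \<nu>. \<bar>incr v z\<bar> powr p = 0"
    by eventually_elim (use zero in auto)
  then have "E v = 0" unfolding E_def by (rule integral_eq_zero_AE)
  then have "AE x in lborel. v x = 0" using vV by (intro E_zero_imp) auto
  then show ?thesis by eventually_elim (simp add: v_def)
qed

end

section \<open>Monotone iteration\<close>

context nonlocal_form begin

lemma F_le_iff:
  "F h u \<le> F h z \<longleftrightarrow> E u \<le> E z - p * (LINT x|lborel. h x * z x) + p * (LINT x|lborel. h x * u x)"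
proof -
  have "F h u \<le> F h z \<longleftrightarrow> p * F h u \<le> p * F h z" using p_ge by simp
  moreover have "p * F h u = E u - p * (LINT x|lborel. h x * u x)" "p * F h z = E z - p * (LINT x|lborel. h x * z x)"
    using p_ge by (simp_all add: F_def right_diff_distrib)
  ultimately show ?thesis by linarith
qed

text \<open>Iterating \<open>u \<mapsto> argmin F (g \<circ> u)\<close> downwards from the supersolution \<open>M\<close> gives a decreasing
  sequence, whose limit is a solution. The same iteration started at \<open>w0\<close> stays below it and, \<open>G\<close> being
  convex, decreases \<open>E w / p - \<integral>G w\<close>, which keeps the limit away from zero.\<close>

lemma exists_solution:
  assumes M: "M > 0"
    and g_meas [measurable]: "g \<in> borel_measurable borel" and G_meas [measurable]: "G \<in> borel_measurable borel"
    and g_mono: "\<And>s t. 0 \<le> s \<Longrightarrow> s \<le> t \<Longrightarrow> g s \<le> g t" and g0: "g 0 \<ge> 0"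
    and g_M: "g M \<le> T * M powr (p - 1)"
    and g_lim: "\<And>X s. (\<And>n::nat. X n \<ge> 0) \<Longrightarrow> X \<longlonglongrightarrow> s \<Longrightarrow> (\<lambda>n. g (X n)) \<longlonglongrightarrow> g s"
    and G: "\<And>s t. 0 \<le> s \<Longrightarrow> 0 \<le> t \<Longrightarrow> G s + g s * (t - s) \<le> G t" and G0: "G 0 = 0"
    and w0: "w0 \<in> V" "\<And>x. 0 \<le> w0 x" "\<And>x. w0 x \<le> M"
    and neg: "E w0 / p - (LINT x|lborel. G (w0 x)) < 0"
  shows "\<exists>u\<in>V. (\<forall>x. 0 \<le> u x \<and> u x \<le> M) \<and> \<not> (AE x in lborel. u x = 0) \<and>
    (\<forall>v\<in>V. (LINT z|\<nu>. sgpow p (incr u z) * incr v z) = (LINT x|lborel. g (u x) * v x))"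
proof -
  define ok where "ok u \<longleftrightarrow> u \<in> borel_measurable borel \<and> (\<forall>x. 0 \<le> u x \<and> u x \<le> M)" for u :: "'a \<Rightarrow> real"
  \<comment> \<open>A minimizer is chosen with values in [0, M] at every point. Monotonicity of the
    chosen map holds almost everywhere by comparison, whatever the choice.\<close>
  define S where "S u = (SOME w. is_min (\<lambda>x. g (u x)) w \<and> (\<forall>x. 0 \<le> w x \<and> w x \<le> M))" for u
  have okm: "u \<in> borel_measurable borel" if "ok u" for u
    using that by (simp add: ok_def)
  have ok_g: "0 \<le> g (u x)" "g (u x) \<le> T * M powr (p - 1)" "\<bar>g (u x)\<bar> \<le> g M" if "ok u" for u x
    using that g_mono[of 0 "u x"] g_mono[of "u x" M] g0 g_M by (auto simp: ok_def)
  have gm: "(\<lambda>x. g (u x)) \<in> borel_measurable borel" if "ok u" for u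
    using measurable_compose[OF okm[OF that] g_meas] .
  have S: "is_min (\<lambda>x. g (u x)) (S u)" "ok (S u)" if "ok u" for u
  proof -
    have "\<exists>w. is_min (\<lambda>x. g (u x)) w \<and> (\<forall>x. 0 \<le> w x \<and> w x \<le> M)"
      using exists_min[OF M gm[OF that] ok_g(1,2)[OF that]] .
    then have *: "is_min (\<lambda>x. g (u x)) (S u) \<and> (\<forall>x. 0 \<le> S u x \<and> S u x \<le> M)"
      unfolding S_def by (rule someI_ex)
    then show "is_min (\<lambda>x. g (u x)) (S u)" by simp
    from * show "ok (S u)" using V_measurable by (auto simp: ok_def is_min_def)
  qed
  have S_V: "S u \<in> V" if "ok u" for u using S(1)[OF that] by (simp add: is_min_def)
  have S_mono: "AE x in lborel. S u x \<le> S w x" if "ok u" "ok w" "AE x in lborel. u x \<le> w x" for u w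
  proof (rule comparison[OF S(1)[OF that(1)] S(1)[OF that(2)] gm[OF that(1)] gm[OF that(2)] ok_g(3)[OF that(1)] ok_g(3)[OF that(2)]])
    show "AE x in lborel. g (u x) \<le> g (w x)"
      using that(3) by eventually_elim (use that(1) in \<open>auto simp: ok_def intro: g_mono\<close>)
  qed
  \<comment> \<open>The start M does not vanish off \<Omega>, so it is not in \<open>V\<close>;
    membership in \<open>V\<close> holds from index 1 on, which is why \<open>U (Suc n)\<close>
    appears below.\<close>
  define U where "U n = (S ^^ n) (\<lambda>_. M)" for n
  define W where "W n = (S ^^ n) w0" for n
  have U_Suc: "U (Suc n) = S (U n)" and W_Suc: "W (Suc n) = S (W n)" for n by (simp_all add: U_def W_def)
  have okU: "ok (U n)" for n
    by (induction n) (use M S(2) in \<open>auto simp: U_Suc, auto simp: U_def ok_def\<close>)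
  have okW: "ok (W n)" for n
    by (induction n) (use w0 S(2) V_measurable in \<open>auto simp: W_Suc, auto simp: W_def ok_def\<close>)
  have U_dec: "AE x in lborel. U (Suc n) x \<le> U n x" for n
  proof (induction n)
    case 0
    show ?case using okU[of "Suc 0"] by (auto simp: ok_def U_def)
  next
    case (Suc n)
    show ?case unfolding U_Suc[of "Suc n"] U_Suc[of n]
      using S_mono[OF okU okU Suc] by (simp only: U_Suc)
  qed
  have W_le: "AE x in lborel. W n x \<le> U n x" for n
  proof (induction n)
    case 0
    show ?case using w0 by (auto simp: U_def W_def)
  next
    case (Suc n)
    show ?case unfolding U_Suc W_Suc using S_mono[OF okW okU Suc] .
  qed
  have WV: "W n \<in> V" for n
    using w0(1) S_V[OF okW] by (cases n) (auto simp: W_Suc, auto simp: W_def)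
  have UV: "U (Suc n) \<in> V" for n unfolding U_Suc by (rule S_V[OF okU])
  \<comment> \<open>The subgradient inequality at s and at t, with slopes between 0 and
    \<open>g M\<close>, makes \<open>G\<close> Lipschitz on [0, M].\<close>
  have G_diff: "\<bar>G t - G s\<bar> \<le> g M * \<bar>t - s\<bar>" if "0 \<le> s" "s \<le> M" "0 \<le> t" "t \<le> M" for s t
  proof -
    have gb: "0 \<le> g r" "g r \<le> g M" if "0 \<le> r" "r \<le> M" for r
      using g_mono[of 0 r] g_mono[of r M] g0 that by auto
    have bd: "\<bar>g r * (t - s)\<bar> \<le> g M * \<bar>t - s\<bar>" if "0 \<le> r" "r \<le> M" for r
      using gb[OF that] by (auto simp: abs_mult intro!: mult_right_mono)
    have "g s * (t - s) \<le> G t - G s" "G t - G s \<le> g t * (t - s)"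
      using G[OF \<open>0 \<le> s\<close> \<open>0 \<le> t\<close>] G[OF \<open>0 \<le> t\<close> \<open>0 \<le> s\<close>] by (auto simp: algebra_simps)
    then show ?thesis using bd[of s] bd[of t] that by linarith
  qed
  have G_int: "integrable lborel (\<lambda>x. G (u x))" if "ok u" "\<And>x. x \<notin> \<Omega> \<Longrightarrow> u x = 0" for u
  proof (rule integrable_of_bounded)
    have [measurable]: "u \<in> borel_measurable borel" using that by (rule_tac okm)
    show "(\<lambda>x. G (u x)) \<in> borel_measurable borel" by measurable
    have gM: "0 \<le> g M" using g_mono[of 0 M] g0 M by simp
    show "\<bar>G (u x)\<bar> \<le> g M * M" for x
    proof -
      have "\<bar>G (u x)\<bar> \<le> g M * \<bar>u x\<bar>"
        using G_diff[of 0 "u x"] that(1) M G0 by (simp add: ok_def)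
      also have "\<dots> \<le> g M * M"
        using that(1) gM by (intro mult_left_mono) (auto simp: ok_def)
      finally show ?thesis .
    qed
  qed (use that G0 in auto)
  have mult_int: "integrable lborel (\<lambda>x. g (u x) * z x)" if "ok u" "z \<in> V" for u z
    using V_integrable_mult[OF that(2) gm[OF that(1)] ok_g(3)[OF that(1)]] .
  define J where "J w = E w / p - (LINT x|lborel. G (w x))" for w
  \<comment> \<open>The new iterate minimizes the functional in which \<open>G\<close> is replaced
    by its tangent at the old iterate. By convexity the tangent lies below \<open>G\<close>, so a
    decrease of the former functional is a decrease of \<open>J\<close>.\<close>
  have J_dec: "J (W (Suc n)) \<le> J (W n)" for n
  proof -
    let ?u = "W n" and ?w = "W (Suc n)"
    have "F (\<lambda>x. g (?u x)) ?w \<le> F (\<lambda>x. g (?u x)) ?u"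
      using S(1)[OF okW[of n]] WV[of n] by (simp add: is_min_def W_Suc)
    moreover have "(LINT x|lborel. G (?u x) + (g (?u x) * ?w x - g (?u x) * ?u x)) \<le> (LINT x|lborel. G (?w x))"
    proof (intro integral_mono Bochner_Integration.integrable_add Bochner_Integration.integrable_diff
        G_int mult_int okW WV V_outside[OF WV])
      show "G (?u x) + (g (?u x) * ?w x - g (?u x) * ?u x) \<le> G (?w x)" for x
        using G[of "?u x" "?w x"] okW[of n] okW[of "Suc n"] by (simp add: ok_def right_diff_distrib)
    qed
    moreover have "(LINT x|lborel. G (?u x) + (g (?u x) * ?w x - g (?u x) * ?u x))
      = (LINT x|lborel. G (?u x)) + ((LINT x|lborel. g (?u x) * ?w x) - (LINT x|lborel. g (?u x) * ?u x))"
      using G_int[OF okW[of n] V_outside[OF WV]] mult_int[OF okW[of n] WV[of n]]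
        mult_int[OF okW[of n] WV[of "Suc n"]] by simp
    ultimately show ?thesis unfolding J_def F_def by linarith
  qed
  define c where "c = - J w0"
  have c: "c > 0" using neg by (simp add: c_def J_def)
  have J_le: "J (W n) \<le> - c" for n
    by (induction n) (use J_dec order_trans in \<open>auto simp: c_def, auto simp: W_def\<close>)
  \<comment> \<open>As the energy is nonnegative, J \<le> -c bounds the integral of \<open>G\<close>
    along \<open>W\<close> from below. \<open>G\<close> is nondecreasing on nonnegative arguments
    because its slopes \<open>g\<close> are nonnegative, so the bound carries over to
    \<open>U\<close>.\<close>
  have GU: "c \<le> (LINT x|lborel. G (U (Suc n) x))" for n
  proof -
    have "c \<le> (LINT x|lborel. G (W (Suc n) x))"
      using J_le[of "Suc n"] E_nonneg[of "W (Suc n)"] p_ge divide_nonneg_nonneg[of "E (W (Suc n))" p]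
      unfolding J_def by linarith
    also have "\<dots> \<le> (LINT x|lborel. G (U (Suc n) x))"
    proof (intro integral_mono_AE G_int okW okU V_outside[OF WV] V_outside[OF UV])
      show "AE x in lborel. G (W (Suc n) x) \<le> G (U (Suc n) x)"
        using W_le[of "Suc n"]
      proof eventually_elim
        case (elim x)
        have "0 \<le> W (Suc n) x" using okW[of "Suc n"] by (simp add: ok_def)
        moreover have "0 \<le> g (W (Suc n) x) * (U (Suc n) x - W (Suc n) x)"
          using elim ok_g(1)[OF okW] by (intro mult_nonneg_nonneg) auto
        ultimately show ?case
          using G[of "W (Suc n) x" "U (Suc n) x"] elim by linarith
      qed
    qed
    finally show ?thesis .
  qed
  define u where "u x = (INF n. U (Suc n) x)" for x
  have U0: "0 \<le> U n x" "U n x \<le> M" for n x using okU[of n] by (auto simp: ok_def)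
  have bdd: "bdd_below (range (\<lambda>n. U (Suc n) x))" for x by (rule bdd_belowI2[where m = 0]) (rule U0)
  have [measurable]: "U n \<in> borel_measurable borel" for n using okU by (rule okm)
  have um [measurable]: "u \<in> borel_measurable borel"
    unfolding u_def[abs_def] by (rule borel_measurable_cINF) (auto intro: bdd)
  have uout: "u x = 0" if "x \<notin> \<Omega>" for x using V_outside[OF UV that] by (simp add: u_def)
  have u0: "0 \<le> u x" "u x \<le> M" for x
    using cINF_greatest[of UNIV 0 "\<lambda>n. U (Suc n) x"] cINF_lower2[OF bdd, of 0 x M] U0
    by (auto simp: u_def)
  have oku: "ok u" using u0 um by (simp add: ok_def)
  have "AE x in lborel. \<forall>n. U (Suc n) x \<le> U n x" using U_dec by (subst AE_all_countable) simp
  then have lim: "AE x in lborel. (\<lambda>n. U (Suc n) x) \<longlonglongrightarrow> u x"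
  proof eventually_elim
    case (elim x)
    then have "decseq (\<lambda>n. U (Suc n) x)" by (auto simp: decseq_Suc_iff)
    then show ?case unfolding u_def by (rule LIMSEQ_decseq_INF[OF bdd])
  qed
  then have lim2: "AE x in lborel. (\<lambda>n. U (Suc (Suc n)) x) \<longlonglongrightarrow> u x"
    by eventually_elim (rule LIMSEQ_Suc)
  have glim: "AE x in lborel. (\<lambda>n. g (U (Suc n) x)) \<longlonglongrightarrow> g (u x)"
    using lim by eventually_elim (rule g_lim[OF U0(1)])
  have gM: "0 \<le> g M" using g_mono[of 0 M] g0 M by simp
  have "(\<lambda>n. LINT x|lborel. G (U (Suc n) x)) \<longlonglongrightarrow> (LINT x|lborel. G (u x))"
  proof (rule integral_dominated_convergence)
    show "integrable lborel (\<lambda>x. g M * M * indicat_real \<Omega> x)"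
      by (intro integrable_mult_right integrable_indicator_Omega)
    show "AE x in lborel. (\<lambda>n. G (U (Suc n) x)) \<longlonglongrightarrow> G (u x)"
      using lim
    proof eventually_elim
      case (elim x)
      have "(\<lambda>n. g M * \<bar>U (Suc n) x - u x\<bar>) \<longlonglongrightarrow> g M * \<bar>u x - u x\<bar>"
        using elim by (intro tendsto_intros)
      then have "(\<lambda>n. g M * \<bar>U (Suc n) x - u x\<bar>) \<longlonglongrightarrow> 0" by simp
      then have "(\<lambda>n. G (U (Suc n) x) - G (u x)) \<longlonglongrightarrow> 0"
        by (rule Lim_null_comparison[rotated]) (use G_diff u0 U0 in auto)
      then show ?case by (rule LIM_zero_cancel)
    qed
    have "norm (G (U (Suc n) x)) \<le> g M * M * indicat_real \<Omega> x" for n x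
    proof (cases "x \<in> \<Omega>")
      case True
      have "\<bar>G (U (Suc n) x)\<bar> \<le> g M * \<bar>U (Suc n) x\<bar>" using G_diff[of 0 "U (Suc n) x"] U0[of "Suc n" x] M G0 by simp
      also have "\<dots> \<le> g M * M" using U0[of "Suc n" x] gM by (intro mult_left_mono) auto
      finally show ?thesis using True by simp
    qed (use V_outside[OF UV] G0 in simp)
    then show "AE x in lborel. norm (G (U (Suc n) x)) \<le> g M * M * indicat_real \<Omega> x" for n by simp
  qed measurable
  then have "c \<le> (LINT x|lborel. G (u x))" by (rule LIMSEQ_le_const) (use GU in blast)
  moreover have "(LINT x|lborel. G (u x)) = 0" if "AE x in lborel. u x = 0"
    by (rule integral_eq_zero_AE) (use that in \<open>eventually_elim, simp add: G0\<close>)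
  ultimately have nontriv: "\<not> (AE x in lborel. u x = 0)" using c by auto
  let ?h = "\<lambda>x. g (u x)"
  \<comment> \<open>The two indices differ by one since each iterate minimizes with the datum taken
    from its predecessor.\<close>
  have lim_int: "(\<lambda>n. LINT x|lborel. g (U (Suc n) x) * U (Suc (Suc n)) x) \<longlonglongrightarrow> (LINT x|lborel. g (u x) * u x)"
  proof (rule integral_dominated_convergence)
    show "integrable lborel (\<lambda>x. g M * M * indicat_real \<Omega> x)"
      by (intro integrable_mult_right integrable_indicator_Omega)
    show "AE x in lborel. (\<lambda>n. g (U (Suc n) x) * U (Suc (Suc n)) x) \<longlonglongrightarrow> g (u x) * u x"
      using glim lim2 by eventually_elim (rule tendsto_mult)
    have "norm (g (U (Suc n) x) * U (Suc (Suc n)) x) \<le> g M * M * indicat_real \<Omega> x" for n x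
      using ok_g(3)[OF okU[of "Suc n"], of x] U0[of "Suc (Suc n)" x] V_outside[OF UV[of "Suc n"], of x] gM
      by (cases "x \<in> \<Omega>") (auto simp: abs_mult intro!: mult_mono)
    then show "AE x in lborel. norm (g (U (Suc n) x) * U (Suc (Suc n)) x) \<le> g M * M * indicat_real \<Omega> x" for n by simp
  qed measurable
  \<comment> \<open>Minimality passes to the limit: solved for the energy, it is a bound whose
    linear terms converge, and \<open>E_Fatou\<close> handles the left-hand side without strong
    convergence of the energies.\<close>
  have min: "u \<in> V \<and> F ?h u \<le> F ?h z" if z: "z \<in> V" for z
  proof -
    note [measurable] = V_measurable[OF z]
    have zlim: "(\<lambda>n. LINT x|lborel. g (U (Suc n) x) * z x) \<longlonglongrightarrow> (LINT x|lborel. g (u x) * z x)"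
    proof (rule integral_dominated_convergence)
      show "integrable lborel (\<lambda>x. g M * \<bar>z x\<bar>)"
        by (intro integrable_mult_right integrable_abs V_integrable_lborel z)
      show "AE x in lborel. (\<lambda>n. g (U (Suc n) x) * z x) \<longlonglongrightarrow> g (u x) * z x"
        using glim by eventually_elim (intro tendsto_intros)
      have "norm (g (U (Suc n) x) * z x) \<le> g M * \<bar>z x\<bar>" for n x
        using ok_g(3)[OF okU[of "Suc n"], of x] by (auto simp: abs_mult intro!: mult_right_mono)
      then show "AE x in lborel. norm (g (U (Suc n) x) * z x) \<le> g M * \<bar>z x\<bar>" for n by simp
    qed measurable
    define Bd where "Bd n = E z - p * (LINT x|lborel. g (U (Suc n) x) * z x)
        + p * (LINT x|lborel. g (U (Suc n) x) * U (Suc (Suc n)) x)" for n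
    have "E (U (Suc (Suc n))) \<le> Bd n" for n
    proof -
      have "F (\<lambda>x. g (U (Suc n) x)) (U (Suc (Suc n))) \<le> F (\<lambda>x. g (U (Suc n) x)) z"
        using S(1)[OF okU[of "Suc n"]] z by (simp add: is_min_def U_Suc[of "Suc n"])
      then show ?thesis by (simp add: F_le_iff Bd_def)
    qed
    moreover have "Bd \<longlonglongrightarrow> E z - p * (LINT x|lborel. g (u x) * z x) + p * (LINT x|lborel. g (u x) * u x)"
      unfolding Bd_def by (intro tendsto_intros zlim lim_int)
    ultimately have "u \<in> V" "E u \<le> E z - p * (LINT x|lborel. g (u x) * z x) + p * (LINT x|lborel. g (u x) * u x)"
      using E_Fatou[OF UV um uout lim2] by blast+
    then show ?thesis by (simp add: F_le_iff)
  qed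
  have uV: "u \<in> V" using min[OF V_zero] by simp
  have "is_min ?h u" using min uV by (auto simp: is_min_def)
  then have "(LINT z|\<nu>. sgpow p (incr u z) * incr v z) = (LINT x|lborel. g (u x) * v x)" if "v \<in> V" for v
    using euler_lagrange[OF _ that gm[OF oku] ok_g(3)[OF oku]] by simp
  then show ?thesis using uV u0 nontriv by blast
qed

end

section \<open>Radial integrals and the constants\<close>

text \<open>Polar coordinates for radial functions. The half-lines form an intersection-stable
  generator, and on each of them both sides give the volume of a ball, the density being the
  derivative of \<open>unit_ball_vol\<close> times r^N.\<close>

lemma distr_norm_lborel:
  "distr (lborel :: 'a::euclidean_space measure) borel norm =
    density lborel (\<lambda>r. ennreal (DIM('a) * unit_ball_vol DIM('a) * r powr (real DIM('a) - 1) * indicator {0<..} r))"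
    (is "?M = density lborel ?f")
proof (rule measure_eqI_generator_eq)
  have vol: "emeasure ?M {..x} = ennreal (if x \<ge> 0 then unit_ball_vol DIM('a) * x ^ DIM('a) else 0)" for x
  proof -
    have "emeasure ?M {..x} = emeasure (lborel :: 'a measure) (norm -` {..x})"
      by (simp add: emeasure_distr)
    also have "norm -` {..x} = (cball 0 x :: 'a set)" by auto
    finally show ?thesis by (simp add: emeasure_cball)
  qed
  have dens: "emeasure (density lborel ?f) {..x} = ennreal (if x \<ge> 0 then unit_ball_vol DIM('a) * x ^ DIM('a) else 0)" for x
  proof (cases "x \<ge> 0")
    case True
    let ?c = "DIM('a) * unit_ball_vol DIM('a)"
    have "emeasure (density lborel ?f) {..x} = (\<integral>\<^sup>+r. ?f r * indicator {..x} r \<partial>lborel)"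
      by (subst emeasure_density) simp_all
    also have "\<dots> = (\<integral>\<^sup>+r. ennreal (indicator {0..x} r * (?c * r powr (real DIM('a) - 1))) \<partial>lborel)"
    proof (rule nn_integral_cong_AE)
      have "AE r in lborel. r \<noteq> (0::real)" by (rule AE_lborel_singleton)
      then show "AE r in lborel. ?f r * indicator {..x} r = ennreal (indicator {0..x} r * (?c * r powr (real DIM('a) - 1)))"
        by eventually_elim (auto simp: indicator_def)
    qed
    also have "\<dots> = ennreal (?c * (x powr (real DIM('a) - 1 + 1) / (real DIM('a) - 1 + 1)))"
    proof (rule nn_integral_has_integral_lebesgue)
      show "((\<lambda>r. ?c * r powr (real DIM('a) - 1)) has_integral ?c * (x powr (real DIM('a) - 1 + 1) / (real DIM('a) - 1 + 1))) {0..x}"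
        using True by (intro has_integral_mult_right has_integral_powr_from_0) auto
    qed auto
    also have "?c * (x powr (real DIM('a) - 1 + 1) / (real DIM('a) - 1 + 1)) = unit_ball_vol DIM('a) * x ^ DIM('a)"
      using True by (cases "x = 0") (auto simp: powr_realpow)
    finally show ?thesis using True by simp
  next
    case False
    have "emeasure (density lborel ?f) {..x} = (\<integral>\<^sup>+r. ?f r * indicator {..x} r \<partial>lborel)"
      by (subst emeasure_density) simp_all
    also have "\<dots> = 0"
      using False by (subst nn_integral_0_iff_AE) (auto simp: indicator_def)
    finally show ?thesis using False by simp
  qed
  show "emeasure ?M X = emeasure (density lborel ?f) X" if "X \<in> range atMost" for X
    using that vol dens by auto
  show "emeasure ?M {..real i} \<noteq> \<infinity>" for i by (simp add: vol)
  show "(\<Union>i. {..real i}) = UNIV" using real_arch_simple by auto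
  show "Int_stable (range atMost :: real set set)"
    by (auto simp: Int_stable_def)
  show "sets ?M = sigma_sets UNIV (range atMost)" "sets (density lborel ?f) = sigma_sets UNIV (range atMost)"
    by (simp_all add: borel_eq_atMost)
qed auto

lemma nn_integral_norm:
  assumes [measurable]: "f \<in> borel_measurable borel"
  shows "(\<integral>\<^sup>+z. f (norm (z::'a::euclidean_space)) \<partial>lborel) =
    (\<integral>\<^sup>+r. ennreal (DIM('a) * unit_ball_vol DIM('a) * r powr (real DIM('a) - 1) * indicator {0<..} r) * f r \<partial>lborel)"
proof -
  have "(\<integral>\<^sup>+z. f (norm (z::'a)) \<partial>lborel) = (\<integral>\<^sup>+r. f r \<partial>distr (lborel :: 'a measure) borel norm)"
    by (subst nn_integral_distr) simp_all
  then show ?thesis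
    unfolding distr_norm_lborel by (subst (asm) nn_integral_density) simp_all
qed

lemma nn_integral_powr_to_inf:
  fixes a b :: real
  assumes "a > 0" "b > 0"
  shows "(\<integral>\<^sup>+r. ennreal (indicator {a..} r * r powr (- b - 1)) \<partial>lborel) = ennreal (a powr (- b) / b)"
proof (rule nn_integral_has_integral_lebesgue)
  show "((\<lambda>r. r powr (- b - 1)) has_integral a powr (- b) / b) {a..}"
    using has_integral_powr_to_inf[of "- b - 1" a] assms by (simp add: field_simps)
qed auto

lemma nn_integral_norm_powr_outside:
  fixes a b :: real
  assumes "a > 0" "b > 0"
  shows "(\<integral>\<^sup>+z. ennreal (indicator {a..} (norm (z::'a::euclidean_space)) / norm z powr (DIM('a) + b)) \<partial>lborel) =
     ennreal (DIM('a) * unit_ball_vol DIM('a) * (a powr (- b) / b))"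
proof -
  let ?c = "DIM('a) * unit_ball_vol DIM('a)"
  have "(\<integral>\<^sup>+z. ennreal (indicator {a..} (norm (z::'a)) / norm z powr (DIM('a) + b)) \<partial>lborel)
    = (\<integral>\<^sup>+r. ennreal (?c * r powr (real DIM('a) - 1) * indicator {0<..} r) * ennreal (indicator {a..} r / r powr (DIM('a) + b)) \<partial>lborel)"
    by (rule nn_integral_norm) measurable
  also have "\<dots> = (\<integral>\<^sup>+r. ennreal ?c * ennreal (indicator {a..} r * r powr (- b - 1)) \<partial>lborel)"
  proof (rule nn_integral_cong)
    fix r :: real
    show "ennreal (?c * r powr (real DIM('a) - 1) * indicator {0<..} r) * ennreal (indicator {a..} r / r powr (DIM('a) + b))
      = ennreal ?c * ennreal (indicator {a..} r * r powr (- b - 1))"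
    proof (cases "r \<ge> a")
      case True
      have "r powr (real DIM('a) - 1) / r powr (DIM('a) + b) = r powr (- b - 1)"
        unfolding powr_diff[symmetric] by (rule arg_cong) simp
      then show ?thesis
        using True assms by (simp flip: ennreal_mult' add: mult_ac)
    qed auto
  qed
  also have "\<dots> = ennreal ?c * ennreal (a powr (- b) / b)"
    using nn_integral_powr_to_inf[OF assms] by (subst nn_integral_cmult) simp_all
  also have "\<dots> = ennreal (?c * (a powr (- b) / b))"
    using assms by (intro ennreal_mult[symmetric]) auto
  finally show ?thesis .
qed

text \<open>The integrand behaves like r^(c-1) near 0 and r^(-b-1) at infinity, whence the two
  summands. It is applied with b = s p and c = p (1 - s), where the factor s (1 - s) of the
  normalizing constant cancels both blow-ups.\<close>

lemma nn_integral_norm_powr_bound: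
  fixes b c :: real
  assumes "b > 0" "c > 0"
  shows "(\<integral>\<^sup>+z. ennreal (min 1 (norm (z::'a::euclidean_space) powr (b + c)) / norm z powr (DIM('a) + b)) \<partial>lborel) \<le>
     ennreal (DIM('a) * unit_ball_vol DIM('a) * (1 / c + 1 / b))"
proof -
  let ?c = "DIM('a) * unit_ball_vol DIM('a)"
  have "(\<integral>\<^sup>+z. ennreal (min 1 (norm (z::'a) powr (b + c)) / norm z powr (DIM('a) + b)) \<partial>lborel)
    = (\<integral>\<^sup>+r. ennreal (?c * r powr (real DIM('a) - 1) * indicator {0<..} r) * ennreal (min 1 (r powr (b + c)) / r powr (DIM('a) + b)) \<partial>lborel)"
    by (rule nn_integral_norm) measurable
  also have "\<dots> \<le> (\<integral>\<^sup>+r. ennreal ?c * (ennreal (indicator {0..1} r * r powr (c - 1)) + ennreal (indicator {1..} r * r powr (- b - 1))) \<partial>lborel)"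
  proof (rule nn_integral_mono)
    fix r :: real
    show "ennreal (?c * r powr (real DIM('a) - 1) * indicator {0<..} r) * ennreal (min 1 (r powr (b + c)) / r powr (DIM('a) + b))
      \<le> ennreal ?c * (ennreal (indicator {0..1} r * r powr (c - 1)) + ennreal (indicator {1..} r * r powr (- b - 1)))"
    proof (cases "r > 0")
      case True
      have eq: "r powr (real DIM('a) - 1) / r powr (DIM('a) + b) = r powr (- b - 1)"
        unfolding powr_diff[symmetric] by (rule arg_cong) simp
      have "r powr (real DIM('a) - 1) * (min 1 (r powr (b + c)) / r powr (DIM('a) + b)) = min 1 (r powr (b + c)) * r powr (- b - 1)"
        by (simp flip: eq)
      also have "\<dots> \<le> indicator {0..1} r * r powr (c - 1) + indicator {1..} r * r powr (- b - 1)"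
      proof (cases "r \<le> 1")
        case True
        have "min 1 (r powr (b + c)) * r powr (- b - 1) \<le> r powr (b + c) * r powr (- b - 1)"
          by (intro mult_right_mono) auto
        also have "\<dots> = r powr (c - 1)" by (simp flip: powr_add)
        finally show ?thesis using True \<open>r > 0\<close> by (simp add: add_increasing2)
      next
        case False
        have "min 1 (r powr (b + c)) * r powr (- b - 1) \<le> 1 * r powr (- b - 1)"
          by (intro mult_right_mono) auto
        then show ?thesis using False by simp
      qed
      finally have "?c * (r powr (real DIM('a) - 1) * (min 1 (r powr (b + c)) / r powr (DIM('a) + b)))
        \<le> ?c * (indicator {0..1} r * r powr (c - 1) + indicator {1..} r * r powr (- b - 1))"
        by (rule mult_left_mono) simp
      from ennreal_leI[OF this] show ?thesis
        using True by (simp add: ennreal_mult' mult.assoc flip: ennreal_mult' ennreal_plus)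
    qed auto
  qed
  also have "\<dots> = ennreal ?c * ((\<integral>\<^sup>+r. ennreal (indicator {0..1} r * r powr (c - 1)) \<partial>lborel)
      + (\<integral>\<^sup>+r. ennreal (indicator {1..} r * r powr (- b - 1)) \<partial>lborel))"
    by (subst nn_integral_cmult, measurable, subst nn_integral_add, measurable)
  also have "(\<integral>\<^sup>+r. ennreal (indicator {0..1} r * r powr (c - 1)) \<partial>lborel) = ennreal (1 / c)"
  proof (rule nn_integral_has_integral_lebesgue)
    show "((\<lambda>r. r powr (c - 1)) has_integral 1 / c) {0..1}"
      using has_integral_powr_from_0[of "c - 1" 1] assms by simp
  qed auto
  also have "(\<integral>\<^sup>+r. ennreal (indicator {1..} r * r powr (- b - 1)) \<partial>lborel) = ennreal (1 / b)"
    using nn_integral_powr_to_inf[of 1 b] assms by simp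
  also have "ennreal (1 / c) + ennreal (1 / b) = ennreal (1 / c + 1 / b)"
    using assms by (intro ennreal_plus[symmetric]) auto
  also have "ennreal ?c * ennreal (1 / c + 1 / b) = ennreal (?c * (1 / c + 1 / b))"
    using assms by (intro ennreal_mult[symmetric]) auto
  finally show ?thesis .
qed

section \<open>Dependence of the normalizing constant on s\<close>

definition Gamma_ratio :: "nat \<Rightarrow> real \<Rightarrow> real \<Rightarrow> real" where
  "Gamma_ratio N p s = Gamma ((real N + p * s) / 2) / Gamma (2 - s)"

lemma Gamma_ratio_pos:
  assumes "N > 0" "p \<ge> 0" "s \<in> {0..1}" shows "Gamma_ratio N p s > 0"
  using assms unfolding Gamma_ratio_def
  by (intro divide_pos_pos Gamma_real_pos) (auto intro: add_pos_nonneg)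

lemma Gamma_ratio_continuous:
  assumes "N > 0" "p \<ge> 0" shows "continuous_on {0..1} (Gamma_ratio N p)"
proof -
  have pos: "(real N + p * s) / 2 > 0" if "s \<in> {0..1}" for s
    using assms that by (auto intro: add_pos_nonneg)
  have 1: "(real N + p * s) / 2 \<notin> \<int>\<^sub>\<le>\<^sub>0" "2 - s \<notin> \<int>\<^sub>\<le>\<^sub>0" "Gamma (2 - s) \<noteq> 0" if "s \<in> {0..1}" for s
    using pos[OF that] that by (auto elim!: nonpos_Ints_cases simp: Gamma_eq_zero_iff)
  show ?thesis unfolding Gamma_ratio_def
    by (intro continuous_at_imp_continuous_on ballI continuous_divide isCont_Gamma continuous_intros) (use 1 in auto)
qed

lemma Gamma_ratio_bounds:
  assumes "N > 0" "p \<ge> 0" "s \<in> {0..1}"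
  shows "Gamma_lower N p \<le> Gamma_ratio N p s" "Gamma_ratio N p s \<le> Gamma_upper N p"
proof -
  have "compact (Gamma_ratio N p ` {0..1})"
    using Gamma_ratio_continuous[OF assms(1,2)] by (intro compact_continuous_image) auto
  then have "bounded (Gamma_ratio N p ` {0..1})" by (rule compact_imp_bounded)
  then have "bdd_below (Gamma_ratio N p ` {0..1})" "bdd_above (Gamma_ratio N p ` {0..1})"
    by (auto intro: bounded_imp_bdd_below bounded_imp_bdd_above)
  then show "Gamma_lower N p \<le> Gamma_ratio N p s" "Gamma_ratio N p s \<le> Gamma_upper N p"
    unfolding Gamma_lower_def Gamma_upper_def Gamma_ratio_def[symmetric]
    using assms(3) by (auto intro: cINF_lower cSUP_upper)
qed

text \<open>Everything that does not depend on s is collected in a positive prefactor, which cancels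
  whenever two orders are compared.\<close>

lemma frac_const_altdef:
  "frac_const N p s = p / (4 * pi powr ((real N - 1) / 2) * Gamma ((p + 1) / 2)) * (s * (1 - s) * 4 powr s * Gamma_ratio N p s)"
proof -
  have eq: "2 powr (2 * s - 1) = 4 powr s / (2::real)"
    using powr_powr[of 2 2 s] by (simp add: powr_diff)
  show ?thesis unfolding frac_const_def Gamma_ratio_def eq by (simp add: mult_ac)
qed

lemma frac_const_factor_pos:
  "p > 0 \<Longrightarrow> p / (4 * pi powr ((real N - 1) / 2) * Gamma ((p + 1) / 2)) > 0"
  by (auto intro!: divide_pos_pos mult_pos_pos Gamma_real_pos)

lemma frac_const_pos:
  assumes "N > 0" "p > 0" "s \<in> {0<..<1}" shows "frac_const N p s > 0"
  unfolding frac_const_altdef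
  using assms Gamma_ratio_pos[of N p s] by (intro mult_pos_pos frac_const_factor_pos) auto

text \<open>Only 4^s and the Gamma ratio are estimated; s (1 - s) is kept to compensate the factors
  1 / s and 1 / (1 - s) of the radial integrals.\<close>

lemma frac_const_le:
  assumes "N > 0" "p > 0" "s \<in> {0<..<1}"
  shows "frac_const N p s \<le> p / (4 * pi powr ((real N - 1) / 2) * Gamma ((p + 1) / 2)) * (4 * Gamma_upper N p) * (s * (1 - s))"
proof -
  have "4 powr s * Gamma_ratio N p s \<le> 4 * Gamma_upper N p"
    using assms Gamma_ratio_bounds(2)[of N p s] Gamma_ratio_pos[of N p s] powr_mono[of s 1 4]
    by (intro mult_mono) auto
  then have "(s * (1 - s)) * (4 powr s * Gamma_ratio N p s) \<le> (s * (1 - s)) * (4 * Gamma_upper N p)"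
    using assms by (intro mult_left_mono) auto
  then have "s * (1 - s) * 4 powr s * Gamma_ratio N p s \<le> 4 * Gamma_upper N p * (s * (1 - s))"
    by (simp add: mult_ac)
  from mult_left_mono[OF this less_imp_le[OF frac_const_factor_pos[OF assms(2), of N]]]
  show ?thesis unfolding frac_const_altdef by (simp only: mult.assoc)
qed

text \<open>The quotient r^(b-a) has an exponent between 0 and p, so it is bounded as long as r is.
  This is where the restriction to distances up to 2R enters.\<close>

lemma powr_neg_exponent_mono:
  fixes r \<rho> a b p :: real
  assumes "0 < r" "r \<le> \<rho>" "0 \<le> a" "a \<le> b" "b - a \<le> p"
  shows "r powr (- a) \<le> max 1 (\<rho> powr p) * r powr (- b)"
proof -
  have "r powr (b - a) \<le> max 1 (\<rho> powr p)"
  proof (cases "r \<le> 1")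
    case True
    then have "r powr (b - a) \<le> 1" using assms by (intro powr_le1) auto
    then show ?thesis by simp
  next
    case False
    then have "r powr (b - a) \<le> r powr p" using assms by (intro powr_mono) auto
    also have "\<dots> \<le> \<rho> powr p" using assms by (intro powr_mono2) auto
    finally show ?thesis by simp
  qed
  then have "r powr (b - a) * r powr (- b) \<le> max 1 (\<rho> powr p) * r powr (- b)"
    by (rule mult_right_mono) simp
  then show ?thesis by (simp flip: powr_add)
qed

text \<open>The constant is the reciprocal of the one in the smallness condition, up to \<open>4 \<delta>\<close>.\<close>

lemma frac_const_comparison:
  assumes N: "N > 0" and p: "p > 0" and s: "0 < s" "s \<le> s0" "s0 \<le> s'" "s' \<le> 1 - \<delta>" and "\<delta> > 0"
    and low: "Gamma_lower N p > 0"
    and r: "0 < r" "r \<le> \<rho>"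
  defines "B \<equiv> Gamma_upper N p * max 1 (\<rho> powr p) / (Gamma_lower N p * s0 * \<delta>)"
  shows "frac_const N p s * r powr (- (s * p)) \<le> B * (frac_const N p s' * r powr (- (s' * p)))"
    and "frac_const N p s * r powr (- (s * p)) / s \<le> B * (frac_const N p s' * r powr (- (s' * p)) / s')"
proof -
  let ?A = "p / (4 * pi powr ((real N - 1) / 2) * Gamma ((p + 1) / 2))"
  let ?g = "Gamma_ratio N p" and ?m = "max 1 (\<rho> powr p)"
  have A: "?A > 0" using frac_const_factor_pos[OF p] .
  have s01: "0 < s0" "s < 1" "0 < s'" "s' < 1" using s \<open>\<delta> > 0\<close> by auto
  have g: "0 < ?g s" "?g s \<le> Gamma_upper N p" "Gamma_lower N p \<le> ?g s'"
    using Gamma_ratio_pos[of N p s] Gamma_ratio_bounds[of N p s] Gamma_ratio_bounds[of N p s'] N p s s01 by auto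
  have up: "Gamma_upper N p > 0" using g by linarith
  \<comment> \<open>Both claims are instances: X = s (1 - s), Y = s' (1 - s') for the first, and X =
    1 - s, Y = 1 - s' for the second, where the division by s and s' has removed one factor. In
    either case Y is at least s0 \<delta>, because s' is at least s0 and 1 - s' at least
    \<delta>.\<close>
  have core: "X * 4 powr s * ?g s * r powr (- (s * p)) \<le> B * (Y * 4 powr s' * ?g s' * r powr (- (s' * p)))"
    if X: "0 \<le> X" "X \<le> 1" and Y: "s0 * \<delta> \<le> Y" for X Y
  proof -
    have "s' * p - s * p \<le> p"
      using s s01 p mult_right_mono[of "s' - s" 1 p] by (simp add: algebra_simps)
    then have pw: "r powr (- (s * p)) \<le> ?m * r powr (- (s' * p))"
      using s r p s01 by (intro powr_neg_exponent_mono) (auto intro: mult_right_mono)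
    have "X * 4 powr s * ?g s * r powr (- (s * p)) \<le> 1 * 4 powr s' * Gamma_upper N p * (?m * r powr (- (s' * p)))"
      using X g s up pw by (intro mult_mono powr_mono) auto
    also have "\<dots> = (Gamma_upper N p * ?m) * (4 powr s' * r powr (- (s' * p)))" by simp
    also have "Gamma_upper N p * ?m = B * (Gamma_lower N p * (s0 * \<delta>))"
      unfolding B_def using low s01 \<open>\<delta> > 0\<close> by (simp add: field_simps)
    also have "B * (Gamma_lower N p * (s0 * \<delta>)) \<le> B * (?g s' * Y)"
      using g Y low s01 \<open>\<delta> > 0\<close> up unfolding B_def
      by (intro mult_left_mono[OF mult_mono]) auto
    then have "B * (Gamma_lower N p * (s0 * \<delta>)) * (4 powr s' * r powr (- (s' * p)))
        \<le> B * (?g s' * Y) * (4 powr s' * r powr (- (s' * p)))"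
      by (rule mult_right_mono) simp
    finally show ?thesis by (simp add: mult_ac)
  qed
  have s'd: "\<delta> \<le> 1 - s'" using s by simp
  have "s * (1 - s) \<le> 1" using s s01 by (intro mult_le_one) auto
  moreover have "s0 * \<delta> \<le> s' * (1 - s')" using s s01 s'd \<open>\<delta> > 0\<close> by (intro mult_mono) auto
  ultimately have "s * (1 - s) * 4 powr s * ?g s * r powr (- (s * p)) \<le> B * (s' * (1 - s') * 4 powr s' * ?g s' * r powr (- (s' * p)))"
    using s s01 by (intro core) auto
  from mult_left_mono[OF this less_imp_le[OF A]]
  show "frac_const N p s * r powr (- (s * p)) \<le> B * (frac_const N p s' * r powr (- (s' * p)))"
    unfolding frac_const_altdef by (simp add: mult_ac)
  have "s0 * \<delta> \<le> 1 * (1 - s')" using s s01 s'd \<open>\<delta> > 0\<close> by (intro mult_mono) auto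
  then have "(1 - s) * 4 powr s * ?g s * r powr (- (s * p)) \<le> B * ((1 - s') * 4 powr s' * ?g s' * r powr (- (s' * p)))"
    using s s01 by (intro core) auto
  from mult_left_mono[OF this less_imp_le[OF A]]
  show "frac_const N p s * r powr (- (s * p)) / s \<le> B * (frac_const N p s' * r powr (- (s' * p)) / s')"
    unfolding frac_const_altdef using s s01 by (simp add: mult_ac)
qed

text \<open>For each s' in S' the bound on \<open>W\<close> gives that the integral of a W is at
  most that of a times B W(s'). Integrating this against b over S' multiplies the left-hand side by
  the mass of b on S', which then cancels, being finite; if it is zero, the hypothesis makes a
  vanish as well.\<close>

lemma nn_integral_weight_comparison:
  fixes a b :: "real \<Rightarrow> real" and W :: "real \<Rightarrow> ennreal"
  assumes [measurable]: "a \<in> borel_measurable borel" "b \<in> borel_measurable borel" "W \<in> borel_measurable borel"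
    and fin: "(\<integral>\<^sup>+s. ennreal (b s) \<partial>lborel) < \<infinity>" and c: "c \<ge> 0" and B: "B \<ge> 0"
    and le: "(\<integral>\<^sup>+s. ennreal (a s) * indicator S s \<partial>lborel) \<le> ennreal c * (\<integral>\<^sup>+s. ennreal (b s) * indicator S' s \<partial>lborel)"
    and S: "S \<in> sets borel" "S' \<in> sets borel" and a0: "\<And>s. s \<notin> S \<Longrightarrow> a s \<le> 0"
    and W: "\<And>s s'. s \<in> S \<Longrightarrow> s' \<in> S' \<Longrightarrow> W s \<le> ennreal B * W s'"
  shows "(\<integral>\<^sup>+s. ennreal (a s) * W s \<partial>lborel) \<le> ennreal (c * B) * (\<integral>\<^sup>+s. ennreal (b s) * W s \<partial>lborel)"
proof -
  note [measurable] = S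
  let ?a = "\<integral>\<^sup>+s. ennreal (a s) * indicator S s \<partial>lborel" and ?b = "\<integral>\<^sup>+s. ennreal (b s) * indicator S' s \<partial>lborel"
  let ?aW = "\<integral>\<^sup>+s. ennreal (a s) * W s \<partial>lborel" and ?bW = "\<integral>\<^sup>+s. ennreal (b s) * W s \<partial>lborel"
  have aW: "?aW = (\<integral>\<^sup>+s. ennreal (a s) * indicator S s * W s \<partial>lborel)"
    by (intro nn_integral_cong) (use a0 in \<open>auto simp: indicator_def ennreal_neg\<close>)
  have *: "?aW \<le> ?a * (ennreal B * W s')" if "s' \<in> S'" for s'
  proof -
    have "?aW \<le> (\<integral>\<^sup>+s. ennreal (a s) * indicator S s * (ennreal B * W s') \<partial>lborel)"
      unfolding aW using W[OF _ that] by (intro nn_integral_mono) (auto simp: indicator_def intro!: mult_left_mono)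
    also have "\<dots> = ?a * (ennreal B * W s')" by (rule nn_integral_multc) measurable
    finally show ?thesis .
  qed
  have "?b * ?aW = (\<integral>\<^sup>+s. ennreal (b s) * indicator S' s * ?aW \<partial>lborel)"
    by (rule nn_integral_multc[symmetric]) measurable
  also have "\<dots> \<le> (\<integral>\<^sup>+s. ?a * ennreal B * (ennreal (b s) * W s) \<partial>lborel)"
  proof (rule nn_integral_mono)
    fix s
    show "ennreal (b s) * indicator S' s * ?aW \<le> ?a * ennreal B * (ennreal (b s) * W s)"
      using mult_left_mono[OF *[of s], of "ennreal (b s)"] by (cases "s \<in> S'") (auto simp: mult_ac)
  qed
  also have "\<dots> = ?a * ennreal B * ?bW" by (rule nn_integral_cmult) measurable
  also have "\<dots> \<le> ennreal c * ?b * ennreal B * ?bW" by (intro mult_right_mono le) auto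
  also have "\<dots> = ?b * (ennreal (c * B) * ?bW)" using c B by (simp add: ennreal_mult mult_ac)
  finally have main: "?b * ?aW \<le> ?b * (ennreal (c * B) * ?bW)" .
  have "?b \<le> (\<integral>\<^sup>+s. ennreal (b s) \<partial>lborel)"
    by (intro nn_integral_mono) (auto simp: indicator_def)
  with fin have bfin: "?b \<noteq> \<infinity>" by (auto simp: top_unique)
  show ?thesis
  proof (cases "?b = 0")
    case True
    with le have "?a = 0" by simp
    then have "AE s in lborel. ennreal (a s) * indicator S s = 0"
      by (subst (asm) nn_integral_0_iff_AE) auto
    then have "?aW = 0" unfolding aW by (subst nn_integral_0_iff_AE) (auto elim: eventually_mono)
    then show ?thesis by simp
  next
    case False
    then show ?thesis using main bfin by (simp add: ennreal_mult_le_mult_iff)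
  qed
qed

section \<open>Superposed kernels\<close>

lemma nn_integral_reflect:
  fixes f :: "'a::euclidean_space \<Rightarrow> ennreal"
  assumes [measurable]: "f \<in> borel_measurable borel"
  shows "(\<integral>\<^sup>+y. f (x - y) \<partial>lborel) = (\<integral>\<^sup>+y. f y \<partial>lborel)"
proof -
  have "lborel = distr (lborel :: 'a measure) borel (\<lambda>y. x - y)"
    using lborel_affine[of "-1" x] by (simp add: density_1)
  then have "(\<integral>\<^sup>+y. f y \<partial>lborel) = (\<integral>\<^sup>+y. f y \<partial>distr (lborel :: 'a measure) borel (\<lambda>y. x - y))"
    by (rule arg_cong)
  also have "\<dots> = (\<integral>\<^sup>+y. f (x - y) \<partial>lborel)" by (rule nn_integral_distr) measurable
  finally show ?thesis ..
qed

lemma nn_integral_translate: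
  fixes f :: "'a::euclidean_space \<Rightarrow> ennreal"
  assumes [measurable]: "f \<in> borel_measurable borel"
  shows "(\<integral>\<^sup>+x. f (x - y) \<partial>lborel) = (\<integral>\<^sup>+x. f x \<partial>lborel)"
proof -
  have "(\<integral>\<^sup>+x. f x \<partial>lborel) = (\<integral>\<^sup>+x. f x \<partial>distr (lborel :: 'a measure) borel ((+) (- y)))"
    by (simp only: lborel_distr_plus)
  also have "\<dots> = (\<integral>\<^sup>+x. f (- y + x) \<partial>lborel)" by (rule nn_integral_distr) measurable
  finally show ?thesis by simp
qed

lemma borel_measurable_minus_pair [measurable]:
  "(\<lambda>z::'a::euclidean_space \<times> 'a. fst z - snd z) \<in> borel_measurable borel"
  by (intro borel_measurable_continuous_onI continuous_intros)

lemma nn_convolution: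
  fixes g c :: "'a::euclidean_space \<Rightarrow> ennreal"
  assumes [measurable]: "g \<in> borel_measurable borel" "c \<in> borel_measurable borel"
  shows "(\<integral>\<^sup>+z. g (fst z - snd z) * c (fst z) \<partial>lborel) = (\<integral>\<^sup>+x. g x \<partial>lborel) * (\<integral>\<^sup>+x. c x \<partial>lborel)"
    and "(\<integral>\<^sup>+z. g (fst z - snd z) * c (snd z) \<partial>lborel) = (\<integral>\<^sup>+x. g x \<partial>lborel) * (\<integral>\<^sup>+x. c x \<partial>lborel)"
proof -
  have m1: "(\<lambda>z. g (fst z - snd z) * c (fst z)) \<in> borel_measurable (lborel \<Otimes>\<^sub>M lborel)"
    and m2: "(\<lambda>z. g (fst z - snd z) * c (snd z)) \<in> borel_measurable (lborel \<Otimes>\<^sub>M lborel)"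
    unfolding lborel_prod by measurable
  have "(\<integral>\<^sup>+z. g (fst z - snd z) * c (fst z) \<partial>lborel) = (\<integral>\<^sup>+x. \<integral>\<^sup>+y. g (x - y) * c x \<partial>lborel \<partial>lborel)"
    using lborel.nn_integral_fst[OF m1] by (simp add: lborel_prod)
  also have "\<dots> = (\<integral>\<^sup>+x. (\<integral>\<^sup>+y. g y \<partial>lborel) * c x \<partial>lborel)"
    by (intro nn_integral_cong, subst nn_integral_multc) (simp_all add: nn_integral_reflect)
  finally show "(\<integral>\<^sup>+z. g (fst z - snd z) * c (fst z) \<partial>lborel) = (\<integral>\<^sup>+x. g x \<partial>lborel) * (\<integral>\<^sup>+x. c x \<partial>lborel)"
    by (simp add: nn_integral_cmult)
  have "(\<integral>\<^sup>+z. g (fst z - snd z) * c (snd z) \<partial>lborel) = (\<integral>\<^sup>+y. \<integral>\<^sup>+x. g (x - y) * c y \<partial>lborel \<partial>lborel)"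
    using lborel_pair.nn_integral_snd[OF m2] by (simp add: lborel_prod)
  also have "\<dots> = (\<integral>\<^sup>+y. (\<integral>\<^sup>+x. g x \<partial>lborel) * c y \<partial>lborel)"
    by (intro nn_integral_cong, subst nn_integral_multc) (simp_all add: nn_integral_translate)
  finally show "(\<integral>\<^sup>+z. g (fst z - snd z) * c (snd z) \<partial>lborel) = (\<integral>\<^sup>+x. g x \<partial>lborel) * (\<integral>\<^sup>+x. c x \<partial>lborel)"
    by (simp add: nn_integral_cmult)
qed

lemma convolution_fst:
  fixes g c :: "'a::euclidean_space \<Rightarrow> real"
  assumes [measurable]: "g \<in> borel_measurable borel" and g: "\<And>x. 0 \<le> g x"
    and \<tau>: "(\<integral>\<^sup>+x. ennreal (g x) \<partial>lborel) = ennreal \<tau>" "0 \<le> \<tau>"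
    and c: "integrable lborel c" and [measurable]: "c \<in> borel_measurable borel"
  shows "integrable lborel (\<lambda>z. g (fst z - snd z) * c (fst z))"
    and "(LINT z|lborel. g (fst z - snd z) * c (fst z)) = \<tau> * (LINT x|lborel. c x)"
proof -
  let ?H = "\<lambda>z. g (fst z - snd z) * c (fst z)"
  have m: "?H \<in> borel_measurable (lborel \<Otimes>\<^sub>M lborel)" unfolding lborel_prod by measurable
  have inner: "(\<integral>\<^sup>+y. ennreal (g (x - y)) \<partial>lborel) = ennreal \<tau>" for x
    using nn_integral_reflect[of "\<lambda>y. ennreal (g y)" x] \<tau> by simp
  have "(\<integral>\<^sup>+z. ennreal (norm (?H z)) \<partial>(lborel \<Otimes>\<^sub>M lborel))
      = (\<integral>\<^sup>+z. ennreal (g (fst z - snd z)) * ennreal \<bar>c (fst z)\<bar> \<partial>lborel)"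
    unfolding lborel_prod by (intro nn_integral_cong) (simp add: abs_mult g ennreal_mult)
  also have "\<dots> = (\<integral>\<^sup>+x. ennreal (g x) \<partial>lborel) * (\<integral>\<^sup>+x. ennreal \<bar>c x\<bar> \<partial>lborel)"
    by (rule nn_convolution(1)) measurable
  also have "\<dots> < \<infinity>"
    using c by (auto simp: \<tau> integrable_iff_bounded ennreal_mult_less_top)
  finally have i: "integrable (lborel \<Otimes>\<^sub>M lborel) ?H"
    using m by (auto simp: integrable_iff_bounded)
  then show "integrable lborel ?H" unfolding lborel_prod .
  have "(LINT z|lborel. ?H z) = (LINT x|lborel. LINT y|lborel. ?H (x, y))"
    using lborel_pair.integral_fst'[OF i] unfolding lborel_prod by simp
  also have "\<dots> = (LINT x|lborel. \<tau> * c x)"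
  proof (rule Bochner_Integration.integral_cong)
    fix x
    have "(LINT y|lborel. g (x - y)) = \<tau>"
      using inner[of x] \<tau>(2) g by (subst integral_eq_nn_integral) auto
    then show "(LINT y|lborel. ?H (x, y)) = \<tau> * c x" by simp
  qed simp
  finally show "(LINT z|lborel. ?H z) = \<tau> * (LINT x|lborel. c x)" by simp
qed

lemma lborel_swap:
  fixes f :: "'a::euclidean_space \<times> 'a \<Rightarrow> real"
  assumes "integrable lborel f"
  shows "integrable lborel (\<lambda>z. f (snd z, fst z))" "(LINT z|lborel. f (snd z, fst z)) = (LINT z|lborel. f z)"
proof -
  have f: "integrable (lborel \<Otimes>\<^sub>M lborel) f" using assms by (simp add: lborel_prod)
  show "integrable lborel (\<lambda>z. f (snd z, fst z))"
    using lborel_pair.integrable_product_swap[OF f] by (simp add: lborel_prod case_prod_beta')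
  show "(LINT z|lborel. f (snd z, fst z)) = (LINT z|lborel. f z)"
    using lborel_pair.integral_product_swap[OF borel_measurable_integrable[OF f]]
    by (simp add: lborel_prod case_prod_beta')
qed

lemma convolution_snd:
  fixes g c :: "'a::euclidean_space \<Rightarrow> real"
  assumes [measurable]: "g \<in> borel_measurable borel" and g: "\<And>x. 0 \<le> g x" "\<And>x. g (- x) = g x"
    and \<tau>: "(\<integral>\<^sup>+x. ennreal (g x) \<partial>lborel) = ennreal \<tau>" "0 \<le> \<tau>"
    and c: "integrable lborel c" and [measurable]: "c \<in> borel_measurable borel"
  shows "integrable lborel (\<lambda>z. g (fst z - snd z) * c (snd z))"
    and "(LINT z|lborel. g (fst z - snd z) * c (snd z)) = \<tau> * (LINT x|lborel. c x)"
proof -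
  have "g (y - x) = g (x - y)" for x y using g(2)[of "x - y"] by simp
  then show "integrable lborel (\<lambda>z. g (fst z - snd z) * c (snd z))"
    and "(LINT z|lborel. g (fst z - snd z) * c (snd z)) = \<tau> * (LINT x|lborel. c x)"
    using lborel_swap[OF convolution_fst(1)[OF assms(1) g(1) \<tau> c assms(7)]]
      convolution_fst(2)[OF assms(1) g(1) \<tau> c assms(7)] by simp_all
qed

text \<open>If \<open>2R \<le> |x - y|\<close>, then at most one of \<open>x\<close>, \<open>y\<close> lies in \<open>\<Omega> \<subseteq> B\<^sub>R\<close>, so the interaction decouples
  and sees only the total mass of the kernel.\<close>

lemma far_interaction:
  fixes g u v :: "'a::euclidean_space \<Rightarrow> real"
  assumes [measurable]: "g \<in> borel_measurable borel" and g: "\<And>x. 0 \<le> g x" "\<And>x. g (- x) = g x"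
    and far: "\<And>x. norm x < 2 * R \<Longrightarrow> g x = 0"
    and \<tau>: "(\<integral>\<^sup>+x. ennreal (g x) \<partial>lborel) = ennreal \<tau>" "0 \<le> \<tau>"
    and \<Omega>: "\<Omega> \<subseteq> ball 0 R" and p: "p \<ge> 2"
    and uv: "u \<in> borel_measurable borel" "v \<in> borel_measurable borel"
      "\<And>x. x \<notin> \<Omega> \<Longrightarrow> u x = 0" "\<And>x. x \<notin> \<Omega> \<Longrightarrow> v x = 0"
      "integrable lborel (\<lambda>x. sgpow p (u x) * v x)"
  shows "integrable lborel (\<lambda>z. g (fst z - snd z) * (sgpow p (incr u z) * incr v z))"
    and "(LINT z|lborel. g (fst z - snd z) * (sgpow p (incr u z) * incr v z))
      = 2 * \<tau> * (LINT x|lborel. sgpow p (u x) * v x)"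
proof -
  define c where "c x = sgpow p (u x) * v x" for x
  have ci: "integrable lborel c" using uv(5) by (simp add: c_def[abs_def])
  have cm: "c \<in> borel_measurable borel"
    unfolding c_def using uv(1,2) borel_measurable_sgpow[OF p] by measurable
  \<comment> \<open>One of the two points lies off \<Omega>, and there u and v vanish together;
    since \<open>sgpow\<close> is odd, the product of the increments is the value of
    \<open>c\<close> at the other point, whichever of the two it is.\<close>
  have eq: "g (fst z - snd z) * (sgpow p (incr u z) * incr v z)
      = g (fst z - snd z) * c (fst z) + g (fst z - snd z) * c (snd z)" for z
  proof (cases "norm (fst z - snd z) < 2 * R")
    case False
    have "fst z \<notin> \<Omega> \<or> snd z \<notin> \<Omega>"
    proof (rule ccontr)
      assume "\<not> ?thesis"
      then have "norm (fst z) < R" "norm (snd z) < R" using \<Omega> by auto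
      then show False using False norm_triangle_ineq4[of "fst z" "snd z"] by linarith
    qed
    then show ?thesis using uv(3,4) by (auto simp: incr_def c_def)
  qed (simp add: far)
  note fst = convolution_fst[OF assms(1) g(1) \<tau> ci cm]
  note snd = convolution_snd[OF assms(1) g \<tau> ci cm]
  show "integrable lborel (\<lambda>z. g (fst z - snd z) * (sgpow p (incr u z) * incr v z))"
    unfolding eq by (intro Bochner_Integration.integrable_add fst(1) snd(1))
  show "(LINT z|lborel. g (fst z - snd z) * (sgpow p (incr u z) * incr v z))
      = 2 * \<tau> * (LINT x|lborel. sgpow p (u x) * v x)"
    unfolding eq Bochner_Integration.integral_add[OF fst(1) snd(1)] fst(2) snd(2) by (simp add: c_def[abs_def])
qed

section \<open>Kernels integrated over the order s\<close>

definition frac_weight :: "nat \<Rightarrow> real \<Rightarrow> real \<Rightarrow> real" where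
  "frac_weight N p s = indicator {0<..<1} s * frac_const N p s"

lemma frac_weight_nonneg: "N > 0 \<Longrightarrow> p > 0 \<Longrightarrow> 0 \<le> frac_weight N p s"
  using frac_const_pos[of N p s] by (auto simp: frac_weight_def indicator_def)

lemma borel_measurable_frac_weight:
  assumes "N > 0" "p > 0" shows "frac_weight N p \<in> borel_measurable borel"
proof -
  have "continuous_on {0<..<1} (Gamma_ratio N p)"
    by (rule continuous_on_subset[OF Gamma_ratio_continuous]) (use assms in auto)
  then have "continuous_on {0<..<1} (frac_const N p)"
    unfolding frac_const_altdef[abs_def] by (intro continuous_intros) auto
  then have "(\<lambda>s. indicator {0<..<1} s *\<^sub>R frac_const N p s) \<in> borel_measurable borel"
    by (intro borel_measurable_continuous_on_indicator) auto
  then show ?thesis by (simp add: frac_weight_def[abs_def])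
qed

lemma frac_weight_le:
  assumes "N > 0" "p > 0"
  obtains A where "A > 0" "\<And>s. s \<in> {0<..<1} \<Longrightarrow> frac_weight N p s \<le> A * (s * (1 - s))" "\<And>s. frac_weight N p s \<le> A"
proof -
  define A where "A = p / (4 * pi powr ((real N - 1) / 2) * Gamma ((p + 1) / 2)) * (4 * Gamma_upper N p)"
  have "Gamma_upper N p > 0"
    using Gamma_ratio_pos[of N p 0] Gamma_ratio_bounds(2)[of N p 0] assms by auto
  then have A: "A > 0" unfolding A_def using frac_const_factor_pos[OF assms(2), of N] by (intro mult_pos_pos) auto
  have 1: "frac_weight N p s \<le> A * (s * (1 - s))" if "s \<in> {0<..<1}" for s
    using frac_const_le[OF assms that] that by (simp add: frac_weight_def A_def)
  moreover have "frac_weight N p s \<le> A" for s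
  proof (cases "s \<in> {0<..<1}")
    case True
    have "s * (1 - s) \<le> 1" using True by (intro mult_le_one) auto
    then have "A * (s * (1 - s)) \<le> A * 1" using A by (intro mult_left_mono) auto
    with 1[OF True] show ?thesis by simp
  qed (use A in \<open>simp add: frac_weight_def\<close>)
  ultimately show ?thesis using A that by blast
qed

definition weight :: "(real \<Rightarrow> real) \<Rightarrow> bool" where
  "weight \<phi> \<longleftrightarrow> \<phi> \<in> borel_measurable borel \<and> (\<forall>s. 0 \<le> \<phi> s) \<and> (\<forall>s. s \<notin> {0<..<1} \<longrightarrow> \<phi> s = 0)
    \<and> (\<integral>\<^sup>+s. ennreal (\<phi> s) \<partial>lborel) < \<infinity>"

definition kern :: "real \<Rightarrow> real \<Rightarrow> real ^ 'n \<Rightarrow> real" where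
  "kern p s z = frac_weight CARD('n) p s / norm z powr (real CARD('n) + s * p)"

text \<open>Real-valued so that signed combinations make sense; the integral is finite by
  \<open>ennreal_Ker\<close>. At z = 0 division by zero gives the value 0, in accordance with the
  convention on the diagonal.\<close>

definition Ker :: "real \<Rightarrow> (real \<Rightarrow> real) \<Rightarrow> real ^ 'n \<Rightarrow> real" where
  "Ker p \<phi> z = enn2real (\<integral>\<^sup>+s. ennreal (\<phi> s) * ennreal (kern p s z) \<partial>lborel)"

text \<open>For s in (0,1) this is the integral of \<open>kern p s\<close> over norm z \<ge> 2 R in
  polar coordinates, \<open>N * unit_ball_vol N\<close> being the area of the unit sphere.\<close>

definition tail_mass :: "nat \<Rightarrow> real \<Rightarrow> real \<Rightarrow> real \<Rightarrow> real" where
  "tail_mass N p R s = frac_weight N p s * (N * unit_ball_vol N * ((2 * R) powr (- (s * p)) / (s * p)))"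

lemma kern_nonneg: "p > 0 \<Longrightarrow> 0 \<le> kern p s z"
  by (simp add: kern_def frac_weight_nonneg)

lemma kern_measurable [measurable]:
  assumes "p > 0" shows "(\<lambda>(s, z :: real ^ 'n). kern p s z) \<in> borel_measurable (borel \<Otimes>\<^sub>M borel)"
proof -
  have [measurable]: "frac_weight CARD('n) p \<in> borel_measurable borel"
    using assms by (intro borel_measurable_frac_weight) auto
  show ?thesis unfolding kern_def by measurable
qed

lemma weightD:
  assumes "weight \<phi>"
  shows weight_measurable: "\<phi> \<in> borel_measurable borel" and weight_nonneg: "0 \<le> \<phi> s"
    and weight_outside: "s \<notin> {0<..<1} \<Longrightarrow> \<phi> s = 0" and weight_finite: "(\<integral>\<^sup>+s. ennreal (\<phi> s) \<partial>lborel) < \<infinity>"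
  using assms by (auto simp: weight_def)

lemma weight_mult_bounded:
  assumes "weight \<phi>" "\<And>s. s \<in> {0<..<1} \<Longrightarrow> h s \<le> ennreal B"
  shows "(\<integral>\<^sup>+s. ennreal (\<phi> s) * h s \<partial>lborel) \<le> (\<integral>\<^sup>+s. ennreal (\<phi> s) \<partial>lborel) * ennreal B"
    and "(\<integral>\<^sup>+s. ennreal (\<phi> s) * h s \<partial>lborel) < \<infinity>"
proof -
  note [measurable] = weight_measurable[OF assms(1)]
  have "(\<integral>\<^sup>+s. ennreal (\<phi> s) * h s \<partial>lborel) \<le> (\<integral>\<^sup>+s. ennreal (\<phi> s) * ennreal B \<partial>lborel)"
  proof (rule nn_integral_mono)
    fix s show "ennreal (\<phi> s) * h s \<le> ennreal (\<phi> s) * ennreal B"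
      using assms(2)[of s] weight_outside[OF assms(1), of s] by (cases "s \<in> {0<..<1}") (auto intro: mult_left_mono)
  qed
  also have "\<dots> = (\<integral>\<^sup>+s. ennreal (\<phi> s) \<partial>lborel) * ennreal B" by (rule nn_integral_multc) measurable
  finally show 1: "(\<integral>\<^sup>+s. ennreal (\<phi> s) * h s \<partial>lborel) \<le> (\<integral>\<^sup>+s. ennreal (\<phi> s) \<partial>lborel) * ennreal B" .
  also have "\<dots> < \<infinity>" using weight_finite[OF assms(1)] by (auto simp: ennreal_mult_less_top)
  finally show "(\<integral>\<^sup>+s. ennreal (\<phi> s) * h s \<partial>lborel) < \<infinity>" .
qed

lemma powr_minus_le_one_plus:
  fixes x a b :: real
  assumes "0 \<le> x" "0 \<le> a" "a \<le> b"
  shows "x powr (- a) \<le> 1 + x powr (- b)"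
proof (cases "x \<ge> 1")
  case True
  then have "x powr (- a) \<le> x powr 0" using assms by (intro powr_mono) auto
  also have "x powr 0 = 1" using True by simp
  finally show ?thesis using powr_ge_zero[of x "- b"] by linarith
next
  case False
  then have "x powr (- a) \<le> x powr (- b)" using assms by (intro powr_mono') auto
  then show ?thesis by simp
qed

text \<open>At fixed z, |z|^(-N-sp) is at most 1 + |z|^(-N-p) for all s in (0,1), so integrability
  of the weight suffices.\<close>

lemma ennreal_Ker:
  fixes z :: "real ^ 'n"
  assumes "p > 0" "weight \<phi>"
  shows "ennreal (Ker p \<phi> z) = (\<integral>\<^sup>+s. ennreal (\<phi> s) * ennreal (kern p s z) \<partial>lborel)"
proof -
  let ?N = "real CARD('n)"
  obtain A where A: "A > 0" "\<And>s. s \<in> {0<..<1} \<Longrightarrow> frac_weight CARD('n) p s \<le> A * (s * (1 - s))"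
      "\<And>s. frac_weight CARD('n) p s \<le> A"
    by (rule frac_weight_le[OF zero_less_card_finite[where 'a = 'n] assms(1)]) blast
  have "kern p s z \<le> A * (1 + norm z powr (- (?N + p)))" if s: "s \<in> {0<..<1}" for s
  proof -
    have "norm z powr (- (?N + s * p)) \<le> 1 + norm z powr (- (?N + p))"
      using s assms(1) by (intro powr_minus_le_one_plus add_nonneg_nonneg) auto
    then have "frac_weight CARD('n) p s * norm z powr (- (?N + s * p)) \<le> A * (1 + norm z powr (- (?N + p)))"
      using A by (intro mult_mono) auto
    then show ?thesis by (simp only: kern_def powr_minus divide_inverse)
  qed
  then have "(\<integral>\<^sup>+s. ennreal (\<phi> s) * ennreal (kern p s z) \<partial>lborel) < \<infinity>"
    by (intro weight_mult_bounded(2)[OF assms(2)]) (rule ennreal_leI)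
  then show ?thesis unfolding Ker_def by simp
qed

lemma Ker_nonneg: "0 \<le> Ker p \<phi> z" by (simp add: Ker_def)

lemma Ker_minus: "Ker p \<phi> (- z) = Ker p \<phi> z" by (simp add: Ker_def kern_def)

lemma Ker_measurable:
  assumes "p > 0" "weight \<phi>" shows "Ker p \<phi> \<in> borel_measurable (borel :: (real ^ 'n) measure)"
proof -
  note [measurable] = weight_measurable[OF assms(2)] kern_measurable[OF assms(1)]
  show ?thesis unfolding Ker_def by measurable
qed

text \<open>One Tonelli statement for both uses: \<open>\<zeta>\<close> is the identity for masses
  and the difference of the two points for energies.\<close>

lemma Ker_swap:
  fixes h :: "'b \<Rightarrow> ennreal" and \<zeta> :: "'b \<Rightarrow> real ^ 'n"
  assumes "p > 0" "weight \<phi>" "sigma_finite_measure M"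
    and [measurable]: "h \<in> borel_measurable M" "\<zeta> \<in> borel_measurable M"
  shows "(\<integral>\<^sup>+z. ennreal (Ker p \<phi> (\<zeta> z)) * h z \<partial>M)
    = (\<integral>\<^sup>+s. ennreal (\<phi> s) * (\<integral>\<^sup>+z. ennreal (kern p s (\<zeta> z)) * h z \<partial>M) \<partial>lborel)"
proof -
  interpret M: sigma_finite_measure M by fact
  interpret P: pair_sigma_finite lborel M ..
  note [measurable] = weight_measurable[OF assms(2)]
  have [measurable]: "(\<lambda>(s, z). kern p s (\<zeta> z)) \<in> borel_measurable (lborel \<Otimes>\<^sub>M M)"
  proof -
    have "(\<lambda>(s, z). (s, \<zeta> z)) \<in> lborel \<Otimes>\<^sub>M M \<rightarrow>\<^sub>M borel \<Otimes>\<^sub>M borel" by measurable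
    from measurable_compose[OF this kern_measurable[OF assms(1)]] show ?thesis
      by (simp add: case_prod_beta')
  qed
  have km [measurable]: "(\<lambda>s. kern p s (\<zeta> z)) \<in> borel_measurable lborel" for z
  proof -
    have "(\<lambda>s. (s, \<zeta> z)) \<in> lborel \<rightarrow>\<^sub>M borel \<Otimes>\<^sub>M borel" by measurable
    from measurable_compose[OF this kern_measurable[OF assms(1)]] show ?thesis by simp
  qed
  have [measurable]: "(\<lambda>z. kern p s (\<zeta> z)) \<in> borel_measurable M" for s
  proof -
    have "(\<lambda>z. (s, \<zeta> z)) \<in> M \<rightarrow>\<^sub>M borel \<Otimes>\<^sub>M borel" by measurable
    from measurable_compose[OF this kern_measurable[OF assms(1)]] show ?thesis by simp
  qed
  have "(\<integral>\<^sup>+z. ennreal (Ker p \<phi> (\<zeta> z)) * h z \<partial>M)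
      = (\<integral>\<^sup>+z. \<integral>\<^sup>+s. ennreal (\<phi> s) * ennreal (kern p s (\<zeta> z)) * h z \<partial>lborel \<partial>M)"
    unfolding ennreal_Ker[OF assms(1,2)] by (intro nn_integral_cong nn_integral_multc[symmetric]) measurable
  also have "\<dots> = (\<integral>\<^sup>+s. \<integral>\<^sup>+z. ennreal (\<phi> s) * ennreal (kern p s (\<zeta> z)) * h z \<partial>M \<partial>lborel)"
    by (rule P.Fubini') measurable
  also have "\<dots> = (\<integral>\<^sup>+s. ennreal (\<phi> s) * (\<integral>\<^sup>+z. ennreal (kern p s (\<zeta> z)) * h z \<partial>M) \<partial>lborel)"
    by (intro nn_integral_cong, subst nn_integral_cmult[symmetric]) (auto simp: mult.assoc)
  finally show ?thesis .
qed

lemma Ker_tail: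
  assumes p: "p > 0" and \<phi>: "weight \<phi>" and R: "R > 0"
  shows "(\<integral>\<^sup>+z. ennreal (indicator {2 * R..} (norm (z :: real ^ 'n)) * Ker p \<phi> z) \<partial>lborel)
      = (\<integral>\<^sup>+s. ennreal (\<phi> s) * ennreal (tail_mass CARD('n) p R s) \<partial>lborel)"
    and "(\<integral>\<^sup>+s. ennreal (\<phi> s) * ennreal (tail_mass CARD('n) p R s) \<partial>lborel) < \<infinity>"
proof -
  let ?N = "CARD('n)"
  have "(\<integral>\<^sup>+z. ennreal (indicator {2 * R..} (norm (z :: real ^ 'n)) * Ker p \<phi> z) \<partial>lborel)
      = (\<integral>\<^sup>+z. ennreal (Ker p \<phi> z) * indicator {2 * R..} (norm (z :: real ^ 'n)) \<partial>lborel)"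
    by (intro nn_integral_cong) (auto simp: indicator_def)
  also have "\<dots> = (\<integral>\<^sup>+s. ennreal (\<phi> s) * (\<integral>\<^sup>+z. ennreal (kern p s z) * indicator {2 * R..} (norm (z :: real ^ 'n)) \<partial>lborel) \<partial>lborel)"
    by (rule Ker_swap[OF p \<phi> sigma_finite_lborel]) measurable
  also have "\<dots> = (\<integral>\<^sup>+s. ennreal (\<phi> s) * ennreal (tail_mass CARD('n) p R s) \<partial>lborel)"
  proof (rule nn_integral_cong)
    fix s
    show "ennreal (\<phi> s) * (\<integral>\<^sup>+z. ennreal (kern p s z) * indicator {2 * R..} (norm (z :: real ^ 'n)) \<partial>lborel)
        = ennreal (\<phi> s) * ennreal (tail_mass CARD('n) p R s)"
    proof (cases "s \<in> {0<..<1}")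
      case True
      have "(\<integral>\<^sup>+z. ennreal (kern p s z) * indicator {2 * R..} (norm (z :: real ^ 'n)) \<partial>lborel)
        = (\<integral>\<^sup>+z. ennreal (frac_weight ?N p s) * ennreal (indicator {2 * R..} (norm z) / norm (z :: real ^ 'n) powr (real ?N + s * p)) \<partial>lborel)"
        by (intro nn_integral_cong)
           (auto simp: kern_def indicator_def frac_weight_nonneg p simp flip: ennreal_mult)
      also have "\<dots> = ennreal (frac_weight ?N p s) * ennreal (?N * unit_ball_vol ?N * ((2 * R) powr (- (s * p)) / (s * p)))"
        using nn_integral_norm_powr_outside[where 'a = "real ^ 'n", of "2 * R" "s * p"] True p R
        by (subst nn_integral_cmult) auto
      also have "\<dots> = ennreal (tail_mass CARD('n) p R s)"
        unfolding tail_mass_def using p True by (intro ennreal_mult[symmetric] frac_weight_nonneg) auto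
      finally show ?thesis by simp
    qed (simp add: weight_outside[OF \<phi>])
  qed
  finally show "(\<integral>\<^sup>+z. ennreal (indicator {2 * R..} (norm (z :: real ^ 'n)) * Ker p \<phi> z) \<partial>lborel)
      = (\<integral>\<^sup>+s. ennreal (\<phi> s) * ennreal (tail_mass CARD('n) p R s) \<partial>lborel)" .
  obtain A where A: "A > 0" "\<And>s. s \<in> {0<..<1} \<Longrightarrow> frac_weight ?N p s \<le> A * (s * (1 - s))"
      "\<And>s. frac_weight ?N p s \<le> A"
    by (rule frac_weight_le[OF zero_less_card_finite[where 'a = 'n] p]) blast
  let ?c = "?N * unit_ball_vol ?N"
  have "tail_mass CARD('n) p R s \<le> A * (?c * ((1 + (2 * R) powr (- p)) / p))" if s: "s \<in> {0<..<1}" for s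
  proof -
    have "(2 * R) powr (- (s * p)) \<le> 1 + (2 * R) powr (- p)"
      using s p R by (intro powr_minus_le_one_plus) auto
    \<comment> \<open>The factor s of the normalizing constant compensates the 1 / (s p) produced by
      integrating to infinity; otherwise the tail would blow up as s tends to 0.\<close>
    moreover have "frac_weight ?N p s / s \<le> A"
    proof -
      have "A * (s * (1 - s)) \<le> A * s"
        using s A(1) by (intro mult_left_mono) (auto simp: mult_left_le)
      then have "frac_weight ?N p s \<le> A * s"
        using A(2)[OF s] by linarith
      then show ?thesis using s by (simp add: field_simps)
    qed
    ultimately have "frac_weight ?N p s / s * (?c * ((2 * R) powr (- (s * p)) / p))
        \<le> A * (?c * ((1 + (2 * R) powr (- p)) / p))"
      using A(1) p by (intro mult_mono mult_left_mono divide_right_mono) auto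
    moreover have "tail_mass CARD('n) p R s = frac_weight ?N p s / s * (?c * ((2 * R) powr (- (s * p)) / p))"
      by (simp add: tail_mass_def)
    ultimately show ?thesis by simp
  qed
  then show "(\<integral>\<^sup>+s. ennreal (\<phi> s) * ennreal (tail_mass CARD('n) p R s) \<partial>lborel) < \<infinity>"
    by (intro weight_mult_bounded(2)[OF \<phi>]) (rule ennreal_leI)
qed

section \<open>Reduction to a nonnegative kernel\<close>

lemma frac_integrand_altdef:
  "frac_integrand s p u v z =
    sgpow p (incr u z) * incr v z / norm (fst z - snd z) powr (real CARD('n) + s * p)"
  for z :: "(real ^ 'n) \<times> (real ^ 'n)"
  by (simp add: frac_integrand_def sgpow_def incr_def case_prod_beta)

abbreviation energy :: "real \<Rightarrow> ('a::euclidean_space \<Rightarrow> real) \<Rightarrow> ('a \<Rightarrow> real) \<Rightarrow> ennreal" where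
  "energy p \<kappa> u \<equiv> \<integral>\<^sup>+z. ennreal (\<kappa> (fst z - snd z)) * ennreal (\<bar>incr u z\<bar> powr p) \<partial>lborel"

text \<open>Fubini on orders times pairs of points. Integrating first over s turns the weighted
  kernels into \<open>Ker\<close>, and the form is dominated by the two energies, so the product
  function is absolutely integrable. The integrability clauses of a weak solution that involve the
  order s come from here.\<close>

lemma form_slice:
  fixes u v :: "real ^ 'n \<Rightarrow> real"
  assumes p: "p \<ge> 2" and \<phi>: "weight \<phi>"
    and [measurable]: "u \<in> borel_measurable borel" "v \<in> borel_measurable borel"
    and fin: "energy p (Ker p \<phi>) u < \<infinity>"
      "energy p (Ker p \<phi>) v < \<infinity>"
  shows "AE s in lborel. \<phi> s \<noteq> 0 \<longrightarrow> integrable lborel (frac_integrand s p u v)"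
    and "integrable lborel (\<lambda>s. \<phi> s * frac_form s p u v)"
    and "integrable lborel (\<lambda>z. Ker p \<phi> (fst z - snd z) * (sgpow p (incr u z) * incr v z))"
    and "(LINT s|lborel. \<phi> s * frac_form s p u v) =
      (LINT z|lborel. Ker p \<phi> (fst z - snd z) * (sgpow p (incr u z) * incr v z))"
proof -
  have p0: "p > 0" using p by simp
  note [measurable] = weight_measurable[OF \<phi>] borel_measurable_sgpow[OF p] Ker_measurable[OF p0 \<phi>]
  define \<Phi> where "\<Phi> z = sgpow p (incr u z) * incr v z" for z
  have \<Phi> [measurable]: "\<Phi> \<in> borel_measurable borel" unfolding \<Phi>_def by measurable
  have Kerm [measurable]: "(\<lambda>z. Ker p \<phi> (fst z - snd z)) \<in> borel_measurable (borel :: ((real ^ 'n) \<times> (real ^ 'n)) measure)"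
    using measurable_compose[OF borel_measurable_minus_pair Ker_measurable[OF p0 \<phi>]] .
  define H where "H s z = \<phi> s * kern p s (fst z - snd z) * \<Phi> z" for s z
  have km [measurable]: "(\<lambda>(s, z :: (real ^ 'n) \<times> (real ^ 'n)). kern p s (fst z - snd z)) \<in> borel_measurable (lborel \<Otimes>\<^sub>M lborel)"
  proof -
    have "(\<lambda>(s, z :: (real ^ 'n) \<times> (real ^ 'n)). (s, fst z - snd z)) \<in> lborel \<Otimes>\<^sub>M lborel \<rightarrow>\<^sub>M borel \<Otimes>\<^sub>M borel"
      using borel_measurable_minus_pair[where 'a = "real ^ 'n"] by measurable
    from measurable_compose[OF this kern_measurable[OF p0]] show ?thesis by (simp add: case_prod_beta')
  qed
  have km1 [measurable]: "(\<lambda>s. kern p s z) \<in> borel_measurable lborel" for z :: "real ^ 'n"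
  proof -
    have "(\<lambda>s. (s, z)) \<in> lborel \<rightarrow>\<^sub>M borel \<Otimes>\<^sub>M borel" by measurable
    from measurable_compose[OF this kern_measurable[OF p0]] show ?thesis by simp
  qed
  have Hm: "(\<lambda>(s, z). H s z) \<in> borel_measurable (lborel \<Otimes>\<^sub>M lborel)" unfolding H_def by measurable
  have \<Phi>_le: "\<bar>\<Phi> z\<bar> \<le> \<bar>incr u z\<bar> powr p + \<bar>incr v z\<bar> powr p" for z
    unfolding \<Phi>_def by (rule abs_sgpow_mult_le[OF p])
  have K\<Phi>: "(\<integral>\<^sup>+z. ennreal (Ker p \<phi> (fst z - snd z)) * ennreal \<bar>\<Phi> z\<bar> \<partial>lborel) < \<infinity>"
  proof -
    have "(\<integral>\<^sup>+z. ennreal (Ker p \<phi> (fst z - snd z)) * ennreal \<bar>\<Phi> z\<bar> \<partial>lborel) \<le>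
      (\<integral>\<^sup>+z. ennreal (Ker p \<phi> (fst z - snd z)) * ennreal (\<bar>incr u z\<bar> powr p) +
         ennreal (Ker p \<phi> (fst z - snd z)) * ennreal (\<bar>incr v z\<bar> powr p) \<partial>lborel)"
      unfolding distrib_left[symmetric]
      by (intro nn_integral_mono mult_left_mono) (use \<Phi>_le in \<open>auto simp: ennreal_leI simp flip: ennreal_plus\<close>)
    also have "\<dots> < \<infinity>" using fin by (subst nn_integral_add) auto
    finally show ?thesis .
  qed
  have "(\<integral>\<^sup>+w. ennreal (norm (case w of (s, z) \<Rightarrow> H s z)) \<partial>(lborel \<Otimes>\<^sub>M lborel))
     = (\<integral>\<^sup>+z. \<integral>\<^sup>+s. ennreal (norm (H s z)) \<partial>lborel \<partial>lborel)"
    by (subst lborel_pair.nn_integral_snd[symmetric]) (use Hm in \<open>auto simp: case_prod_beta'\<close>)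
  also have "\<dots> = (\<integral>\<^sup>+z. ennreal (Ker p \<phi> (fst z - snd z)) * ennreal \<bar>\<Phi> z\<bar> \<partial>lborel)"
  proof (rule nn_integral_cong)
    fix z :: "(real ^ 'n) \<times> (real ^ 'n)"
    have "(\<integral>\<^sup>+s. ennreal (norm (H s z)) \<partial>lborel)
      = (\<integral>\<^sup>+s. ennreal (\<phi> s) * ennreal (kern p s (fst z - snd z)) * ennreal \<bar>\<Phi> z\<bar> \<partial>lborel)"
      by (intro nn_integral_cong)
         (simp add: H_def abs_mult ennreal_mult weight_nonneg[OF \<phi>] kern_nonneg[OF p0])
    also have "\<dots> = (\<integral>\<^sup>+s. ennreal (\<phi> s) * ennreal (kern p s (fst z - snd z)) \<partial>lborel) * ennreal \<bar>\<Phi> z\<bar>"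
      by (rule nn_integral_multc) measurable
    finally show "(\<integral>\<^sup>+s. ennreal (norm (H s z)) \<partial>lborel) = ennreal (Ker p \<phi> (fst z - snd z)) * ennreal \<bar>\<Phi> z\<bar>"
      by (simp add: ennreal_Ker[OF p0 \<phi>])
  qed
  finally have i: "integrable (lborel \<Otimes>\<^sub>M lborel) (\<lambda>(s, z). H s z)"
    using K\<Phi> Hm by (auto simp: integrable_iff_bounded)
  have form: "H s z = (\<phi> s * frac_const CARD('n) p s) * frac_integrand s p u v z" for s z
    using weight_outside[OF \<phi>, of s]
    by (cases "s \<in> {0<..<1}") (auto simp: H_def kern_def frac_weight_def frac_integrand_altdef \<Phi>_def)
  show "AE s in lborel. \<phi> s \<noteq> 0 \<longrightarrow> integrable lborel (frac_integrand s p u v)"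
    using lborel_pair.AE_integrable_fst[OF i]
  proof eventually_elim
    case (elim s)
    show ?case
    proof
      assume "\<phi> s \<noteq> 0"
      then have "s \<in> {0<..<1}" using weight_outside[OF \<phi>] by blast
      then have "\<phi> s * frac_const CARD('n) p s \<noteq> 0"
        using \<open>\<phi> s \<noteq> 0\<close> frac_const_pos[of "CARD('n)" p s] p0 by auto
      then show "integrable lborel (frac_integrand s p u v)" using elim unfolding form by simp
    qed
  qed
  have fim: "frac_integrand s p u v \<in> borel_measurable lborel" for s
    unfolding frac_integrand_altdef[abs_def] by measurable
  have inner: "(LINT z|lborel. H s z) = \<phi> s * frac_form s p u v" for s
    unfolding form frac_form_def integral_completion[OF fim] by simp
  show "integrable lborel (\<lambda>s. \<phi> s * frac_form s p u v)"
    using lborel_pair.integrable_fst[OF i] unfolding inner .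
  have KerL: "(LINT s|lborel. H s z) = Ker p \<phi> (fst z - snd z) * \<Phi> z" for z
  proof -
    have "(LINT s|lborel. \<phi> s * kern p s (fst z - snd z)) = Ker p \<phi> (fst z - snd z)"
      unfolding Ker_def
      by (subst integral_eq_nn_integral) (auto simp: ennreal_mult weight_nonneg[OF \<phi>] kern_nonneg[OF p0])
    then show ?thesis by (simp add: H_def)
  qed
  show "integrable lborel (\<lambda>z. Ker p \<phi> (fst z - snd z) * (sgpow p (incr u z) * incr v z))"
    using lborel_pair.integrable_snd[OF i] unfolding KerL \<Phi>_def .
  show "(LINT s|lborel. \<phi> s * frac_form s p u v) =
      (LINT z|lborel. Ker p \<phi> (fst z - snd z) * (sgpow p (incr u z) * incr v z))"
    using lborel_pair.integral_fst[OF i] lborel_pair.integral_snd[OF i] unfolding inner KerL \<Phi>_def by simp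
qed

section \<open>From the signed kernel to a comparable nonnegative one\<close>

definition mass :: "nat \<Rightarrow> real \<Rightarrow> real \<Rightarrow> (real \<Rightarrow> real) \<Rightarrow> real" where
  "mass N p R \<phi> = enn2real (\<integral>\<^sup>+s. ennreal (\<phi> s) * ennreal (tail_mass N p R s) \<partial>lborel)"

lemma mass_nonneg: "0 \<le> mass N p R \<phi>"
  by (simp add: mass_def)

lemma nn_integral_Ker_tail:
  assumes "p > 0" "weight \<phi>" "R > 0"
  shows "(\<integral>\<^sup>+z. ennreal (indicator {2 * R..} (norm (z :: real ^ 'n)) * Ker p \<phi> z) \<partial>lborel)
    = ennreal (mass CARD('n) p R \<phi>)"
  using Ker_tail[OF assms, where 'n = 'n] by (simp add: mass_def)

lemma tail_mass_pos:
  assumes "N > 0" "p > 0" "R > 0" "s \<in> {0<..<1}" shows "tail_mass N p R s > 0"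
proof -
  have "frac_weight N p s > 0"
    using assms frac_const_pos[of N p s] by (simp add: frac_weight_def)
  then show ?thesis using assms by (simp add: tail_mass_def)
qed

text \<open>\<open>fp\<close> and \<open>fm\<close> stand for the positive and negative parts of f.
  The negative kernel is controlled pointwise at short range and only in mass at long range; the
  factor 1 / 4 is what the smallness condition delivers.\<close>

locale superposition =
  fixes \<Omega> :: "(real ^ 'n) set" and R p :: real and fp fm :: "real \<Rightarrow> real"
  assumes Omega_open: "open \<Omega>" and Omega_nonempty: "\<Omega> \<noteq> {}"
    and Omega_ball: "\<Omega> \<subseteq> ball 0 R" and R_pos: "R > 0" and p_ge: "p \<ge> 2"
    and weights: "weight fp" "weight fm"
    and f_pos: "(\<integral>\<^sup>+s. ennreal (fp s) \<partial>lborel) > 0"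
    and near: "\<And>z :: real ^ 'n. 0 < norm z \<Longrightarrow> norm z < 2 * R \<Longrightarrow> Ker p fm z \<le> Ker p fp z / 4"
    and tails: "mass CARD('n) p R fm \<le> mass CARD('n) p R fp / 4"
begin

abbreviation Kp :: "real ^ 'n \<Rightarrow> real" where "Kp \<equiv> Ker p fp"
abbreviation Km :: "real ^ 'n \<Rightarrow> real" where "Km \<equiv> Ker p fm"

text \<open>The mass of the signed kernel at distance at least 2R. It becomes the constant
  \<open>T\<close> of \<open>nonlocal_form\<close>.\<close>

definition \<tau> :: real where "\<tau> = mass CARD('n) p R fp - mass CARD('n) p R fm"

text \<open>Beyond distance \<open>2R\<close> only the total mass of the kernel matters, so there the signed kernel may be
  replaced by a multiple of the positive one with the same mass. The result is nonnegative and comparable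
  to \<open>Kp\<close>.\<close>

definition \<kappa> :: "real ^ 'n \<Rightarrow> real" where
  "\<kappa> z = (if norm z < 2 * R then Kp z - Km z else \<tau> / mass CARD('n) p R fp * Kp z)"

lemma p_pos: "p > 0" using p_ge by simp

lemma mp_pos: "mass CARD('n) p R fp > 0"
proof -
  note [measurable] = weight_measurable[OF weights(1)]
  have [measurable]: "tail_mass CARD('n) p R \<in> borel_measurable borel"
    using borel_measurable_frac_weight[of "CARD('n)" p] p_pos unfolding tail_mass_def by measurable
  have "mass CARD('n) p R fp \<noteq> 0"
  proof
    assume "mass CARD('n) p R fp = 0"
    then have "(\<integral>\<^sup>+s. ennreal (fp s) * ennreal (tail_mass CARD('n) p R s) \<partial>lborel) = 0"
      using Ker_tail(2)[OF p_pos weights(1) R_pos, where 'n = 'n] by (auto simp: mass_def enn2real_eq_0_iff)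
    then have "AE s in lborel. ennreal (fp s) * ennreal (tail_mass CARD('n) p R s) = 0"
      by (subst (asm) nn_integral_0_iff_AE) auto
    then have "AE s in lborel. ennreal (fp s) = 0"
    proof eventually_elim
      case (elim s)
      then show ?case
        using weight_outside[OF weights(1), of s] tail_mass_pos[OF zero_less_card_finite[where 'a = 'n] p_pos R_pos, of s]
        by (cases "s \<in> {0<..<1}") (auto simp: ennreal_eq_0_iff)
    qed
    then have "(\<integral>\<^sup>+s. ennreal (fp s) \<partial>lborel) = 0" by (subst nn_integral_0_iff_AE) auto
    then show False using f_pos by simp
  qed
  then show ?thesis using mass_nonneg[of "CARD('n)" p R fp] by simp
qed

lemma tau_bounds: "3 / 4 * mass CARD('n) p R fp \<le> \<tau>" "\<tau> \<le> mass CARD('n) p R fp" "\<tau> > 0"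
  using tails mp_pos mass_nonneg[of "CARD('n)" p R fm] by (auto simp: \<tau>_def)

lemma K_measurable [measurable]: "Kp \<in> borel_measurable borel" "Km \<in> borel_measurable borel"
  using Ker_measurable[OF p_pos] weights by auto

lemma kappa_measurable [measurable]: "\<kappa> \<in> borel_measurable borel"
  unfolding \<kappa>_def by measurable

lemma kappa_bounds: "3 / 4 * Kp z \<le> \<kappa> z" "\<kappa> z \<le> Kp z"
proof -
  \<comment> \<open>\<open>near\<close> says nothing about z = 0, where both kernels are 0 by
    division by zero.\<close>
  have n: "Km z \<le> Kp z / 4" if "norm z < 2 * R"
    using near[of z] that by (cases "z = 0") (auto simp: Ker_def kern_def)
  have t: "3 / 4 \<le> \<tau> / mass CARD('n) p R fp" "\<tau> / mass CARD('n) p R fp \<le> 1" using tau_bounds mp_pos by (auto simp: field_simps)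
  have "3 / 4 * Kp z \<le> \<tau> / mass CARD('n) p R fp * Kp z" "\<tau> / mass CARD('n) p R fp * Kp z \<le> 1 * Kp z"
    by (intro mult_right_mono t Ker_nonneg)+
  then show "3 / 4 * Kp z \<le> \<kappa> z" "\<kappa> z \<le> Kp z"
    using n Ker_nonneg[of p fm z] by (auto simp: \<kappa>_def)
qed

lemma kappa_nonneg: "0 \<le> \<kappa> z"
  using kappa_bounds(1)[of z] Ker_nonneg[of p fp z] by linarith

lemma kappa_pair_measurable [measurable]: "(\<lambda>z. \<kappa> (fst z - snd z)) \<in> borel_measurable borel"
  using measurable_compose[OF borel_measurable_minus_pair kappa_measurable] .

lemma K_pair_measurable [measurable]:
  "(\<lambda>z. Kp (fst z - snd z)) \<in> borel_measurable borel" "(\<lambda>z. Km (fst z - snd z)) \<in> borel_measurable borel"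
  using measurable_compose[OF borel_measurable_minus_pair K_measurable(1)]
    measurable_compose[OF borel_measurable_minus_pair K_measurable(2)] .

text \<open>Two points of \<Omega> are less than 2R apart, so all y at distance at least 2R from x
  in \<Omega> lie outside \<Omega>; \<open>\<kappa>\<close> is scaled to have mass exactly
  \<open>\<tau>\<close> there.\<close>

sublocale nonlocal_form \<Omega> "\<lambda>z. \<kappa> (fst z - snd z)" p \<tau>
proof
  show "\<Omega> \<in> sets borel" using Omega_open by simp
  have "emeasure lborel \<Omega> \<le> emeasure lborel (ball (0 :: real ^ 'n) R)"
    using Omega_ball by (intro emeasure_mono) auto
  also have "\<dots> < \<infinity>" using R_pos by (simp add: emeasure_ball)
  finally show "emeasure lborel \<Omega> < \<infinity>" .
  fix x assume x: "x \<in> \<Omega>"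
  have "ennreal \<tau> = ennreal (\<tau> / mass CARD('n) p R fp) * ennreal (mass CARD('n) p R fp)"
    using mp_pos tau_bounds by (subst ennreal_mult[symmetric]) auto
  also have "ennreal (mass CARD('n) p R fp) = (\<integral>\<^sup>+z. ennreal (indicator {2 * R..} (norm (z :: real ^ 'n)) * Kp z) \<partial>lborel)"
    by (rule nn_integral_Ker_tail[OF p_pos weights(1) R_pos, symmetric])
  also have "\<dots> = (\<integral>\<^sup>+y. ennreal (indicator {2 * R..} (norm (x - y)) * Kp (x - y)) \<partial>lborel)"
    by (rule nn_integral_reflect[symmetric]) measurable
  also have "ennreal (\<tau> / mass CARD('n) p R fp) * \<dots> = (\<integral>\<^sup>+y. ennreal (\<tau> / mass CARD('n) p R fp) * ennreal (indicator {2 * R..} (norm (x - y)) * Kp (x - y)) \<partial>lborel)"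
    by (rule nn_integral_cmult[symmetric]) measurable
  also have "\<dots> \<le> (\<integral>\<^sup>+y. ennreal (\<kappa> (fst (x, y) - snd (x, y))) * indicator (- \<Omega>) y \<partial>lborel)"
  proof (rule nn_integral_mono)
    fix y
    show "ennreal (\<tau> / mass CARD('n) p R fp) * ennreal (indicator {2 * R..} (norm (x - y)) * Kp (x - y))
        \<le> ennreal (\<kappa> (fst (x, y) - snd (x, y))) * indicator (- \<Omega>) y"
    proof (cases "2 * R \<le> norm (x - y)")
      case True
      have "y \<notin> \<Omega>"
      proof
        assume "y \<in> \<Omega>"
        then have "norm x < R" "norm y < R" using x Omega_ball by auto
        then show False using True norm_triangle_ineq4[of x y] by linarith
      qed
      then show ?thesis
        using True mp_pos tau_bounds by (simp add: \<kappa>_def Ker_nonneg flip: ennreal_mult)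
    qed simp
  qed
  finally show "ennreal \<tau> \<le> (\<integral>\<^sup>+y. ennreal (\<kappa> (fst (x, y) - snd (x, y))) * indicator (- \<Omega>) y \<partial>lborel)" .
qed (use p_ge tau_bounds kappa_nonneg in auto)

text \<open>\<open>\<kappa>\<close> lies between 3/4 of \<open>Kp\<close> and \<open>Kp\<close>, so
  finite energy means the same for both. The norm of the solution space involves the positive part
  of f only, that is, the energy of \<open>Kp\<close>.\<close>

lemma V_iff:
  "u \<in> V \<longleftrightarrow> u \<in> borel_measurable borel \<and> (\<forall>x. x \<notin> \<Omega> \<longrightarrow> u x = 0) \<and>
    energy p Kp u < \<infinity>"
proof (cases "u \<in> borel_measurable borel")
  case True
  note [measurable] = this
  let ?K = "energy p Kp u"
  let ?k = "energy p \<kappa> u"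
  have "integrable \<nu> (\<lambda>z. \<bar>incr u z\<bar> powr p) \<longleftrightarrow> (\<integral>\<^sup>+z. ennreal (\<bar>incr u z\<bar> powr p) \<partial>\<nu>) < \<infinity>"
    by (simp add: integrable_iff_bounded)
  also have "(\<integral>\<^sup>+z. ennreal (\<bar>incr u z\<bar> powr p) \<partial>\<nu>) = ?k"
    unfolding \<nu>_def by (rule nn_integral_density) measurable
  also have "?k < \<infinity> \<longleftrightarrow> ?K < \<infinity>"
  proof
    assume "?K < \<infinity>"
    moreover have "?k \<le> ?K"
      using kappa_bounds(2) by (intro nn_integral_mono mult_right_mono ennreal_leI) auto
    ultimately show "?k < \<infinity>" by (rule le_less_trans[rotated])
  next
    assume "?k < \<infinity>"
    have "?K \<le> (\<integral>\<^sup>+z. ennreal (4 / 3) * (ennreal (\<kappa> (fst z - snd z)) * ennreal (\<bar>incr u z\<bar> powr p)) \<partial>lborel)"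
    proof (rule nn_integral_mono)
      fix z
      have "Kp (fst z - snd z) \<le> 4 / 3 * \<kappa> (fst z - snd z)"
        using kappa_bounds(1)[of "fst z - snd z"] by simp
      then have "ennreal (Kp (fst z - snd z)) \<le> ennreal (4 / 3) * ennreal (\<kappa> (fst z - snd z))"
        using kappa_nonneg by (subst ennreal_mult[symmetric]) (auto intro: ennreal_leI)
      then show "ennreal (Kp (fst z - snd z)) * ennreal (\<bar>incr u z\<bar> powr p)
          \<le> ennreal (4 / 3) * (ennreal (\<kappa> (fst z - snd z)) * ennreal (\<bar>incr u z\<bar> powr p))"
        unfolding mult.assoc[symmetric] by (rule mult_right_mono) simp
    qed
    also have "\<dots> = ennreal (4 / 3) * ?k" by (rule nn_integral_cmult) measurable
    also have "\<dots> < \<infinity>" using \<open>?k < \<infinity>\<close> by (auto simp: ennreal_mult_less_top)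
    finally show "?K < \<infinity>" .
  qed
  finally show ?thesis by (auto simp: V_def)
qed (simp add: V_def)

lemma far_integrals:
  assumes u: "u \<in> V" and v: "v \<in> V" and \<phi>: "weight \<phi>"
  defines "g \<equiv> \<lambda>z :: real ^ 'n. indicator {2 * R..} (norm z) * Ker p \<phi> z"
  shows "integrable lborel (\<lambda>z. g (fst z - snd z) * (sgpow p (incr u z) * incr v z))"
    and "(LINT z|lborel. g (fst z - snd z) * (sgpow p (incr u z) * incr v z))
      = 2 * mass CARD('n) p R \<phi> * (LINT x|lborel. sgpow p (u x) * v x)"
proof -
  note [measurable] = Ker_measurable[OF p_pos \<phi>] V_measurable[OF u] V_measurable[OF v]
  have gm: "g \<in> borel_measurable borel" unfolding g_def by measurable
  have "norm (sgpow p (u x) * v x) \<le> norm (\<bar>u x\<bar> powr p + \<bar>v x\<bar> powr p)" for x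
    using abs_sgpow_mult_le[OF p_ge, of "u x" "v x"] by simp
  then have i: "integrable lborel (\<lambda>x. sgpow p (u x) * v x)"
    by (intro Bochner_Integration.integrable_bound[OF
        Bochner_Integration.integrable_add[OF coercive(1)[OF u] coercive(1)[OF v]]] AE_I2) measurable
  have \<tau>': "(\<integral>\<^sup>+x. ennreal (g x) \<partial>lborel) = ennreal (mass CARD('n) p R \<phi>)"
    unfolding g_def by (rule nn_integral_Ker_tail[OF p_pos \<phi> R_pos])
  have g: "0 \<le> g x" "g (- x) = g x" "norm x < 2 * R \<Longrightarrow> g x = 0" for x
    by (simp_all add: g_def Ker_nonneg Ker_minus)
  show "integrable lborel (\<lambda>z. g (fst z - snd z) * (sgpow p (incr u z) * incr v z))"
    and "(LINT z|lborel. g (fst z - snd z) * (sgpow p (incr u z) * incr v z))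
      = 2 * mass CARD('n) p R \<phi> * (LINT x|lborel. sgpow p (u x) * v x)"
    using far_interaction[OF gm g \<tau>' mass_nonneg Omega_ball p_ge V_measurable[OF u] V_measurable[OF v]
        V_outside[OF u] V_outside[OF v] i] by auto
qed

text \<open>At short range \<open>Km\<close> is below \<open>Kp\<close>. At long range it need not
  be, but there the energy decouples into a multiple of the integral of |u|^p, which coercivity
  bounds.\<close>

lemma Km_energy_finite:
  assumes u: "u \<in> V"
  shows "energy p Km u < \<infinity>"
proof -
  note [measurable] = V_measurable[OF u]
  let ?far = "\<lambda>z :: (real ^ 'n) \<times> (real ^ 'n). indicator {2 * R..} (norm (fst z - snd z)) * Km (fst z - snd z) * (sgpow p (incr u z) * incr u z)"
  have far: "integrable lborel ?far" using far_integrals(1)[OF u u weights(2)] .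
  have "energy p Km u \<le>
    (\<integral>\<^sup>+z. ennreal (Kp (fst z - snd z)) * ennreal (\<bar>incr u z\<bar> powr p) + ennreal (norm (?far z)) \<partial>lborel)"
  proof (rule nn_integral_mono)
    fix z :: "(real ^ 'n) \<times> (real ^ 'n)"
    show "ennreal (Km (fst z - snd z)) * ennreal (\<bar>incr u z\<bar> powr p)
        \<le> ennreal (Kp (fst z - snd z)) * ennreal (\<bar>incr u z\<bar> powr p) + ennreal (norm (?far z))"
    proof (cases "norm (fst z - snd z) < 2 * R")
      case True
      then have "\<kappa> (fst z - snd z) = Kp (fst z - snd z) - Km (fst z - snd z)" by (simp add: \<kappa>_def)
      then have "Km (fst z - snd z) \<le> Kp (fst z - snd z)" using kappa_nonneg[of "fst z - snd z"] by simp
      then show ?thesis by (intro add_increasing2 mult_right_mono ennreal_leI) auto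
    next
      case False
      then have "ennreal (norm (?far z)) = ennreal (Km (fst z - snd z)) * ennreal (\<bar>incr u z\<bar> powr p)"
        by (simp add: sgpow_mult_self[OF p_ge] abs_mult ennreal_mult Ker_nonneg)
      then show ?thesis by (simp add: add_increasing)
    qed
  qed
  also have "\<dots> = energy p Kp u + (\<integral>\<^sup>+z. ennreal (norm (?far z)) \<partial>lborel)"
    using borel_measurable_integrable[OF far] by (intro nn_integral_add) measurable
  also have "\<dots> < \<infinity>" using far u by (auto simp: V_iff integrable_iff_bounded)
  finally show ?thesis .
qed

lemmas slice_plus = form_slice[OF p_ge weights(1)] and slice_minus = form_slice[OF p_ge weights(2)]

text \<open>\<open>\<kappa>\<close> and \<open>Kp - Km\<close> differ only beyond distance 2R, and
  the difference has total mass \<open>\<tau>\<close> minus the mass of \<open>Kp\<close> plus that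
  of \<open>Km\<close>, which is 0. As the form sees nothing but the mass there, the two forms
  agree.\<close>

lemma form_eq:
  assumes u: "u \<in> V" and v: "v \<in> V"
  shows "(LINT s|lborel. fp s * frac_form s p u v) - (LINT s|lborel. fm s * frac_form s p u v)
    = (LINT z|\<nu>. sgpow p (incr u z) * incr v z)"
proof -
  note [measurable] = V_measurable[OF u] V_measurable[OF v]
  let ?\<Phi> = "\<lambda>z. sgpow p (incr u z) * incr v z"
  let ?g = "\<lambda>\<phi> z. indicator {2 * R..} (norm (fst z - snd z :: real ^ 'n)) * Ker p \<phi> (fst z - snd z)"
  have pf: "energy p Kp w < \<infinity>" if "w \<in> V" for w
    using that by (simp add: V_iff)
  note P = slice_plus[OF V_measurable[OF u] V_measurable[OF v] pf[OF u] pf[OF v]]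
  note M = slice_minus[OF V_measurable[OF u] V_measurable[OF v] Km_energy_finite[OF u] Km_energy_finite[OF v]]
  note FP = far_integrals[OF u v weights(1)] and FM = far_integrals[OF u v weights(2)]
  have "\<kappa> (fst z - snd z) * ?\<Phi> z = Kp (fst z - snd z) * ?\<Phi> z - Km (fst z - snd z) * ?\<Phi> z
      + ((\<tau> / mass CARD('n) p R fp - 1) * (?g fp z * ?\<Phi> z) + ?g fm z * ?\<Phi> z)" for z
    by (simp add: \<kappa>_def indicator_def algebra_simps)
  moreover have "(LINT z|\<nu>. ?\<Phi> z) = (LINT z|lborel. \<kappa> (fst z - snd z) * ?\<Phi> z)"
    unfolding \<nu>_def by (subst integral_density) (simp_all add: kappa_nonneg)
  ultimately have "(LINT z|\<nu>. ?\<Phi> z) = (LINT z|lborel. Kp (fst z - snd z) * ?\<Phi> z - Km (fst z - snd z) * ?\<Phi> z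
      + ((\<tau> / mass CARD('n) p R fp - 1) * (?g fp z * ?\<Phi> z) + ?g fm z * ?\<Phi> z))"
    by simp
  also have "\<dots> = (LINT z|lborel. Kp (fst z - snd z) * ?\<Phi> z) - (LINT z|lborel. Km (fst z - snd z) * ?\<Phi> z)
      + ((\<tau> / mass CARD('n) p R fp - 1) * (LINT z|lborel. ?g fp z * ?\<Phi> z) + (LINT z|lborel. ?g fm z * ?\<Phi> z))"
    using P(3) M(3) FP(1) FM(1)
    by (simp only: Bochner_Integration.integral_add Bochner_Integration.integral_diff integral_mult_right_zero
        Bochner_Integration.integrable_add Bochner_Integration.integrable_diff integrable_mult_right)
  also have "(\<tau> / mass CARD('n) p R fp - 1) * (LINT z|lborel. ?g fp z * ?\<Phi> z) + (LINT z|lborel. ?g fm z * ?\<Phi> z)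
      = 2 * ((\<tau> / mass CARD('n) p R fp - 1) * mass CARD('n) p R fp + mass CARD('n) p R fm) * (LINT x|lborel. sgpow p (u x) * v x)"
    unfolding FP(2) FM(2) by (simp add: algebra_simps)
  also have "(\<tau> / mass CARD('n) p R fp - 1) * mass CARD('n) p R fp + mass CARD('n) p R fm = 0" using mp_pos by (simp add: \<tau>_def field_simps)
  finally show ?thesis using P(4) M(4) by simp
qed

section \<open>A nontrivial function of finite energy\<close>

definition bump :: "real ^ 'n \<Rightarrow> real" where
  "bump x = min 1 (infdist x (- \<Omega>))"

lemma compl_nonempty: "- \<Omega> \<noteq> {}"
proof
  assume "- \<Omega> = {}"
  then have "\<Omega> = UNIV" by auto
  then show False using Omega_ball bounded_ball bounded_subset not_bounded_UNIV by metis
qed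

lemma bump_bounds: "0 \<le> bump x" "bump x \<le> 1"
  by (simp_all add: bump_def infdist_nonneg)

lemma bump_outside: "x \<notin> \<Omega> \<Longrightarrow> bump x = 0"
  by (simp add: bump_def)

lemma bump_pos: "x \<in> \<Omega> \<Longrightarrow> bump x > 0"
  using in_closed_iff_infdist_zero[of "- \<Omega>" x] Omega_open compl_nonempty infdist_nonneg[of x "- \<Omega>"]
  by (auto simp: bump_def open_closed less_le)

lemma bump_measurable [measurable]: "bump \<in> borel_measurable borel"
  unfolding bump_def by (intro borel_measurable_continuous_onI continuous_intros) 

text \<open>The truncated distance to the complement is 1-Lipschitz with values in [0,1]. The
  minimum tames the singularity on the diagonal, and the indicators record that at least one point
  must lie in \<Omega>.\<close>

lemma incr_bump_le: "\<bar>incr bump z\<bar> \<le> min 1 (norm (fst z - snd z)) * (indicator \<Omega> (fst z) + indicator \<Omega> (snd z))"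
proof -
  have 1: "\<bar>incr bump z\<bar> \<le> 1"
    using bump_bounds[of "fst z"] bump_bounds[of "snd z"] by (auto simp: incr_def)
  have "\<bar>infdist (fst z) (- \<Omega>) - infdist (snd z) (- \<Omega>)\<bar> \<le> norm (fst z - snd z)"
    using infdist_triangle_abs[of "fst z" "- \<Omega>" "snd z"] by (simp add: dist_norm)
  then have 2: "\<bar>incr bump z\<bar> \<le> norm (fst z - snd z)"
    by (auto simp: incr_def bump_def)
  show ?thesis
  proof (cases "fst z \<in> \<Omega> \<or> snd z \<in> \<Omega>")
    case True
    then have "1 \<le> indicat_real \<Omega> (fst z) + indicat_real \<Omega> (snd z)" by (auto simp: indicator_def)
    then have "min 1 (norm (fst z - snd z)) * 1 \<le> min 1 (norm (fst z - snd z)) * (indicat_real \<Omega> (fst z) + indicat_real \<Omega> (snd z))"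
      by (intro mult_left_mono) auto
    then show ?thesis using 1 2 by linarith
  qed (simp add: incr_def bump_outside)
qed

text \<open>The bound is uniform in s, as needed for a weight that is merely integrable: s (1 - s)
  times 1 / (p (1 - s)) + 1 / (s p) equals 1 / p.\<close>

lemma bump_slice:
  assumes s: "s \<in> {0<..<1}" and A: "A > 0" "frac_weight CARD('n) p s \<le> A * (s * (1 - s))"
  shows "energy p (kern p s) bump
    \<le> ennreal (2 powr p * A * (CARD('n) * unit_ball_vol CARD('n)) / p) * (2 * emeasure lborel \<Omega>)"
proof -
  let ?N = "real CARD('n)" and ?c = "CARD('n) * unit_ball_vol CARD('n)"
  let ?fw = "frac_weight CARD('n) p s"
  define q where "q z = ennreal (min 1 (norm z powr p) / norm z powr (?N + s * p))" for z :: "real ^ 'n"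
  have qm [measurable]: "q \<in> borel_measurable borel" unfolding q_def by measurable
  have q: "(\<integral>\<^sup>+z. q z \<partial>lborel) \<le> ennreal (?c * (1 / (p * (1 - s)) + 1 / (s * p)))"
  proof -
    have "s * p + p * (1 - s) = p" by (simp add: algebra_simps)
    then show ?thesis
      using nn_integral_norm_powr_bound[where 'a = "real ^ 'n", of "s * p" "p * (1 - s)"] s p_pos
      by (simp add: q_def)
  qed
  have le: "ennreal (kern p s (fst z - snd z)) * ennreal (\<bar>incr bump z\<bar> powr p)
    \<le> ennreal (2 powr p * ?fw) * (q (fst z - snd z) * indicator \<Omega> (fst z) + q (fst z - snd z) * indicator \<Omega> (snd z))" for z
  proof (cases "fst z \<in> \<Omega> \<or> snd z \<in> \<Omega>")
    case True
    let ?r = "norm (fst z - snd z)" and ?i = "indicat_real \<Omega> (fst z) + indicat_real \<Omega> (snd z)"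
    have i: "1 \<le> ?i" "?i \<le> 2" using True by (auto simp: indicator_def)
    have "\<bar>incr bump z\<bar> powr p \<le> (min 1 ?r * 2) powr p"
    proof (rule powr_mono2)
      show "\<bar>incr bump z\<bar> \<le> min 1 ?r * 2"
        using incr_bump_le[of z] mult_left_mono[OF i(2), of "min 1 ?r"] by simp
    qed (use p_pos in auto)
    also have "\<dots> = 2 powr p * min 1 ?r powr p" by (simp add: powr_mult mult.commute)
    also have "min 1 ?r powr p = min 1 (?r powr p)"
      using p_pos powr_le1[of p ?r] ge_one_powr_ge_zero[of ?r p] by (cases "?r \<le> 1") (auto simp: min_def)
    finally have b: "\<bar>incr bump z\<bar> powr p \<le> 2 powr p * min 1 (?r powr p)" .
    have "kern p s (fst z - snd z) * \<bar>incr bump z\<bar> powr p \<le> kern p s (fst z - snd z) * (2 powr p * min 1 (?r powr p))"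
      by (intro mult_left_mono b kern_nonneg p_pos)
    also have "\<dots> = 2 powr p * ?fw * (min 1 (?r powr p) / ?r powr (?N + s * p))"
      by (simp add: kern_def)
    finally have "ennreal (kern p s (fst z - snd z) * \<bar>incr bump z\<bar> powr p)
      \<le> ennreal (2 powr p * ?fw * (min 1 (?r powr p) / ?r powr (?N + s * p)))" by (rule ennreal_leI)
    also have "\<dots> = ennreal (2 powr p * ?fw) * q (fst z - snd z)"
      unfolding q_def using frac_weight_nonneg[of "CARD('n)" p s] p_pos by (intro ennreal_mult) auto
    also have "ennreal (kern p s (fst z - snd z) * \<bar>incr bump z\<bar> powr p)
      = ennreal (kern p s (fst z - snd z)) * ennreal (\<bar>incr bump z\<bar> powr p)"
      using kern_nonneg[OF p_pos] by (intro ennreal_mult) auto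
    finally have 1: "ennreal (kern p s (fst z - snd z)) * ennreal (\<bar>incr bump z\<bar> powr p) \<le> ennreal (2 powr p * ?fw) * q (fst z - snd z)" .
    also have "\<dots> \<le> ennreal (2 powr p * ?fw) * (q (fst z - snd z) * indicator \<Omega> (fst z) + q (fst z - snd z) * indicator \<Omega> (snd z))"
      using True by (intro mult_left_mono) (auto simp: indicator_def)
    finally show ?thesis .
  qed (simp add: incr_def bump_outside)
  have "energy p (kern p s) bump
    \<le> (\<integral>\<^sup>+z. ennreal (2 powr p * ?fw) * (q (fst z - snd z) * indicator \<Omega> (fst z) + q (fst z - snd z) * indicator \<Omega> (snd z)) \<partial>lborel)"
    by (intro nn_integral_mono le)
  also have "\<dots> = ennreal (2 powr p * ?fw) * ((\<integral>\<^sup>+z. q z \<partial>lborel) * (2 * emeasure lborel \<Omega>))"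
  proof -
    have [measurable]: "(\<lambda>z. q (fst z - snd z)) \<in> borel_measurable borel"
      using measurable_compose[OF borel_measurable_minus_pair qm] .
    have ind: "(\<lambda>x. indicator \<Omega> x :: ennreal) \<in> borel_measurable borel" by measurable
    have "(\<integral>\<^sup>+z. q (fst z - snd z) * indicator \<Omega> (fst z) + q (fst z - snd z) * indicator \<Omega> (snd z) \<partial>lborel)
      = (\<integral>\<^sup>+z. q (fst z - snd z) * indicator \<Omega> (fst z) \<partial>lborel) + (\<integral>\<^sup>+z. q (fst z - snd z) * indicator \<Omega> (snd z) \<partial>lborel)"
      by (rule nn_integral_add) measurable
    also have "\<dots> = (\<integral>\<^sup>+z. q z \<partial>lborel) * (2 * emeasure lborel \<Omega>)"
      unfolding nn_convolution[OF qm ind] by (simp add: mult_2 distrib_left)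
    finally show ?thesis by (subst nn_integral_cmult) auto
  qed
  also have "\<dots> = ennreal (2 powr p * ?fw) * (\<integral>\<^sup>+z. q z \<partial>lborel) * (2 * emeasure lborel \<Omega>)"
    by (simp add: mult.assoc)
  also have "\<dots> \<le> ennreal (2 powr p * ?fw) * ennreal (?c * (1 / (p * (1 - s)) + 1 / (s * p))) * (2 * emeasure lborel \<Omega>)"
    by (intro mult_right_mono mult_left_mono q) auto
  also have "ennreal (2 powr p * ?fw) * ennreal (?c * (1 / (p * (1 - s)) + 1 / (s * p)))
      = ennreal (2 powr p * ?fw * (?c * (1 / (p * (1 - s)) + 1 / (s * p))))"
    using frac_weight_nonneg[of "CARD('n)" p s] p_pos s by (intro ennreal_mult[symmetric]) auto
  also have "\<dots> * (2 * emeasure lborel \<Omega>) \<le> ennreal (2 powr p * A * ?c / p) * (2 * emeasure lborel \<Omega>)"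
  proof (intro mult_right_mono ennreal_leI)
    have "2 powr p * ?fw * (?c * (1 / (p * (1 - s)) + 1 / (s * p)))
      \<le> 2 powr p * (A * (s * (1 - s))) * (?c * (1 / (p * (1 - s)) + 1 / (s * p)))"
      using A s p_pos by (intro mult_right_mono mult_left_mono) auto
    also have "\<dots> = 2 powr p * A * ?c / p"
      using s p_pos by (simp add: field_simps)
    finally show "2 powr p * ?fw * (?c * (1 / (p * (1 - s)) + 1 / (s * p))) \<le> 2 powr p * A * ?c / p" .
  qed auto
  finally show ?thesis .
qed

lemma bump_in_V: "bump \<in> V"
proof -
  obtain A where A: "A > 0" "\<And>s. s \<in> {0<..<1} \<Longrightarrow> frac_weight CARD('n) p s \<le> A * (s * (1 - s))"
      "\<And>s. frac_weight CARD('n) p s \<le> A"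
    by (rule frac_weight_le[OF zero_less_card_finite[where 'a = 'n] p_pos]) blast
  let ?B = "ennreal (2 powr p * A * (CARD('n) * unit_ball_vol CARD('n)) / p) * (2 * emeasure lborel \<Omega>)"
  have "?B < top" using Omega_finite by (auto simp: ennreal_mult_less_top)
  then have B: "ennreal (enn2real ?B) = ?B" by simp
  have "energy p Kp bump
    = (\<integral>\<^sup>+s. ennreal (fp s) * energy p (kern p s) bump \<partial>lborel)"
    by (rule Ker_swap[OF p_pos weights(1) sigma_finite_lborel]) measurable
  also have "\<dots> < \<infinity>"
    using bump_slice[OF _ A(1) A(2)] B by (intro weight_mult_bounded(2)[OF weights(1), of _ "enn2real ?B"]) auto
  finally show ?thesis by (simp add: V_iff bump_outside)
qed

lemma not_AE_bump_0: "\<not> (AE x in lborel. bump x = 0)"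
proof
  assume ae: "AE x in lborel. bump x = 0"
  obtain x e where e: "e > 0" "ball x e \<subseteq> \<Omega>"
    using Omega_open Omega_nonempty by (meson all_not_in_conv open_contains_ball)
  have "AE y in lborel. y \<notin> ball x e"
    using ae by eventually_elim (use e(2) bump_pos in force)
  then have "emeasure lborel (ball x e) = 0"
    by (subst (asm) AE_iff_measurable[where N = "ball x e"]) auto
  then show False using e(1) unit_ball_vol_pos[of "CARD('n)"] by (simp add: emeasure_ball)
qed

end

section \<open>Weak solutions\<close>

lemma borel_measurable_completion_AE:
  assumes [measurable]: "h \<in> borel_measurable M" and "AE x in M. g x = h x"
  shows "g \<in> borel_measurable (completion M)"
proof (rule measurableI)
  obtain N where N: "N \<in> null_sets M" "{x \<in> space M. g x \<noteq> h x} \<subseteq> N"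
    using assms(2) by (auto elim!: AE_E simp: null_sets_def)
  fix A :: "'b set" assume A: "A \<in> sets borel"
  have "g -` A \<inter> space M \<inter> N \<in> sets (completion M)"
    by (rule sets_completionI_sub[OF N(1)]) auto
  moreover have "h -` A \<inter> space M - N \<in> sets (completion M)"
    using A N(1) by (intro sets_completionI_sets sets.Diff measurable_sets[OF assms(1)]) (auto simp: null_sets_def)
  moreover have "g -` A \<inter> space (completion M) = (h -` A \<inter> space M - N) \<union> (g -` A \<inter> space M \<inter> N)"
    using N(2) by auto
  ultimately show "g -` A \<inter> space (completion M) \<in> sets (completion M)" by (metis sets.Un)
qed simp

lemma integrable_completion_AE:
  fixes g h :: "'a \<Rightarrow> real"
  assumes "integrable M h" "AE x in M. g x = h x"
  shows "integrable (completion M) g" "integral\<^sup>L (completion M) g = integral\<^sup>L M h"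
proof -
  have h: "h \<in> borel_measurable M" using assms(1) by simp
  have m: "g \<in> borel_measurable (completion M)" "h \<in> borel_measurable (completion M)"
    using borel_measurable_completion_AE[OF h assms(2)] measurable_completion[OF h] by auto
  have ae: "AE x in completion M. g x = h x" using assms(2) by (rule AE_completion)
  show "integrable (completion M) g"
    using integrable_cong_AE[OF m ae] integrable_completion[OF h] assms(1) by simp
  show "integral\<^sup>L (completion M) g = integral\<^sup>L M h"
    using integral_cong_AE[OF m ae] integral_completion[OF h] by simp
qed

lemma ennpowr_less_top_iff: "ennpowr x a < top \<longleftrightarrow> x < top"
  by (auto simp: ennpowr_def less_top)

lemma ennpowr_ennpowr_inverse:
  assumes "p > 0" shows "ennpowr (ennpowr x (1 / p)) p = x"
  using assms by (simp add: ennpowr_def powr_powr ennreal_enn2real_if)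

context superposition begin

text \<open>The roots and powers in the definition of the norm undo each other, and Tonelli turns
  the rest into the energy of \<open>Kp\<close>. Both f and u are replaced by Borel versions that
  agree almost everywhere.\<close>

lemma X_norm_finite_iff:
  assumes f: "AE s in lborel. indicator {0<..<1} s * max (f s) 0 = fp s"
    and m [measurable]: "w \<in> borel_measurable borel" and ae: "AE x in lborel. u x = w x"
  shows "X_norm f p u < top \<longleftrightarrow>
    energy p Kp w < \<infinity>"
proof -
  let ?q = "\<lambda>u s z. ennreal (\<bar>incr u z\<bar> powr p / norm (fst z - snd z :: real ^ 'n) powr (real CARD('n) + s * p))"
  have "X_norm f p u < top \<longleftrightarrow>
    (\<integral>\<^sup>+s. ennreal (max (f s) 0) * (ennreal (frac_const CARD('n) p s) * (\<integral>\<^sup>+z. ?q u s z \<partial>lborel)) * indicator {0<..<1} s \<partial>lborel) < top"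
    by (simp add: X_norm_def ennpowr_less_top_iff nn_integral_completion frac_seminorm_def
        ennpowr_ennpowr_inverse[OF p_pos] case_prod_unfold incr_def)
  also have "(\<integral>\<^sup>+s. ennreal (max (f s) 0) * (ennreal (frac_const CARD('n) p s) * (\<integral>\<^sup>+z. ?q u s z \<partial>lborel)) * indicator {0<..<1} s \<partial>lborel)
    = (\<integral>\<^sup>+s. ennreal (fp s) * energy p (kern p s) w \<partial>lborel)"
  proof (rule nn_integral_cong_AE)
    show "AE s in lborel. ennreal (max (f s) 0) * (ennreal (frac_const CARD('n) p s) * (\<integral>\<^sup>+z. ?q u s z \<partial>lborel)) * indicator {0<..<1} s
      = ennreal (fp s) * energy p (kern p s) w"
      using f
    proof eventually_elim
      case (elim s)
      show ?case
      proof (cases "s \<in> {0<..<1}")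
        case True
        have c: "0 \<le> frac_const CARD('n) p s"
          using frac_const_pos[OF zero_less_card_finite[where 'a = 'n] p_pos True] by simp
        have "(\<integral>\<^sup>+z. ?q u s z \<partial>lborel) = (\<integral>\<^sup>+z. ?q w s z \<partial>lborel)"
          using AE_lborel_pair[OF ae] by (intro nn_integral_cong_AE) (auto simp: incr_def elim: eventually_mono)
        also have "ennreal (frac_const CARD('n) p s) * \<dots> = (\<integral>\<^sup>+z. ennreal (frac_const CARD('n) p s) * ?q w s z \<partial>lborel)"
          by (rule nn_integral_cmult[symmetric]) measurable
        also have "\<dots> = energy p (kern p s) w"
          using True c by (intro nn_integral_cong) (simp add: kern_def frac_weight_def mult.commute flip: ennreal_mult)
        finally show ?thesis using True elim by simp
      qed (simp add: weight_outside[OF weights(1)])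
    qed
  qed
  also have "\<dots> = energy p Kp w"
    by (rule Ker_swap[OF p_pos weights(1) sigma_finite_lborel, symmetric]) measurable
  finally show ?thesis by simp
qed

text \<open>A Borel version of v may be nonzero on a null set off \<Omega>; multiplying it by the
  indicator of \<Omega> restores vanishing at every such point.\<close>

lemma X_space_representative:
  assumes f: "AE s in lborel. indicator {0<..<1} s * max (f s) 0 = fp s" and v: "v \<in> X_space f p \<Omega>"
  obtains w where "w \<in> V" "AE x in lborel. v x = w x"
proof -
  obtain v0 where v0: "v0 \<in> borel_measurable lborel" "AE x in lborel. v x = v0 x"
    using v completion_ex_borel_measurable_real[of v lborel] by (auto simp: X_space_def)
  note [measurable] = v0(1)
  define w where "w x = v0 x * indicator \<Omega> x" for x
  have [measurable]: "\<Omega> \<in> sets borel" using Omega_open by simp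
  have wm: "w \<in> borel_measurable borel"
  proof -
    have "w \<in> borel_measurable lborel" unfolding w_def[abs_def] by measurable
    then show ?thesis by simp
  qed
  have ae: "AE x in lborel. v x = w x"
    using v0(2)
  proof eventually_elim
    case (elim x)
    then show ?case using v by (cases "x \<in> \<Omega>") (auto simp: w_def X_space_def)
  qed
  have "w x = 0" if "x \<notin> \<Omega>" for x using that by (simp add: w_def)
  then have "w \<in> V"
    using X_norm_finite_iff[OF f wm ae] v wm by (simp add: V_iff X_space_def)
  then show ?thesis using ae that by blast
qed

lemma V_subset_X_space:
  assumes f: "AE s in lborel. indicator {0<..<1} s * max (f s) 0 = fp s" and u: "u \<in> V"
  shows "u \<in> X_space f p \<Omega>"
proof -
  have "u \<in> borel_measurable lborel" using V_measurable[OF u] by simp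
  then have "u \<in> borel_measurable lebesgue" by (rule measurable_completion)
  moreover have "X_norm f p u < top"
    using X_norm_finite_iff[OF f V_measurable[OF u], of u] u by (simp add: V_iff)
  ultimately show ?thesis using V_outside[OF u] by (simp add: X_space_def)
qed

text \<open>Each clause is unaffected by changing the test function on a null set, so it may be
  taken in \<open>V\<close>. Then \<open>form_slice\<close> for \<open>fp\<close> and
  \<open>fm\<close> gives the integrability of the forms, and \<open>form_eq\<close> identifies the
  left-hand side.\<close>

lemma weak_solutionI:
  fixes g :: "real \<Rightarrow> real"
  assumes f: "AE s in lborel. indicator {0<..<1} s * max (f s) 0 = fp s"
      "AE s in lborel. indicator {0<..<1} s * f s = fp s - fm s"
    and u: "u \<in> V" and gm: "(\<lambda>x. g (u x)) \<in> borel_measurable borel" and gB: "\<And>x. \<bar>g (u x)\<bar> \<le> B"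
    and eq: "\<And>v. v \<in> V \<Longrightarrow> (LINT z|\<nu>. sgpow p (incr u z) * incr v z) = (LINT x|lborel. g (u x) * v x)"
  shows "weak_solution f p \<Omega> g u"
  unfolding weak_solution_def
proof (intro conjI ballI)
  show "u \<in> X_space f p \<Omega>" by (rule V_subset_X_space[OF f(1) u])
  fix v assume "v \<in> X_space f p \<Omega>"
  then obtain w where w: "w \<in> V" "AE x in lborel. v x = w x"
    by (rule X_space_representative[OF f(1)])
  have pf: "energy p Kp w < \<infinity>" if "w \<in> V" for w
    using that by (simp add: V_iff)
  note P = slice_plus[OF V_measurable[OF u] V_measurable[OF w(1)] pf[OF u] pf[OF w(1)]]
  note M = slice_minus[OF V_measurable[OF u] V_measurable[OF w(1)] Km_energy_finite[OF u] Km_energy_finite[OF w(1)]]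
  have vout: "v x = 0" if "x \<notin> \<Omega>" for x
    using \<open>v \<in> X_space f p \<Omega>\<close> that by (simp add: X_space_def)
  have fi: "AE z in lborel. frac_integrand s p u v z = frac_integrand s p u w z" for s
    using AE_lborel_pair[OF w(2)] by eventually_elim (simp add: frac_integrand_altdef incr_def)
  have ff: "frac_form s p u v = frac_form s p u w" for s
  proof -
    have m: "frac_integrand s p u w \<in> borel_measurable lborel"
      using V_measurable[OF u] V_measurable[OF w(1)] borel_measurable_sgpow[OF p_ge]
      unfolding frac_integrand_altdef[abs_def] by measurable
    have "integral\<^sup>L lebesgue (frac_integrand s p u v) = integral\<^sup>L lebesgue (frac_integrand s p u w)"
      using borel_measurable_completion_AE[OF m fi] measurable_completion[OF m] AE_completion[OF fi]
      by (intro integral_cong_AE) auto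
    then show ?thesis by (simp add: frac_form_def)
  qed
  have "AE s in lborel. s \<in> {0<..<1} \<and> f s \<noteq> 0 \<longrightarrow> integrable lebesgue (frac_integrand s p u v)"
    using f(2) P(1) M(1)
  proof eventually_elim
    case (elim s)
    show ?case
    proof
      assume s: "s \<in> {0<..<1} \<and> f s \<noteq> 0"
      then have "fp s \<noteq> 0 \<or> fm s \<noteq> 0" using elim(1) by auto
      then have "integrable lborel (frac_integrand s p u w)" using elim by blast
      then show "integrable lebesgue (frac_integrand s p u v)" by (rule integrable_completion_AE(1)[OF _ fi])
    qed
  qed
  then show "AE s in lebesgue. s \<in> {0<..<1} \<and> f s \<noteq> 0 \<longrightarrow> integrable lebesgue (frac_integrand s p u v)"
    by (rule AE_completion)
  have i: "integrable lborel (\<lambda>s. fp s * frac_form s p u w - fm s * frac_form s p u w)"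
    using P(2) M(2) by (rule Bochner_Integration.integrable_diff)
  have ae: "AE s in lborel. indicator {0<..<1} s *\<^sub>R (f s * frac_form s p u v)
      = fp s * frac_form s p u w - fm s * frac_form s p u w"
    using f(2)
  proof eventually_elim
    case (elim s)
    have "indicator {0<..<1} s *\<^sub>R (f s * frac_form s p u v) = (indicator {0<..<1} s * f s) * frac_form s p u w"
      by (simp add: ff)
    then show ?case unfolding elim by (simp add: left_diff_distrib)
  qed
  note I = integrable_completion_AE[OF i ae]
  show "set_integrable lebesgue {0<..<1} (\<lambda>s. f s * frac_form s p u v)"
    unfolding set_integrable_def by (rule I(1))
  have i2: "integrable lborel (\<lambda>x. g (u x) * w x)" by (rule V_integrable_mult[OF w(1) gm gB])
  have ae2: "AE x in lborel. indicator \<Omega> x *\<^sub>R (g (u x) * v x) = g (u x) * w x"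
    using w(2)
  proof eventually_elim
    case (elim x)
    then show ?case using vout[of x] by (cases "x \<in> \<Omega>") auto
  qed
  note I2 = integrable_completion_AE[OF i2 ae2]
  show "set_integrable lebesgue \<Omega> (\<lambda>x. g (u x) * v x)"
    unfolding set_integrable_def by (rule I2(1))
  have "(LINT s:{0<..<1}|lebesgue. f s * frac_form s p u v)
      = (LINT s|lborel. fp s * frac_form s p u w - fm s * frac_form s p u w)"
    unfolding set_lebesgue_integral_def by (rule I(2))
  also have "\<dots> = (LINT z|\<nu>. sgpow p (incr u z) * incr w z)"
    using form_eq[OF u w(1)] P(2) M(2) by simp
  also have "\<dots> = (LINT x|lborel. g (u x) * w x)" by (rule eq[OF w(1)])
  also have "\<dots> = (LINT x:\<Omega>|lebesgue. g (u x) * v x)"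
    unfolding set_lebesgue_integral_def by (rule I2(2)[symmetric])
  finally show "(LINT s:{0<..<1}|lebesgue. f s * frac_form s p u v) = (LINT x:\<Omega>|lebesgue. g (u x) * v x)" .
qed

text \<open>Since \<open>m < p\<close>, the term of order \<open>m\<close> beats the energy for small multiples of \<open>bump\<close>.\<close>

lemma small_bump:
  assumes "c > 0" "1 \<le> m" "m < p" "M > 0"
  obtains \<epsilon> where "0 < \<epsilon>" "\<epsilon> \<le> M"
    "E (\<lambda>x. \<epsilon> * bump x) / p < c * (LINT x|lborel. (\<epsilon> * bump x) powr m)"
proof -
  have bi: "integrable lborel (\<lambda>x. bump x powr m)"
  proof (rule integrable_of_bounded)
    show "\<bar>bump x powr m\<bar> \<le> 1" for x
      using powr_le1[of m "bump x"] bump_bounds[of x] assms by simp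
  qed (auto simp: bump_outside)
  define b where "b = (LINT x|lborel. bump x powr m)"
  have "b \<noteq> 0"
  proof
    assume "b = 0"
    then have "AE x in lborel. bump x powr m = 0"
      using bi unfolding b_def by (subst (asm) integral_nonneg_eq_0_iff_AE) auto
    then have "AE x in lborel. bump x = 0" by eventually_elim simp
    then show False using not_AE_bump_0 by simp
  qed
  moreover have "b \<ge> 0" unfolding b_def by (intro integral_nonneg_AE) auto
  ultimately have b: "b > 0" by simp
  \<comment> \<open>The threshold for \<epsilon>^(p-m) below which the energy loses; the added 1
    avoids a division by zero and makes the final inequality strict.\<close>
  define \<eta> where "\<eta> = c * b * p / (E bump + 1)"
  have \<eta>: "\<eta> > 0" unfolding \<eta>_def using assms b p_pos E_nonneg[of bump] by (intro divide_pos_pos mult_pos_pos) auto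
  define \<epsilon> where "\<epsilon> = min M (\<eta> powr (1 / (p - m)))"
  have \<epsilon>: "0 < \<epsilon>" "\<epsilon> \<le> M" using assms \<eta> by (auto simp: \<epsilon>_def)
  have "\<epsilon> powr (p - m) \<le> (\<eta> powr (1 / (p - m))) powr (p - m)"
    using \<epsilon> assms by (intro powr_mono2) (auto simp: \<epsilon>_def)
  also have "\<dots> = \<eta>" using assms \<eta> by (simp add: powr_powr)
  finally have "\<epsilon> powr (p - m) * E bump \<le> \<eta> * E bump" by (rule mult_right_mono) (rule E_nonneg)
  also have "\<dots> < c * b * p"
    using assms b p_pos E_nonneg[of bump] mult_pos_pos[of "c * b" p] by (simp add: \<eta>_def field_simps)
  finally have "\<epsilon> powr m * (\<epsilon> powr (p - m) * E bump) < \<epsilon> powr m * (c * b * p)"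
    using \<epsilon> by (intro mult_strict_left_mono) auto
  moreover have "\<epsilon> powr p = \<epsilon> powr m * \<epsilon> powr (p - m)"
    by (simp flip: powr_add)
  ultimately have "\<epsilon> powr p * E bump < c * (\<epsilon> powr m * b) * p"
    by (simp add: mult_ac)
  moreover have "E (\<lambda>x. \<epsilon> * bump x) = \<epsilon> powr p * E bump"
    using V_scale(2)[OF bump_in_V, of \<epsilon>] \<epsilon> by simp
  moreover have "(LINT x|lborel. (\<epsilon> * bump x) powr m) = \<epsilon> powr m * b"
    unfolding b_def by (simp add: powr_mult)
  ultimately have "E (\<lambda>x. \<epsilon> * bump x) / p < c * (LINT x|lborel. (\<epsilon> * bump x) powr m)"
    using p_pos by (simp add: field_simps)
  then show ?thesis using that \<epsilon> by blast
qed

end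

section \<open>The height M and the range of the parameter\<close>

lemma rpow_pos: "0 < a \<Longrightarrow> rpow a r = a powr r"
  by (simp add: rpow_def)

text \<open>Solutions are sought below a small constant M, so the highest exponent enters through p
  < P alone: near 0 the power t^(P-1) is small against t^(p-1).\<close>

theorem (in superposition) exists_weak_solutions:
  fixes f :: "real \<Rightarrow> real" and m q P :: real
  assumes f: "AE s in lborel. indicator {0<..<1} s * max (f s) 0 = fp s"
      "AE s in lborel. indicator {0<..<1} s * f s = fp s - fm s"
    and m: "1 \<le> m" "m < p" and q: "1 \<le> q" and P: "p < P"
  obtains \<Lambda> where "\<Lambda> > 0" "\<And>lam. 0 < lam \<Longrightarrow> lam < \<Lambda> \<Longrightarrow>
    \<exists>u. weak_solution f p \<Omega>
          (\<lambda>t. rpow \<bar>t\<bar> (P - 2) * t + lam * (rpow \<bar>t\<bar> (m - 1) + rpow \<bar>t\<bar> (q - 1))) u \<and>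
        (\<forall>x. u x \<ge> 0) \<and> \<not> (AE x in lebesgue. u x = 0)"
proof -
  have P2: "P \<ge> 2" and P0: "P > 0" using P p_ge by auto
  \<comment> \<open>Chosen such that the term of exponent P uses up exactly half of the admissible
    value \<open>\<tau>\<close> M^(p-1).\<close>
  define M where "M = (\<tau> / 2) powr (1 / (P - p))"
  have M: "M > 0" using tau_bounds by (simp add: M_def)
  have "M powr (P - p) = \<tau> / 2" using P tau_bounds by (simp add: M_def powr_powr)
  moreover have "M powr (P - 1) = M powr (P - p) * M powr (p - 1)" by (simp flip: powr_add)
  ultimately have MP: "M powr (P - 1) = \<tau> / 2 * M powr (p - 1)" by simp
  define d where "d = M powr (m - 1) + M powr (q - 1)"
  \<comment> \<open>For lam below this bound the two lower powers at M fit into the other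
    half.\<close>
  define \<Lambda> where "\<Lambda> = \<tau> / 2 * M powr (p - 1) / d"
  have d: "d > 0" using M by (simp add: d_def add_pos_pos)
  have \<Lambda>: "\<Lambda> > 0" unfolding \<Lambda>_def using d M tau_bounds by (intro divide_pos_pos mult_pos_pos) auto
  have "\<exists>u. weak_solution f p \<Omega>
          (\<lambda>t. rpow \<bar>t\<bar> (P - 2) * t + lam * (rpow \<bar>t\<bar> (m - 1) + rpow \<bar>t\<bar> (q - 1))) u \<and>
        (\<forall>x. u x \<ge> 0) \<and> \<not> (AE x in lebesgue. u x = 0)"
    if lam: "0 < lam" "lam < \<Lambda>" for lam
  proof -
    define g where "g t = sgpow P t + lam * (rpow \<bar>t\<bar> (m - 1) + rpow \<bar>t\<bar> (q - 1))" for t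
    define G where "G t = \<bar>t\<bar> powr P / P + lam * (\<bar>t\<bar> powr m / m + \<bar>t\<bar> powr q / q)" for t
    have gm: "g \<in> borel_measurable borel"
      using borel_measurable_sgpow[OF P2] unfolding g_def by measurable
    have Gm: "G \<in> borel_measurable borel" unfolding G_def by measurable
    have g_mono: "g s \<le> g t" if "0 \<le> s" "s \<le> t" for s t
    proof -
      have "sgpow P s \<le> sgpow P t"
        using that sgpow_strict_mono[OF P2, of s t] by (cases "s = t") auto
      then show ?thesis
        unfolding g_def using that lam m q by (intro add_mono mult_left_mono rpow_mono) auto
    qed
    have g0: "g 0 \<ge> 0" using lam by (simp add: g_def)
    have "lam * d \<le> \<Lambda> * d" using lam d by (intro mult_right_mono) auto
    also have "\<Lambda> * d = \<tau> / 2 * M powr (p - 1)" using d by (simp add: \<Lambda>_def)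
    finally have g_M: "g M \<le> \<tau> * M powr (p - 1)"
      using M MP by (simp add: g_def d_def sgpow_altdef[OF P2] rpow_pos)
    have g_lim: "(\<lambda>n. g (X n)) \<longlonglongrightarrow> g s" if "\<And>n::nat. X n \<ge> 0" "X \<longlonglongrightarrow> s" for X s
      unfolding g_def using that m q
      by (intro tendsto_intros tendsto_sgpow[OF P2] tendsto_rpow) auto
    have G_sub: "G s + g s * (t - s) \<le> G t" if "0 \<le> s" "0 \<le> t" for s t
    proof -
      have 1: "\<bar>s\<bar> powr P / P + sgpow P s * (t - s) \<le> \<bar>t\<bar> powr P / P"
        using divide_right_mono[OF sgpow_subgradient[OF P2, of s t], of P] P0 by (simp add: add_divide_distrib)
      have 2: "\<bar>s\<bar> powr r / r + rpow \<bar>s\<bar> (r - 1) * (t - s) \<le> \<bar>t\<bar> powr r / r" if "r \<ge> 1" for r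
        using divide_right_mono[OF powr_subgradient[of r s t], of r] \<open>0 \<le> s\<close> \<open>0 \<le> t\<close> that
        by (simp add: add_divide_distrib)
      have "lam * ((\<bar>s\<bar> powr m / m + rpow \<bar>s\<bar> (m - 1) * (t - s)) + (\<bar>s\<bar> powr q / q + rpow \<bar>s\<bar> (q - 1) * (t - s)))
          \<le> lam * (\<bar>t\<bar> powr m / m + \<bar>t\<bar> powr q / q)"
        using 2[OF m(1)] 2[OF q] lam by (intro mult_left_mono add_mono) auto
      then show ?thesis using 1 unfolding G_def g_def by (simp add: algebra_simps)
    qed
    have G0: "G 0 = 0" by (simp add: G_def)
    have c: "lam / m > 0" using lam m by simp
    obtain \<epsilon> where \<epsilon>: "0 < \<epsilon>" "\<epsilon> \<le> M"
      "E (\<lambda>x. \<epsilon> * bump x) / p < lam / m * (LINT x|lborel. (\<epsilon> * bump x) powr m)"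
      by (rule small_bump[OF c m M])
    define w0 where "w0 x = \<epsilon> * bump x" for x
    have w0V: "w0 \<in> V" unfolding w0_def by (rule V_scale(1)[OF bump_in_V])
    have w0: "0 \<le> w0 x" "w0 x \<le> M" for x
      using \<epsilon> bump_bounds[of x] mult_mono[of \<epsilon> M "bump x" 1] by (simp_all add: w0_def)
    have wout: "w0 x = 0" if "x \<notin> \<Omega>" for x using V_outside[OF w0V that] .
    note [measurable] = V_measurable[OF w0V] Gm
    have pi: "integrable lborel (\<lambda>x. w0 x powr m)"
    proof (rule integrable_of_bounded)
      show "\<bar>w0 x powr m\<bar> \<le> M powr m" for x
        using w0[of x] m by (auto intro!: powr_mono2)
    qed (auto simp: wout)
    have Gi: "integrable lborel (\<lambda>x. G (w0 x))"
    proof (rule integrable_of_bounded)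
      show "\<bar>G (w0 x)\<bar> \<le> G M" for x
      proof -
        have "G (w0 x) \<le> G M"
          unfolding G_def using w0[of x] lam m q P0
          by (intro add_mono mult_left_mono divide_right_mono powr_mono2) auto
        moreover have "G (w0 x) \<ge> 0" unfolding G_def using lam m q P0 by (intro add_nonneg_nonneg mult_nonneg_nonneg divide_nonneg_nonneg) auto
        ultimately show ?thesis by simp
      qed
    qed (auto simp: wout G0)
    have "lam / m * (LINT x|lborel. w0 x powr m) = (LINT x|lborel. lam / m * w0 x powr m)" by simp
    \<comment> \<open>The remaining powers in the primitive \<open>G\<close> are nonnegative, so the
      one of order m alone makes the functional negative.\<close>
    also have "\<dots> \<le> (LINT x|lborel. G (w0 x))"
    proof (intro integral_mono integrable_mult_right pi Gi)
      fix x
      have "0 \<le> \<bar>w0 x\<bar> powr P / P" "0 \<le> lam * (\<bar>w0 x\<bar> powr q / q)" using lam q P0 by auto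
      then show "lam / m * w0 x powr m \<le> G (w0 x)"
        using w0(1)[of x] by (simp add: G_def distrib_left)
    qed
    finally have neg: "E w0 / p - (LINT x|lborel. G (w0 x)) < 0"
      using \<epsilon>(3) unfolding w0_def[symmetric] by simp
    obtain u where u: "u \<in> V" "\<And>x. 0 \<le> u x \<and> u x \<le> M" "\<not> (AE x in lborel. u x = 0)"
      "\<And>v. v \<in> V \<Longrightarrow> (LINT z|\<nu>. sgpow p (incr u z) * incr v z) = (LINT x|lborel. g (u x) * v x)"
      using exists_solution[OF M gm Gm g_mono g0 g_M g_lim G_sub G0 w0V w0 neg] by blast
    have gB: "\<bar>g (u x)\<bar> \<le> g M" for x
      using g_mono[of 0 "u x"] g_mono[of "u x" M] g0 u(2)[of x] by auto
    have "weak_solution f p \<Omega> g u"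
      by (rule weak_solutionI[OF f u(1) measurable_compose[OF V_measurable[OF u(1)] gm] gB u(4)])
    moreover have "g = (\<lambda>t. rpow \<bar>t\<bar> (P - 2) * t + lam * (rpow \<bar>t\<bar> (m - 1) + rpow \<bar>t\<bar> (q - 1)))"
      by (simp add: g_def[abs_def] sgpow_def)
    ultimately show ?thesis using u(2,3) by (auto simp: AE_completion_iff)
  qed
  then show ?thesis using \<Lambda> that by blast
qed

section \<open>From the hypotheses on f to the two comparisons of kernels\<close>

theorem corollary8p14:
  fixes \<Omega> :: "(real ^ 'n) set"
    and f :: "real \<Rightarrow> real"
    and R s\<^sub>0 \<kappa> \<kappa>' \<delta> p m q :: real
  assumes "open \<Omega>" and "bounded \<Omega>" and "\<Omega> \<noteq> {}"
    and "R > 0" and "\<Omega> \<subseteq> ball 0 R"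
    and "s\<^sub>0 \<in> {0<..<1}" and "\<kappa> \<ge> 0"
    and "set_integrable lebesgue {0<..<1} f"
    and "\<not> (AE s in lebesgue. s \<in> {0<..<1} \<longrightarrow> f s = 0)"
    and "\<forall>s\<in>{s\<^sub>0<..<1}. f s \<ge> 0"
    and "(LINT s:{s\<^sub>0<..<1}|lebesgue. f s) > 0"
    and "(LINT s:{0<..<s\<^sub>0}|lebesgue. max 0 (- f s))
           \<le> \<kappa> * (LINT s:{s\<^sub>0<..<1}|lebesgue. f s)"
    and "\<delta> \<in> {0<..1 - s\<^sub>0}"
    and "0 < \<kappa>'"
    and "\<kappa>' < s\<^sub>0 * Gamma_lower CARD('n) p
               / (4 * Gamma_upper CARD('n) p * max 1 ((2 * R) powr p))"
    and "(LINT s:{0<..<s\<^sub>0}|lebesgue. max 0 (- f s))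
           \<le> \<kappa>' * \<delta> * (LINT s:{s\<^sub>0<..<1 - \<delta>}|lebesgue. f s)"
    and "real CARD('n) / s\<^sub>0 > p" and "p \<ge> 2"
    and "1 \<le> m" and "m < p" and "p \<le> q" and "q < crit_exp CARD('n) p s\<^sub>0"
  shows "\<exists>\<Lambda> :: real set. open \<Lambda> \<and> is_interval \<Lambda> \<and> \<Lambda> \<noteq> {} \<and> \<Lambda> \<subseteq> {0<..} \<and>
     (\<forall>lam\<in>\<Lambda>. \<exists>u :: real ^ 'n \<Rightarrow> real.
        weak_solution f p \<Omega>
          (\<lambda>t. rpow \<bar>t\<bar> (crit_exp CARD('n) p s\<^sub>0 - 2) * t
                + lam * (rpow \<bar>t\<bar> (m - 1) + rpow \<bar>t\<bar> (q - 1))) u \<and>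
        (\<forall>x. u x \<ge> 0) \<and>
        \<not> (AE x in lebesgue. u x = 0))"
proof -
  let ?N = "CARD('n)"
  have N: "?N > 0" by simp
  have p: "p \<ge> 2" "p > 0" using \<open>p \<ge> 2\<close> by auto
  have s0: "0 < s\<^sub>0" "s\<^sub>0 < 1" using \<open>s\<^sub>0 \<in> {0<..<1}\<close> by auto
  have \<delta>: "0 < \<delta>" using \<open>\<delta> \<in> {0<..1 - s\<^sub>0}\<close> by simp
  define \<mu> where "\<mu> = max 1 ((2 * R) powr p)"
  have \<mu>: "\<mu> > 0" by (simp add: \<mu>_def)
  have up: "Gamma_upper ?N p > 0"
    using Gamma_ratio_pos[of ?N p 0] Gamma_ratio_bounds(2)[of ?N p 0] N p by auto
  have \<kappa>': "\<kappa>' < s\<^sub>0 * Gamma_lower ?N p / (4 * Gamma_upper ?N p * \<mu>)"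
    using assms(15) by (simp add: \<mu>_def)
  have \<kappa>'_less: "\<kappa>' * (4 * Gamma_upper ?N p * \<mu>) < s\<^sub>0 * Gamma_lower ?N p"
    using \<kappa>' up \<mu> by (simp add: pos_less_divide_eq)
  moreover have "0 < \<kappa>' * (4 * Gamma_upper ?N p * \<mu>)"
    using \<open>0 < \<kappa>'\<close> up \<mu> by (intro mult_pos_pos) auto
  ultimately have "0 < s\<^sub>0 * Gamma_lower ?N p" by linarith
  \<comment> \<open>Positivity of the infimum is read off from the existence of a positive
    \<open>\<kappa>'\<close> below the prescribed bound.\<close>
  then have low: "Gamma_lower ?N p > 0"
    using s0 by (simp add: zero_less_mult_iff)
  \<comment> \<open>The constant of \<open>frac_const_comparison\<close> with \<rho> = 2R. The bound
    on \<open>\<kappa>'\<close> is exactly what makes \<open>\<kappa>' * \<delta> * B\<close> at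
    most 1 / 4.\<close>
  define B where "B = Gamma_upper ?N p * \<mu> / (Gamma_lower ?N p * s\<^sub>0 * \<delta>)"
  have B: "B > 0" unfolding B_def using up \<mu> low s0 \<delta> by (intro divide_pos_pos mult_pos_pos) auto
  have "\<kappa>' * \<delta> * B = \<kappa>' * (Gamma_upper ?N p * \<mu>) / (s\<^sub>0 * Gamma_lower ?N p)"
    using low s0 \<delta> by (simp add: B_def)
  also have "\<dots> \<le> 1 / 4"
    using \<kappa>'_less low s0 by (simp add: pos_divide_le_eq)
  finally have cB: "\<kappa>' * \<delta> * B \<le> 1 / 4" .
  let ?fI = "\<lambda>s. indicator {0<..<1} s *\<^sub>R f s"
  have fint: "integrable lebesgue ?fI" using assms(8) by (simp add: set_integrable_def)
  \<comment> \<open>f is only Lebesgue measurable, while the kernels are built from Borel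
    weights.\<close>
  then obtain f1 where f1: "f1 \<in> borel_measurable lborel" "AE s in lborel. ?fI s = f1 s"
    using completion_ex_borel_measurable_real[of ?fI lborel] by auto
  have f1m [measurable]: "f1 \<in> borel_measurable borel" using f1(1) by simp
  have f1i: "integrable lborel f1"
  proof -
    have "integrable lebesgue f1"
      by (rule integrable_cong_AE_imp[OF fint measurable_completion[OF f1(1)]])
         (use AE_completion[OF f1(2)] in \<open>auto simp: eq_commute\<close>)
    then show ?thesis using integrable_completion[OF f1(1)] by simp
  qed
  define fp where "fp s = indicator {0<..<1} s * max 0 (f1 s)" for s
  \<comment> \<open>Above \<open>s\<^sub>0\<close> there is no negative part, and at
    \<open>s\<^sub>0\<close> itself the sign of f is unrestricted; that single point is null and is
    left out of the pointwise identities.\<close>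
  define fm where "fm s = indicator {0<..<s\<^sub>0} s * max 0 (- f1 s)" for s
  have [measurable]: "fp \<in> borel_measurable borel" "fm \<in> borel_measurable borel"
    unfolding fp_def fm_def by measurable
  have fpi: "integrable lborel fp" and fmi: "integrable lborel fm"
    by (rule Bochner_Integration.integrable_bound[OF f1i]; auto simp: fp_def fm_def indicator_def)+
  have nn: "0 \<le> fp s" "0 \<le> fm s" for s by (auto simp: fp_def fm_def)
  have wp: "weight fp" and wm: "weight fm"
    using fpi fmi s0 nn
    by (auto simp: weight_def nn_integral_eq_integral) (auto simp: fp_def fm_def indicator_def)
  have ae: "AE s in lborel. s \<noteq> s\<^sub>0 \<and> ?fI s = f1 s"
    using f1(2) AE_lborel_singleton[of s\<^sub>0] by eventually_elim simp
  have fpm: "indicator {0<..<1} s * max (f s) 0 = fp s \<and> indicator {0<..<1} s * f s = fp s - fm s"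
    if "s \<noteq> s\<^sub>0 \<and> ?fI s = f1 s" for s
  proof (cases "s \<in> {0<..<1}")
    case True
    then have "f1 s = f s" using that by simp
    moreover have "f s \<ge> 0" if "s > s\<^sub>0" using assms(10) True that by auto
    ultimately show ?thesis using True that by (auto simp: fp_def fm_def indicator_def)
  next
    case False
    then show ?thesis using s0 by (auto simp: fp_def fm_def)
  qed
  have fae: "AE s in lborel. indicator {0<..<1} s * max (f s) 0 = fp s"
    "AE s in lborel. indicator {0<..<1} s * f s = fp s - fm s"
    using ae by (eventually_elim, use fpm in blast)+
  have fpos: "(\<integral>\<^sup>+s. ennreal (fp s) \<partial>lborel) > 0"
  proof (rule ccontr)
    assume "\<not> ?thesis"
    then have "(\<integral>\<^sup>+s. ennreal (fp s) \<partial>lborel) = 0" by simp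
    then have "AE s in lborel. fp s = 0"
      using nn by (subst (asm) nn_integral_0_iff_AE) (auto simp: ennreal_eq_0_iff antisym elim: eventually_mono)
    then have "AE s in lborel. indicator {s\<^sub>0<..<1} s *\<^sub>R f s = 0"
      using ae
    proof eventually_elim
      case (elim s)
      then show ?case
        using fpm[OF elim(2)] s0 by (cases "s \<in> {s\<^sub>0<..<1}") (auto simp: fm_def)
    qed
    then have "AE s in lebesgue. indicator {s\<^sub>0<..<1} s *\<^sub>R f s = 0" by (rule AE_completion)
    then have "(LINT s:{s\<^sub>0<..<1}|lebesgue. f s) = 0"
      unfolding set_lebesgue_integral_def by (rule integral_eq_zero_AE)
    then show False using assms(11) by simp
  qed
  let ?S = "{0<..<s\<^sub>0}" and ?S' = "{s\<^sub>0<..<1 - \<delta>}"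
  have neg: "(LINT s:?S|lebesgue. max 0 (- f s)) = (LINT s|lborel. fm s)"
    unfolding set_lebesgue_integral_def
  proof (rule integrable_completion_AE(2)[OF fmi])
    show "AE s in lborel. indicator ?S s *\<^sub>R max 0 (- f s) = fm s"
      using ae by eventually_elim (use s0 in \<open>auto simp: fm_def indicator_def\<close>)
  qed
  have fpS: "integrable lborel (\<lambda>s. fp s * indicator ?S' s)"
    by (rule Bochner_Integration.integrable_bound[OF fpi]) (auto simp: indicator_def nn)
  have pos: "(LINT s:?S'|lebesgue. f s) = (LINT s|lborel. fp s * indicator ?S' s)"
    unfolding set_lebesgue_integral_def
  proof (rule integrable_completion_AE(2)[OF fpS])
    show "AE s in lborel. indicator ?S' s *\<^sub>R f s = fp s * indicator ?S' s"
      using ae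
    proof eventually_elim
      case (elim s)
      then show ?case
        using fpm[OF elim] s0 \<delta> by (cases "s \<in> ?S'") (auto simp: fm_def)
    qed
  qed
  have le: "(\<integral>\<^sup>+s. ennreal (fm s) * indicator ?S s \<partial>lborel)
      \<le> ennreal (\<kappa>' * \<delta>) * (\<integral>\<^sup>+s. ennreal (fp s) * indicator ?S' s \<partial>lborel)"
  proof -
    have "(\<integral>\<^sup>+s. ennreal (fm s) * indicator ?S s \<partial>lborel) = (\<integral>\<^sup>+s. ennreal (fm s) \<partial>lborel)"
      by (intro nn_integral_cong) (auto simp: fm_def indicator_def)
    also have "\<dots> = ennreal (LINT s|lborel. fm s)" using fmi nn by (intro nn_integral_eq_integral) auto
    also have "\<dots> \<le> ennreal (\<kappa>' * \<delta> * (LINT s|lborel. fp s * indicator ?S' s))"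
      using assms(16) unfolding neg pos by (rule ennreal_leI)
    also have "\<dots> = ennreal (\<kappa>' * \<delta>) * ennreal (LINT s|lborel. fp s * indicator ?S' s)"
      using \<open>0 < \<kappa>'\<close> \<delta> by (intro ennreal_mult') auto
    also have "ennreal (LINT s|lborel. fp s * indicator ?S' s) = (\<integral>\<^sup>+s. ennreal (fp s * indicator ?S' s) \<partial>lborel)"
      using fpS nn by (intro nn_integral_eq_integral[symmetric]) auto
    also have "\<dots> = (\<integral>\<^sup>+s. ennreal (fp s) * indicator ?S' s \<partial>lborel)"
      by (intro nn_integral_cong) (auto simp: indicator_def)
    finally show ?thesis .
  qed
  \<comment> \<open>The common source of the two locale conditions: \<open>W\<close> is the kernel
    at a fixed z in one case and the tail mass in the other, both as functions of the order.\<close>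
  have comparison: "(\<integral>\<^sup>+s. ennreal (fm s) * ennreal (W s) \<partial>lborel) \<le> ennreal (1 / 4) * (\<integral>\<^sup>+s. ennreal (fp s) * ennreal (W s) \<partial>lborel)"
    if [measurable]: "W \<in> borel_measurable borel" and "\<And>s s'. s \<in> ?S \<Longrightarrow> s' \<in> ?S' \<Longrightarrow> W s \<le> B * W s'" for W :: "real \<Rightarrow> real"
  proof -
    have "(\<integral>\<^sup>+s. ennreal (fm s) * ennreal (W s) \<partial>lborel) \<le> ennreal (\<kappa>' * \<delta> * B) * (\<integral>\<^sup>+s. ennreal (fp s) * ennreal (W s) \<partial>lborel)"
    proof (rule nn_integral_weight_comparison[OF _ _ _ weight_finite[OF wp] _ _ le])
      show "fm s \<le> 0" if "s \<notin> ?S" for s using that by (simp add: fm_def)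
      show "ennreal (W s) \<le> ennreal B * ennreal (W s')" if "s \<in> ?S" "s' \<in> ?S'" for s s'
        using \<open>\<And>s s'. s \<in> ?S \<Longrightarrow> s' \<in> ?S' \<Longrightarrow> W s \<le> B * W s'\<close>[OF that] B
        by (simp add: ennreal_leI flip: ennreal_mult')
    qed (use \<open>0 < \<kappa>'\<close> \<delta> B in auto)
    also have "\<dots> \<le> ennreal (1 / 4) * (\<integral>\<^sup>+s. ennreal (fp s) * ennreal (W s) \<partial>lborel)"
      by (intro mult_right_mono ennreal_leI cB) simp
    finally show ?thesis .
  qed
  have fwm: "frac_weight ?N p \<in> borel_measurable borel"
    using borel_measurable_frac_weight[of ?N p] N p by simp
  have S1: "s \<in> {0<..<1}" if "s \<in> ?S \<or> s \<in> ?S'" for s using that s0 \<delta> by auto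
  interpret superposition \<Omega> R p fp fm
  proof
    show "Ker p fm z \<le> Ker p fp z / 4" if z: "0 < norm z" "norm z < 2 * R" for z :: "real ^ 'n"
    proof -
      have "ennreal (Ker p fm z) \<le> ennreal (1 / 4) * ennreal (Ker p fp z)"
        unfolding ennreal_Ker[OF p(2) wp] ennreal_Ker[OF p(2) wm]
      proof (rule comparison)
        show "(\<lambda>s. kern p s z) \<in> borel_measurable borel" unfolding kern_def using fwm by measurable
        fix s s' assume s: "s \<in> ?S" "s' \<in> ?S'"
        \<comment> \<open>The factor |z|^(-N) does not depend on the order and drops out of the
          comparison.\<close>
        have k: "kern p s z = norm z powr (- real ?N) * (frac_const ?N p s * norm z powr (- (s * p)))"
          if "s \<in> {0<..<1}" for s
        proof -
          have "norm z powr (- (real ?N + s * p)) = norm z powr (- real ?N) * norm z powr (- (s * p))"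
            by (simp flip: powr_add)
          then have "inverse (norm z powr (real ?N + s * p)) = norm z powr (- real ?N) * norm z powr (- (s * p))"
            by (simp only: powr_minus)
          then show ?thesis using that by (simp add: kern_def frac_weight_def divide_inverse)
        qed
        have "frac_const ?N p s * norm z powr (- (s * p)) \<le> B * (frac_const ?N p s' * norm z powr (- (s' * p)))"
          unfolding B_def \<mu>_def using s s0 \<delta> z low p N by (intro frac_const_comparison(1)) auto
        then have "norm z powr (- real ?N) * (frac_const ?N p s * norm z powr (- (s * p)))
          \<le> norm z powr (- real ?N) * (B * (frac_const ?N p s' * norm z powr (- (s' * p))))"
          by (rule mult_left_mono) simp
        then show "kern p s z \<le> B * kern p s' z"
          using k[of s] k[of s'] S1 s by (simp add: mult.left_commute)
      qed
      also have "\<dots> = ennreal (Ker p fp z / 4)"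
        using Ker_nonneg[of p fp z] by (simp flip: ennreal_mult)
      finally show ?thesis using Ker_nonneg[of p fp z] by (simp add: ennreal_le_iff)
    qed
    show "mass ?N p R fm \<le> mass ?N p R fp / 4"
    proof -
      have e: "ennreal (mass ?N p R \<phi>) = (\<integral>\<^sup>+s. ennreal (\<phi> s) * ennreal (tail_mass ?N p R s) \<partial>lborel)"
        if "weight \<phi>" for \<phi>
        using Ker_tail(2)[OF p(2) that \<open>R > 0\<close>, where 'n = 'n] by (simp add: mass_def)
      have "ennreal (mass ?N p R fm) \<le> ennreal (1 / 4) * ennreal (mass ?N p R fp)"
        unfolding e[OF wp] e[OF wm]
      proof (rule comparison)
        show "tail_mass ?N p R \<in> borel_measurable borel" unfolding tail_mass_def using fwm by measurable
        fix s s' assume s: "s \<in> ?S" "s' \<in> ?S'"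
        let ?c = "?N * unit_ball_vol ?N / p"
        have k: "tail_mass ?N p R s = ?c * (frac_const ?N p s * (2 * R) powr (- (s * p)) / s)"
          if "s \<in> {0<..<1}" for s
          using that by (simp add: tail_mass_def frac_weight_def mult_ac)
        \<comment> \<open>Tail masses carry an additional 1 / s from the radial integration, hence
          the second inequality, taken at r = 2R.\<close>
        have "frac_const ?N p s * (2 * R) powr (- (s * p)) / s
            \<le> B * (frac_const ?N p s' * (2 * R) powr (- (s' * p)) / s')"
          unfolding B_def \<mu>_def using s s0 \<delta> \<open>R > 0\<close> low p N by (intro frac_const_comparison(2)) auto
        then have "?c * (frac_const ?N p s * (2 * R) powr (- (s * p)) / s)
            \<le> ?c * (B * (frac_const ?N p s' * (2 * R) powr (- (s' * p)) / s'))"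
          using p by (intro mult_left_mono) auto
        then show "tail_mass ?N p R s \<le> B * tail_mass ?N p R s'"
          unfolding k[OF S1[OF disjI1[OF s(1)]]] k[OF S1[OF disjI2[OF s(2)]]]
          by (simp only: mult.left_commute[of B])
      qed
      also have "\<dots> = ennreal (mass ?N p R fp / 4)"
        using mass_nonneg[of ?N p R fp] by (simp flip: ennreal_mult)
      finally show ?thesis using mass_nonneg[of ?N p R fp] by (simp add: ennreal_le_iff)
    qed
  qed (use assms(1,3,4,5) p wp wm fpos in auto)
  \<comment> \<open>The critical exponent exceeds p because it exceeds q, which is at least
    p.\<close>
  obtain \<Lambda> where \<Lambda>: "\<Lambda> > 0" "\<And>lam. 0 < lam \<Longrightarrow> lam < \<Lambda> \<Longrightarrow>
    \<exists>u. weak_solution f p \<Omega>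
          (\<lambda>t. rpow \<bar>t\<bar> (crit_exp ?N p s\<^sub>0 - 2) * t + lam * (rpow \<bar>t\<bar> (m - 1) + rpow \<bar>t\<bar> (q - 1))) u \<and>
        (\<forall>x. u x \<ge> 0) \<and> \<not> (AE x in lebesgue. u x = 0)"
    by (rule exists_weak_solutions[OF fae \<open>1 \<le> m\<close> \<open>m < p\<close>, of q "crit_exp ?N p s\<^sub>0"])
       (use p \<open>p \<le> q\<close> \<open>q < crit_exp ?N p s\<^sub>0\<close> in auto)
  show ?thesis
    by (rule exI[of _ "{0<..<\<Lambda>}"]) (use \<Lambda> in \<open>auto simp: is_interval_1\<close>)
qed

end
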